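(* Let $\mathcal{A}$, $\mathcal{X}$, $\mathcal{Y}$ be abelian categories with a recollement of $\mathcal{A}$ by $\mathcal{Y}$ and $\mathcal{X}$, given by functors $i^*,i_*,i^!,j_!,j^*,j_*$, such that $i^*$ is exact and $\mathcal{A}$ is AB3. Then $\mathcal{A}$ is a Grothendieck category if and only if $\mathcal{X}$ and $\mathcal{Y}$ are Grothendieck abelian categories and there exists a generator $G_{\mathcal{X}}$ of $\mathcal{X}$ such that $\mathrm{Im}(j_* )\subseteq\mathsf{Gen}(j_*G_{\mathcal{X}})$.
   Context: Standing assumption: in every abelian category considered, $\mathrm{Ext}^1(X,Y)$ (Yoneda extensions) is a set for all objects $X,Y$. A recollement of an abelian category $\mathcal{A}$ by abelian categories $\mathcal{Y}$ and $\mathcal{X}$ consists of additive functors $i_*:\mathcal{Y}\to\mathcal{A}$, $i^*,i^!:\mathcal{A}\to\mathcal{Y}$, $j^*:\mathcal{A}\to\mathcal{X}$, $j_!,j_*:\mathcal{X}\to\mathcal{A}$ such that (i) $i^*\dashv i_*\dashv i^!$ and $j_!\dashv j^*\dashv j_*$; (ii) $i_*,j_!,j_*$ are fully faithful; (iii) $\mathrm{Im}(i_* )=\mathrm{Ker}(j^* )$ (essential image). AB3: set-indexed coproducts exist. AB5: AB3 and direct limits over directed sets are exact. A generator is an object $G$ such that $\mathrm{Hom}(G,\phi)\neq0$ for every nonzero morphism $\phi$. Grothendieck: AB5 with a generator. $\mathsf{Gen}(X)$ denotes the class of quotients of set-indexed coproducts of copies of $X$. *)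

theory Defs
  imports Main "HOL-Algebra.Group"
begin

unbundle cardinal_syntax

section \<open>Sets versus classes\<close>

text \<open>
  Set-theoretic size is measured by a cardinal \<open>\<kappa>\<close>: a collection counts as a ``set'' iff its
  cardinality is below \<open>\<kappa>\<close>. Only uncountability and regularity are required; an inaccessible
  \<open>\<kappa>\<close> gives the sets of a Grothendieck universe. The underlying type \<open>'u\<close> of \<open>\<kappa>\<close> also provides the
  index sets: every collection of cardinality below \<open>\<kappa>\<close>, of whatever type, is in bijection with a
  subset of \<open>'u\<close>.
\<close>

definition size_cardinal :: "'u rel \<Rightarrow> bool" where
  "size_cardinal \<kappa> \<longleftrightarrow> Card_order \<kappa> \<and> regularCard \<kappa> \<and> natLeq <o \<kappa>"

definition is_set :: "'u rel \<Rightarrow> 'a set \<Rightarrow> bool" where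
  "is_set \<kappa> S \<longleftrightarrow> |S| <o \<kappa>"

section \<open>Abelian categories\<close>

record ('o, 'm) addcat =
  Obj :: "'o set"
  Arr :: "'m set"
  Dom :: "'m \<Rightarrow> 'o"
  Cod :: "'m \<Rightarrow> 'o"
  Ide :: "'o \<Rightarrow> 'm"
  Cmp :: "'m \<Rightarrow> 'm \<Rightarrow> 'm" (infixl "\<cdot>\<index>" 70)
  Add :: "'m \<Rightarrow> 'm \<Rightarrow> 'm"
  Zer :: "'o \<Rightarrow> 'o \<Rightarrow> 'm"

definition Hom :: "('o, 'm) addcat \<Rightarrow> 'o \<Rightarrow> 'o \<Rightarrow> 'm set" where
  "Hom C a b = {f \<in> Arr C. Dom C f = a \<and> Cod C f = b}"

definition hom_group :: "('o, 'm) addcat \<Rightarrow> 'o \<Rightarrow> 'o \<Rightarrow> 'm monoid" where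
  "hom_group C a b = \<lparr>carrier = Hom C a b, monoid.mult = Add C, one = Zer C a b\<rparr>"

text \<open>Composition \<open>g \<cdot>\<^bsub>C\<^esub> f\<close> is in applicative order and is meaningful only if \<open>Cod C f = Dom C g\<close>.\<close>

locale category =
  fixes C :: "('o, 'm) addcat" (structure)
  assumes Dom_Obj: "f \<in> Arr C \<Longrightarrow> Dom C f \<in> Obj C"
    and Cod_Obj: "f \<in> Arr C \<Longrightarrow> Cod C f \<in> Obj C"
    and Ide_Hom: "a \<in> Obj C \<Longrightarrow> Ide C a \<in> Hom C a a"
    and Cmp_Hom: "f \<in> Hom C a b \<Longrightarrow> g \<in> Hom C b c \<Longrightarrow> g \<cdot> f \<in> Hom C a c"
    and Cmp_Ide_right: "f \<in> Hom C a b \<Longrightarrow> f \<cdot> Ide C a = f"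
    and Cmp_Ide_left: "f \<in> Hom C a b \<Longrightarrow> Ide C b \<cdot> f = f"
    and Cmp_assoc: "f \<in> Hom C a b \<Longrightarrow> g \<in> Hom C b c \<Longrightarrow> h \<in> Hom C c d
      \<Longrightarrow> (h \<cdot> g) \<cdot> f = h \<cdot> (g \<cdot> f)"

locale preadditive_category = category +
  assumes Hom_comm_group: "a \<in> Obj C \<Longrightarrow> b \<in> Obj C \<Longrightarrow> comm_group (hom_group C a b)"
    and Cmp_Add_right: "f \<in> Hom C a b \<Longrightarrow> f' \<in> Hom C a b \<Longrightarrow> g \<in> Hom C b c
      \<Longrightarrow> g \<cdot> Add C f f' = Add C (g \<cdot> f) (g \<cdot> f')"
    and Cmp_Add_left: "f \<in> Hom C a b \<Longrightarrow> g \<in> Hom C b c \<Longrightarrow> g' \<in> Hom C b c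
      \<Longrightarrow> Add C g g' \<cdot> f = Add C (g \<cdot> f) (g' \<cdot> f)"

definition is_iso :: "('o, 'm) addcat \<Rightarrow> 'm \<Rightarrow> bool" where
  "is_iso C f \<longleftrightarrow> f \<in> Arr C \<and> (\<exists>g \<in> Hom C (Cod C f) (Dom C f).
     g \<cdot>\<^bsub>C\<^esub> f = Ide C (Dom C f) \<and> f \<cdot>\<^bsub>C\<^esub> g = Ide C (Cod C f))"

definition isomorphic :: "('o, 'm) addcat \<Rightarrow> 'o \<Rightarrow> 'o \<Rightarrow> bool" where
  "isomorphic C a b \<longleftrightarrow> (\<exists>f \<in> Hom C a b. is_iso C f)"

definition is_mono :: "('o, 'm) addcat \<Rightarrow> 'm \<Rightarrow> bool" where
  "is_mono C f \<longleftrightarrow> f \<in> Arr C \<and> (\<forall>a. \<forall>g \<in> Hom C a (Dom C f). \<forall>h \<in> Hom C a (Dom C f).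
     f \<cdot>\<^bsub>C\<^esub> g = f \<cdot>\<^bsub>C\<^esub> h \<longrightarrow> g = h)"

definition is_epi :: "('o, 'm) addcat \<Rightarrow> 'm \<Rightarrow> bool" where
  "is_epi C f \<longleftrightarrow> f \<in> Arr C \<and> (\<forall>b. \<forall>g \<in> Hom C (Cod C f) b. \<forall>h \<in> Hom C (Cod C f) b.
     g \<cdot>\<^bsub>C\<^esub> f = h \<cdot>\<^bsub>C\<^esub> f \<longrightarrow> g = h)"

definition is_zero_object :: "('o, 'm) addcat \<Rightarrow> 'o \<Rightarrow> bool" where
  "is_zero_object C z \<longleftrightarrow> z \<in> Obj C \<and>
     (\<forall>a \<in> Obj C. (\<exists>!f. f \<in> Hom C z a) \<and> (\<exists>!f. f \<in> Hom C a z))"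

definition is_kernel :: "('o, 'm) addcat \<Rightarrow> 'm \<Rightarrow> 'm \<Rightarrow> bool" where
  "is_kernel C k f \<longleftrightarrow> f \<in> Arr C \<and> k \<in> Arr C \<and> Cod C k = Dom C f \<and>
     f \<cdot>\<^bsub>C\<^esub> k = Zer C (Dom C k) (Cod C f) \<and>
     (\<forall>a. \<forall>g \<in> Hom C a (Dom C f). f \<cdot>\<^bsub>C\<^esub> g = Zer C a (Cod C f) \<longrightarrow>
        (\<exists>!u. u \<in> Hom C a (Dom C k) \<and> k \<cdot>\<^bsub>C\<^esub> u = g))"

definition is_cokernel :: "('o, 'm) addcat \<Rightarrow> 'm \<Rightarrow> 'm \<Rightarrow> bool" where
  "is_cokernel C q f \<longleftrightarrow> f \<in> Arr C \<and> q \<in> Arr C \<and> Dom C q = Cod C f \<and>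
     q \<cdot>\<^bsub>C\<^esub> f = Zer C (Dom C f) (Cod C q) \<and>
     (\<forall>b. \<forall>g \<in> Hom C (Cod C f) b. g \<cdot>\<^bsub>C\<^esub> f = Zer C (Dom C f) b \<longrightarrow>
        (\<exists>!u. u \<in> Hom C (Cod C q) b \<and> u \<cdot>\<^bsub>C\<^esub> q = g))"

definition is_biproduct :: "('o, 'm) addcat \<Rightarrow> 'o \<Rightarrow> 'o \<Rightarrow> 'o \<Rightarrow> 'm \<Rightarrow> 'm \<Rightarrow> 'm \<Rightarrow> 'm \<Rightarrow> bool" where
  "is_biproduct C a b s \<iota>\<^sub>1 \<iota>\<^sub>2 \<pi>\<^sub>1 \<pi>\<^sub>2 \<longleftrightarrow>
     \<iota>\<^sub>1 \<in> Hom C a s \<and> \<iota>\<^sub>2 \<in> Hom C b s \<and> \<pi>\<^sub>1 \<in> Hom C s a \<and> \<pi>\<^sub>2 \<in> Hom C s b \<and>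
     \<pi>\<^sub>1 \<cdot>\<^bsub>C\<^esub> \<iota>\<^sub>1 = Ide C a \<and> \<pi>\<^sub>2 \<cdot>\<^bsub>C\<^esub> \<iota>\<^sub>2 = Ide C b \<and>
     \<pi>\<^sub>1 \<cdot>\<^bsub>C\<^esub> \<iota>\<^sub>2 = Zer C b a \<and> \<pi>\<^sub>2 \<cdot>\<^bsub>C\<^esub> \<iota>\<^sub>1 = Zer C a b \<and>
     Add C (\<iota>\<^sub>1 \<cdot>\<^bsub>C\<^esub> \<pi>\<^sub>1) (\<iota>\<^sub>2 \<cdot>\<^bsub>C\<^esub> \<pi>\<^sub>2) = Ide C s"

locale abelian_category = preadditive_category +
  assumes zero_object: "\<exists>z. is_zero_object C z"
    and biproducts: "a \<in> Obj C \<Longrightarrow> b \<in> Obj C \<Longrightarrow> \<exists>s \<iota>\<^sub>1 \<iota>\<^sub>2 \<pi>\<^sub>1 \<pi>\<^sub>2. is_biproduct C a b s \<iota>\<^sub>1 \<iota>\<^sub>2 \<pi>\<^sub>1 \<pi>\<^sub>2"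
    and kernels: "f \<in> Arr C \<Longrightarrow> \<exists>k. is_kernel C k f"
    and cokernels: "f \<in> Arr C \<Longrightarrow> \<exists>q. is_cokernel C q f"
    and mono_normal: "is_mono C f \<Longrightarrow> \<exists>g. is_kernel C f g"
    and epi_normal: "is_epi C f \<Longrightarrow> \<exists>g. is_cokernel C f g"

definition short_exact :: "('o, 'm) addcat \<Rightarrow> 'm \<Rightarrow> 'm \<Rightarrow> bool" where
  "short_exact C f g \<longleftrightarrow> is_kernel C f g \<and> is_cokernel C g f"

section \<open>Size conditions and Yoneda extensions\<close>

definition hom_sets :: "'u rel \<Rightarrow> ('o, 'm) addcat \<Rightarrow> bool" where
  "hom_sets \<kappa> C \<longleftrightarrow> (\<forall>a \<in> Obj C. \<forall>b \<in> Obj C. is_set \<kappa> (Hom C a b))"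

text \<open>An extension \<open>0 \<rightarrow> y \<rightarrow> e \<rightarrow> x \<rightarrow> 0\<close> of \<open>x\<close> by \<open>y\<close> is the pair of its two inner arrows.\<close>

definition extensions :: "('o, 'm) addcat \<Rightarrow> 'o \<Rightarrow> 'o \<Rightarrow> ('m \<times> 'm) set" where
  "extensions C x y = {(f, g). short_exact C f g \<and> Dom C f = y \<and> Cod C g = x}"

definition yoneda_rel :: "('o, 'm) addcat \<Rightarrow> 'o \<Rightarrow> 'o \<Rightarrow> ('m \<times> 'm) rel" where
  "yoneda_rel C x y = {((f, g), (f', g')). (f, g) \<in> extensions C x y \<and> (f', g') \<in> extensions C x y \<and>
     (\<exists>u \<in> Hom C (Cod C f) (Cod C f'). is_iso C u \<and> u \<cdot>\<^bsub>C\<^esub> f = f' \<and> g' \<cdot>\<^bsub>C\<^esub> u = g)}"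

definition Ext1 :: "('o, 'm) addcat \<Rightarrow> 'o \<Rightarrow> 'o \<Rightarrow> ('m \<times> 'm) set set" where
  "Ext1 C x y = extensions C x y // yoneda_rel C x y"

definition ext1_sets :: "'u rel \<Rightarrow> ('o, 'm) addcat \<Rightarrow> bool" where
  "ext1_sets \<kappa> C \<longleftrightarrow> (\<forall>x \<in> Obj C. \<forall>y \<in> Obj C. is_set \<kappa> (Ext1 C x y))"

section \<open>Grothendieck categories\<close>

definition is_coproduct ::
  "('o, 'm) addcat \<Rightarrow> 'i set \<Rightarrow> ('i \<Rightarrow> 'o) \<Rightarrow> 'o \<Rightarrow> ('i \<Rightarrow> 'm) \<Rightarrow> bool" where
  "is_coproduct C I A S \<iota> \<longleftrightarrow> S \<in> Obj C \<and> (\<forall>i \<in> I. \<iota> i \<in> Hom C (A i) S) \<and>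
     (\<forall>T \<in> Obj C. \<forall>f. (\<forall>i \<in> I. f i \<in> Hom C (A i) T) \<longrightarrow>
        (\<exists>!u. u \<in> Hom C S T \<and> (\<forall>i \<in> I. u \<cdot>\<^bsub>C\<^esub> \<iota> i = f i)))"

definition AB3 :: "'u rel \<Rightarrow> ('o, 'm) addcat \<Rightarrow> bool" where
  "AB3 \<kappa> C \<longleftrightarrow> (\<forall>(I :: 'u set) A. is_set \<kappa> I \<and> (\<forall>i \<in> I. A i \<in> Obj C) \<longrightarrow>
     (\<exists>S \<iota>. is_coproduct C I A S \<iota>))"

definition directed_set :: "'i set \<Rightarrow> 'i rel \<Rightarrow> bool" where
  "directed_set I r \<longleftrightarrow> I \<noteq> {} \<and> preorder_on I r \<and>
     (\<forall>i \<in> I. \<forall>j \<in> I. \<exists>k \<in> I. (i, k) \<in> r \<and> (j, k) \<in> r)"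

definition direct_system ::
  "('o, 'm) addcat \<Rightarrow> 'i set \<Rightarrow> 'i rel \<Rightarrow> ('i \<Rightarrow> 'o) \<Rightarrow> ('i \<Rightarrow> 'i \<Rightarrow> 'm) \<Rightarrow> bool" where
  "direct_system C I r A \<alpha> \<longleftrightarrow> (\<forall>i \<in> I. A i \<in> Obj C) \<and>
     (\<forall>i j. (i, j) \<in> r \<longrightarrow> \<alpha> i j \<in> Hom C (A i) (A j)) \<and>
     (\<forall>i \<in> I. \<alpha> i i = Ide C (A i)) \<and>
     (\<forall>i j k. (i, j) \<in> r \<and> (j, k) \<in> r \<longrightarrow> \<alpha> j k \<cdot>\<^bsub>C\<^esub> \<alpha> i j = \<alpha> i k)"

definition direct_system_map ::
  "('o, 'm) addcat \<Rightarrow> 'i set \<Rightarrow> 'i rel \<Rightarrow> ('i \<Rightarrow> 'o) \<Rightarrow> ('i \<Rightarrow> 'i \<Rightarrow> 'm)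
     \<Rightarrow> ('i \<Rightarrow> 'o) \<Rightarrow> ('i \<Rightarrow> 'i \<Rightarrow> 'm) \<Rightarrow> ('i \<Rightarrow> 'm) \<Rightarrow> bool" where
  "direct_system_map C I r A \<alpha> B \<beta> f \<longleftrightarrow> (\<forall>i \<in> I. f i \<in> Hom C (A i) (B i)) \<and>
     (\<forall>i j. (i, j) \<in> r \<longrightarrow> f j \<cdot>\<^bsub>C\<^esub> \<alpha> i j = \<beta> i j \<cdot>\<^bsub>C\<^esub> f i)"

definition is_cocone ::
  "('o, 'm) addcat \<Rightarrow> 'i set \<Rightarrow> 'i rel \<Rightarrow> ('i \<Rightarrow> 'o) \<Rightarrow> ('i \<Rightarrow> 'i \<Rightarrow> 'm)
     \<Rightarrow> 'o \<Rightarrow> ('i \<Rightarrow> 'm) \<Rightarrow> bool" where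
  "is_cocone C I r A \<alpha> T t \<longleftrightarrow> T \<in> Obj C \<and> (\<forall>i \<in> I. t i \<in> Hom C (A i) T) \<and>
     (\<forall>i j. (i, j) \<in> r \<longrightarrow> t j \<cdot>\<^bsub>C\<^esub> \<alpha> i j = t i)"

definition is_direct_limit ::
  "('o, 'm) addcat \<Rightarrow> 'i set \<Rightarrow> 'i rel \<Rightarrow> ('i \<Rightarrow> 'o) \<Rightarrow> ('i \<Rightarrow> 'i \<Rightarrow> 'm)
     \<Rightarrow> 'o \<Rightarrow> ('i \<Rightarrow> 'm) \<Rightarrow> bool" where
  "is_direct_limit C I r A \<alpha> L l \<longleftrightarrow> is_cocone C I r A \<alpha> L l \<and>
     (\<forall>T t. is_cocone C I r A \<alpha> T t \<longrightarrow>
        (\<exists>!u. u \<in> Hom C L T \<and> (\<forall>i \<in> I. u \<cdot>\<^bsub>C\<^esub> l i = t i)))"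

text \<open>
  Exactness of direct limits: the morphisms \<open>u\<close>, \<open>v\<close> induced on direct limits by a short exact
  sequence of direct systems again form a short exact sequence.
\<close>

definition direct_limits_exact :: "'u rel \<Rightarrow> ('o, 'm) addcat \<Rightarrow> bool" where
  "direct_limits_exact \<kappa> C \<longleftrightarrow> (\<forall>(I :: 'u set) r A \<alpha> B \<beta> D \<delta> f g L l M m N n u v.
     is_set \<kappa> I \<and> directed_set I r \<and>
     direct_system C I r A \<alpha> \<and> direct_system C I r B \<beta> \<and> direct_system C I r D \<delta> \<and>
     direct_system_map C I r A \<alpha> B \<beta> f \<and> direct_system_map C I r B \<beta> D \<delta> g \<and>
     (\<forall>i \<in> I. short_exact C (f i) (g i)) \<and>
     is_direct_limit C I r A \<alpha> L l \<and> is_direct_limit C I r B \<beta> M m \<and>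
     is_direct_limit C I r D \<delta> N n \<and>
     u \<in> Hom C L M \<and> (\<forall>i \<in> I. u \<cdot>\<^bsub>C\<^esub> l i = m i \<cdot>\<^bsub>C\<^esub> f i) \<and>
     v \<in> Hom C M N \<and> (\<forall>i \<in> I. v \<cdot>\<^bsub>C\<^esub> m i = n i \<cdot>\<^bsub>C\<^esub> g i)
     \<longrightarrow> short_exact C u v)"

definition AB5 :: "'u rel \<Rightarrow> ('o, 'm) addcat \<Rightarrow> bool" where
  "AB5 \<kappa> C \<longleftrightarrow> AB3 \<kappa> C \<and> direct_limits_exact \<kappa> C"

text \<open>\<open>Hom(G, \<phi>)\<close> is postcomposition with \<open>\<phi>\<close>; it is nonzero iff it takes a nonzero value.\<close>

definition is_generator :: "('o, 'm) addcat \<Rightarrow> 'o \<Rightarrow> bool" where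
  "is_generator C G \<longleftrightarrow> G \<in> Obj C \<and>
     (\<forall>a b. \<forall>\<phi> \<in> Hom C a b. \<phi> \<noteq> Zer C a b \<longrightarrow> (\<exists>h \<in> Hom C G a. \<phi> \<cdot>\<^bsub>C\<^esub> h \<noteq> Zer C G b))"

definition grothendieck_category :: "'u rel \<Rightarrow> ('o, 'm) addcat \<Rightarrow> bool" where
  "grothendieck_category \<kappa> C \<longleftrightarrow> abelian_category C \<and> AB5 \<kappa> C \<and> (\<exists>G. is_generator C G)"

definition Gen :: "'u rel \<Rightarrow> ('o, 'm) addcat \<Rightarrow> 'o \<Rightarrow> 'o set" where
  "Gen \<kappa> C X = {B \<in> Obj C. \<exists>(I :: 'u set) S \<iota> p. is_set \<kappa> I \<and> is_coproduct C I (\<lambda>_. X) S \<iota> \<and>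
     p \<in> Hom C S B \<and> is_epi C p}"

section \<open>Functors and recollements\<close>

record ('o, 'm, 'p, 'n) cat_functor =
  Fobj :: "'o \<Rightarrow> 'p"
  Farr :: "'m \<Rightarrow> 'n"

locale additive_functor =
  dom: preadditive_category C + cod: preadditive_category D
  for C :: "('o, 'm) addcat" and D :: "('p, 'n) addcat" and F :: "('o, 'm, 'p, 'n) cat_functor" +
  assumes Fobj_Obj: "a \<in> Obj C \<Longrightarrow> Fobj F a \<in> Obj D"
    and Farr_Hom: "f \<in> Hom C a b \<Longrightarrow> Farr F f \<in> Hom D (Fobj F a) (Fobj F b)"
    and Farr_Ide: "a \<in> Obj C \<Longrightarrow> Farr F (Ide C a) = Ide D (Fobj F a)"
    and Farr_Cmp: "f \<in> Hom C a b \<Longrightarrow> g \<in> Hom C b c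
      \<Longrightarrow> Farr F (g \<cdot>\<^bsub>C\<^esub> f) = Farr F g \<cdot>\<^bsub>D\<^esub> Farr F f"
    and Farr_Add: "f \<in> Hom C a b \<Longrightarrow> g \<in> Hom C a b
      \<Longrightarrow> Farr F (Add C f g) = Add D (Farr F f) (Farr F g)"

definition fully_faithful ::
  "('o, 'm) addcat \<Rightarrow> ('p, 'n) addcat \<Rightarrow> ('o, 'm, 'p, 'n) cat_functor \<Rightarrow> bool" where
  "fully_faithful C D F \<longleftrightarrow> (\<forall>a \<in> Obj C. \<forall>b \<in> Obj C.
     bij_betw (Farr F) (Hom C a b) (Hom D (Fobj F a) (Fobj F b)))"

definition exact_functor ::
  "('o, 'm) addcat \<Rightarrow> ('p, 'n) addcat \<Rightarrow> ('o, 'm, 'p, 'n) cat_functor \<Rightarrow> bool" where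
  "exact_functor C D F \<longleftrightarrow> (\<forall>f g. short_exact C f g \<longrightarrow> short_exact D (Farr F f) (Farr F g))"

text \<open>\<open>left_adjoint C D F G\<close>: the functor \<open>F : C \<rightarrow> D\<close> is left adjoint to \<open>G : D \<rightarrow> C\<close>.\<close>

definition left_adjoint ::
  "('o, 'm) addcat \<Rightarrow> ('p, 'n) addcat \<Rightarrow> ('o, 'm, 'p, 'n) cat_functor \<Rightarrow> ('p, 'n, 'o, 'm) cat_functor \<Rightarrow> bool"
where
  "left_adjoint C D F G \<longleftrightarrow> (\<exists>\<Phi>.
     (\<forall>a \<in> Obj C. \<forall>b \<in> Obj D. bij_betw (\<Phi> a b) (Hom D (Fobj F a) b) (Hom C a (Fobj G b))) \<and>
     (\<forall>a a' b b'. \<forall>f \<in> Hom C a' a. \<forall>g \<in> Hom D b b'. \<forall>h \<in> Hom D (Fobj F a) b.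
        \<Phi> a' b' (g \<cdot>\<^bsub>D\<^esub> h \<cdot>\<^bsub>D\<^esub> Farr F f) = Farr G g \<cdot>\<^bsub>C\<^esub> \<Phi> a b h \<cdot>\<^bsub>C\<^esub> f))"

definition ess_image ::
  "('o, 'm) addcat \<Rightarrow> ('p, 'n) addcat \<Rightarrow> ('o, 'm, 'p, 'n) cat_functor \<Rightarrow> 'p set" where
  "ess_image C D F = {b \<in> Obj D. \<exists>a \<in> Obj C. isomorphic D (Fobj F a) b}"

definition functor_kernel ::
  "('o, 'm) addcat \<Rightarrow> ('p, 'n) addcat \<Rightarrow> ('o, 'm, 'p, 'n) cat_functor \<Rightarrow> 'o set" where
  "functor_kernel C D F = {a \<in> Obj C. is_zero_object D (Fobj F a)}"

text \<open>
  A recollement of \<open>A\<close> by \<open>Y\<close> and \<open>X\<close>. The suffixes \<open>_up\<close>, \<open>_lo\<close> and \<open>_up_sh\<close>, \<open>_lo_sh\<close> stand for upper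
  and lower star and for upper and lower shriek.
\<close>

locale recollement =
  A: abelian_category A + Y: abelian_category Y + X: abelian_category X +
  i_up: additive_functor A Y i_up + i_lo: additive_functor Y A i_lo +
  i_up_sh: additive_functor A Y i_up_sh + j_lo_sh: additive_functor X A j_lo_sh +
  j_up: additive_functor A X j_up + j_lo: additive_functor X A j_lo
  for A :: "('oa, 'ma) addcat" and Y :: "('oy, 'my) addcat" and X :: "('ox, 'mx) addcat"
    and i_up i_lo i_up_sh j_lo_sh j_up j_lo +
  assumes i_up_i_lo_adjoint: "left_adjoint A Y i_up i_lo"
    and i_lo_i_up_sh_adjoint: "left_adjoint Y A i_lo i_up_sh"
    and j_lo_sh_j_up_adjoint: "left_adjoint X A j_lo_sh j_up"
    and j_up_j_lo_adjoint: "left_adjoint A X j_up j_lo"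
    and i_lo_fully_faithful: "fully_faithful Y A i_lo"
    and j_lo_sh_fully_faithful: "fully_faithful X A j_lo_sh"
    and j_lo_fully_faithful: "fully_faithful X A j_lo"
    and image_i_lo_eq_kernel_j_up: "ess_image Y A i_lo = functor_kernel A X j_up"

end

theory Submission
  imports Defs
begin

text \<open>
  The two outer functors \<open>i_up\<close> and \<open>j_up\<close> see everything: an object of \<open>A\<close> killed by \<open>j_up\<close> lies in the
  image of \<open>i_lo\<close>, so it vanishes if \<open>i_up\<close> kills it too (\<open>zero_object_if_both_zero\<close>). Both functors
  are left adjoints, hence preserve direct limits, and both are exact: \<open>i_up\<close> by assumption, \<open>j_up\<close>
  because it has adjoints on both sides. This settles most of the proposition by
  transport: if direct limits are exact in \<open>X\<close> and \<open>Y\<close>, the kernel of a limit of monomorphisms in \<open>A\<close>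
  is killed by both functors and hence zero (\<open>direct_limits_exact_middle\<close>). Conversely \<open>X\<close> and
  \<open>Y\<close> are reflective in \<open>A\<close>, along \<open>j_lo\<close> and \<open>i_lo\<close>, which gives coproducts and generators, while
  exactness of limits is reflected by the fully faithful exact left adjoints \<open>j_lo_sh\<close> and \<open>i_lo\<close>.
  For a generator \<open>G\<close> of \<open>A\<close>, any arrow from \<open>G\<close> to some \<open>j_lo x\<close> factors through the unit
  \<open>G \<rightarrow> j_lo (j_up G)\<close>, so the images under \<open>j_lo\<close> are generated by \<open>j_lo (j_up G)\<close>.

  What remains is to produce a generator of \<open>A\<close> from generators \<open>G\<^sub>X\<close> and \<open>G\<^sub>Y\<close>
  (\<open>generator_middle\<close>). Write \<open>F = i_up j_lo\<close>. Since \<open>i_up\<close> is exact, every object \<open>M\<close> is glued from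
  its two images: it is the pullback of \<open>j_lo (j_up M)\<close> and \<open>i_lo (i_up M)\<close> over
  \<open>i_lo (F (j_up M))\<close> (\<open>gluing_lift\<close>). So \<open>M\<close> amounts to a triple of \<open>x = j_up M\<close>,
  \<open>y = i_up M\<close> and a map \<open>\<alpha> : y \<rightarrow> F x\<close>, and a map to it from the object glued along
  \<open>\<beta> : G\<^sub>Y \<rightarrow> F H\<close> amounts to \<open>s : H \<rightarrow> x\<close> and \<open>g : G\<^sub>Y \<rightarrow> y\<close> with \<open>F s \<cdot> \<beta> = \<alpha> \<cdot> g\<close>.
  The objects glued along all \<open>\<beta>\<close> in the single set \<open>Hom(G\<^sub>Y, F H)\<close>, where \<open>H\<close> is the countable
  copower of \<open>G\<^sub>X\<close>, form a separating family.

  Indeed let \<open>\<phi> : M \<rightarrow> N\<close> be nonzero. If \<open>j_up \<phi>\<close> is nonzero, some \<open>s\<close> detects it, and \<open>\<beta> = 0\<close>,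
  \<open>g = 0\<close> complete \<open>s\<close> to a map from a glued object. Otherwise \<open>i_up \<phi>\<close> is nonzero and has to be
  detected by a \<open>g\<close> such that \<open>\<alpha> \<cdot> g\<close> lifts along some \<open>F s\<close>. By the assumption on the image of
  \<open>j_lo\<close>, the maps \<open>F s\<close> are jointly epimorphic onto \<open>F x\<close>; preordered by factorisation they are
  directed, because two copies of \<open>H\<close> fit into \<open>H\<close>. Exactness of direct limits in \<open>Y\<close> then says that \<open>y\<close>
  is the union of the preimages of the images of the \<open>F s\<close>, so \<open>i_up \<phi>\<close> is nonzero on one of them
  (\<open>generator_lifts_along_directed_family\<close>).
\<close>

section \<open>Calculus in preadditive categories\<close>

context category
begin

text \<open>Membership in a hom set is reduced to equations for domain and codomain. With the rules below, in which
  no object variables occur beyond those of the arrows, the simplifier then decides typing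
  and normalises composites.\<close>

lemma Hom_iff:
  "f \<in> Hom C a b \<longleftrightarrow> f \<in> Arr C \<and> Dom C f = a \<and> Cod C f = b \<and> a \<in> Obj C \<and> b \<in> Obj C"
  using Dom_Obj Cod_Obj by (auto simp: Hom_def)

lemma Arr_Hom: "f \<in> Arr C \<Longrightarrow> f \<in> Hom C (Dom C f) (Cod C f)"
  by (simp add: Hom_def)

lemma HomD: "f \<in> Hom C a b \<Longrightarrow> Dom C f = a" "f \<in> Hom C a b \<Longrightarrow> Cod C f = b"
  by (simp_all add: Hom_def)

lemma Hom_ObjD: "f \<in> Hom C a b \<Longrightarrow> a \<in> Obj C" "f \<in> Hom C a b \<Longrightarrow> b \<in> Obj C"
  by (simp_all add: Hom_iff)

lemma Cmp_typing [simp]: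
  assumes "f \<in> Arr C" "g \<in> Arr C" "Cod C f = Dom C g"
  shows "g \<cdot> f \<in> Arr C" "Dom C (g \<cdot> f) = Dom C f" "Cod C (g \<cdot> f) = Cod C g"
  using Cmp_Hom[of f "Dom C f" "Cod C f" g "Cod C g"] assms by (simp_all add: Hom_def)

lemma Cmp_assoc_Arr [simp]:
  assumes "f \<in> Arr C" "g \<in> Arr C" "h \<in> Arr C" "Cod C f = Dom C g" "Cod C g = Dom C h"
  shows "(h \<cdot> g) \<cdot> f = h \<cdot> (g \<cdot> f)"
  using Cmp_assoc[of f "Dom C f" "Cod C f" g "Cod C g" h "Cod C h"] assms by (simp add: Hom_def)

lemma Ide_typing [simp]:
  assumes "a \<in> Obj C"
  shows "Ide C a \<in> Arr C" "Dom C (Ide C a) = a" "Cod C (Ide C a) = a"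
  using Ide_Hom[OF assms] by (simp_all add: Hom_def)

lemma Cmp_Ide_Arr [simp]:
  assumes "f \<in> Arr C"
  shows "Dom C f = a \<Longrightarrow> f \<cdot> Ide C a = f" "Cod C f = b \<Longrightarrow> Ide C b \<cdot> f = f"
  using Cmp_Ide_right Cmp_Ide_left Arr_Hom[OF assms] by auto

lemma is_monoI_cancel:
  assumes "m \<in> Hom C a b"
    and "\<And>t g h. g \<in> Hom C t a \<Longrightarrow> h \<in> Hom C t a \<Longrightarrow> m \<cdot> g = m \<cdot> h \<Longrightarrow> g = h"
  shows "is_mono C m"
  using assms unfolding is_mono_def by (auto simp: Hom_iff)

lemma mono_cancel:
  assumes "is_mono C m" "m \<in> Hom C a b" "g \<in> Hom C t a" "h \<in> Hom C t a" "m \<cdot> g = m \<cdot> h"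
  shows "g = h"
  using assms unfolding is_mono_def by (auto simp: Hom_iff)

lemma is_epiI_cancel:
  assumes "e \<in> Hom C a b"
    and "\<And>t g h. g \<in> Hom C b t \<Longrightarrow> h \<in> Hom C b t \<Longrightarrow> g \<cdot> e = h \<cdot> e \<Longrightarrow> g = h"
  shows "is_epi C e"
  using assms unfolding is_epi_def by (auto simp: Hom_iff)

lemma epi_cancel:
  assumes "is_epi C e" "e \<in> Hom C a b" "g \<in> Hom C b t" "h \<in> Hom C b t" "g \<cdot> e = h \<cdot> e"
  shows "g = h"
  using assms unfolding is_epi_def by (auto simp: Hom_iff)

lemma is_isoI:
  assumes "f \<in> Hom C a b" "g \<in> Hom C b a" "g \<cdot> f = Ide C a" "f \<cdot> g = Ide C b"
  shows "is_iso C f"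
  using assms unfolding is_iso_def by (auto simp: Hom_iff)

lemma iso_inverse:
  assumes "is_iso C f" "f \<in> Hom C a b"
  obtains g where "g \<in> Hom C b a" "g \<cdot> f = Ide C a" "f \<cdot> g = Ide C b"
  using assms unfolding is_iso_def by (auto simp: Hom_iff)

lemma retraction_imp_mono:
  assumes f: "f \<in> Hom C a b" and g: "g \<in> Hom C b a" and gf: "g \<cdot> f = Ide C a"
  shows "is_mono C f"
proof (rule is_monoI_cancel[OF f])
  fix t x y assume x: "x \<in> Hom C t a" and y: "y \<in> Hom C t a" and e: "f \<cdot> x = f \<cdot> y"
  have "x = (g \<cdot> f) \<cdot> x" using gf x by (simp add: Hom_iff)
  also have "\<dots> = g \<cdot> (f \<cdot> x)" using f g x by (simp add: Hom_iff)
  also have "\<dots> = (g \<cdot> f) \<cdot> y" using e f g y by (simp add: Hom_iff)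
  also have "\<dots> = y" using gf y by (simp add: Hom_iff)
  finally show "x = y" .
qed

lemma section_imp_epi:
  assumes f: "f \<in> Hom C a b" and g: "g \<in> Hom C b a" and fg: "f \<cdot> g = Ide C b"
  shows "is_epi C f"
proof (rule is_epiI_cancel[OF f])
  fix t x y assume x: "x \<in> Hom C b t" and y: "y \<in> Hom C b t" and e: "x \<cdot> f = y \<cdot> f"
  have "x = x \<cdot> (f \<cdot> g)" using fg x by (simp add: Hom_iff)
  also have "\<dots> = (x \<cdot> f) \<cdot> g" using f g x by (simp add: Hom_iff)
  also have "\<dots> = y \<cdot> (f \<cdot> g)" unfolding e using f g y by (simp add: Hom_iff)
  also have "\<dots> = y" using fg y by (simp add: Hom_iff)
  finally show "x = y" .
qed

lemma iso_imp_mono_epi: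
  assumes "is_iso C f" "f \<in> Hom C a b"
  shows "is_mono C f" "is_epi C f"
  using iso_inverse[OF assms] retraction_imp_mono section_imp_epi assms(2) by metis+

end

definition Sub :: "('o, 'm) addcat \<Rightarrow> 'm \<Rightarrow> 'm \<Rightarrow> 'm" where
  "Sub C f g = Add C f (inv\<^bsub>hom_group C (Dom C g) (Cod C g)\<^esub> g)"

context preadditive_category
begin

lemma Zer_Hom: "a \<in> Obj C \<Longrightarrow> b \<in> Obj C \<Longrightarrow> Zer C a b \<in> Hom C a b"
  using comm_groupE(2)[OF Hom_comm_group] by (simp add: hom_group_def)

lemma Zer_typing [simp]:
  assumes "a \<in> Obj C" "b \<in> Obj C"
  shows "Zer C a b \<in> Arr C" "Dom C (Zer C a b) = a" "Cod C (Zer C a b) = b"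
  using Zer_Hom[OF assms] by (simp_all add: Hom_def)

lemma Add_cancel_right:
  assumes "f \<in> Hom C a b" "f' \<in> Hom C a b" "g \<in> Hom C a b" "Add C f g = Add C f' g"
  shows "f = f'"
proof -
  interpret comm_group "hom_group C a b"
    using Hom_comm_group assms(1) by (simp add: Hom_iff)
  show ?thesis using right_cancel[of g f f'] assms by (simp add: hom_group_def)
qed

lemma Add_Zer_left: "f \<in> Hom C a b \<Longrightarrow> Add C (Zer C a b) f = f"
  using comm_groupE(5)[OF Hom_comm_group[of a b]] by (simp add: hom_group_def Hom_iff)

lemma Sub_Hom: "f \<in> Hom C a b \<Longrightarrow> g \<in> Hom C a b \<Longrightarrow> Sub C f g \<in> Hom C a b"
  and Add_Sub: "f \<in> Hom C a b \<Longrightarrow> g \<in> Hom C a b \<Longrightarrow> Add C (Sub C f g) g = f"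
proof -
  assume f: "f \<in> Hom C a b" and g: "g \<in> Hom C a b"
  interpret G: comm_group "hom_group C a b"
    using Hom_comm_group f by (simp add: Hom_iff)
  have c: "f \<in> carrier (hom_group C a b)" "g \<in> carrier (hom_group C a b)"
    using f g by (simp_all add: hom_group_def)
  have S: "Sub C f g = f \<otimes>\<^bsub>hom_group C a b\<^esub> inv\<^bsub>hom_group C a b\<^esub> g"
    using f g by (simp add: Sub_def Hom_iff hom_group_def)
  show "Sub C f g \<in> Hom C a b"
    using G.m_closed[OF c(1) G.inv_closed[OF c(2)]] S by (simp add: hom_group_def)
  have "Sub C f g \<otimes>\<^bsub>hom_group C a b\<^esub> g = f"
    unfolding S using c by (simp add: G.m_assoc)
  then show "Add C (Sub C f g) g = f" by (simp add: hom_group_def)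
qed

lemma Sub_unique:
  assumes "f \<in> Hom C a b" "g \<in> Hom C a b" "d \<in> Hom C a b" "Add C d g = f"
  shows "Sub C f g = d"
  using Add_cancel_right[OF Sub_Hom[OF assms(1,2)] assms(3,2)] Add_Sub[OF assms(1,2)] assms(4) by simp

lemma Sub_eq_Zer_iff:
  assumes "f \<in> Hom C a b" "g \<in> Hom C a b"
  shows "Sub C f g = Zer C a b \<longleftrightarrow> f = g"
proof -
  have "Zer C a b \<in> Hom C a b" using assms Hom_ObjD Zer_Hom by blast
  then show ?thesis
    using Add_Sub[OF assms] Add_Zer_left[OF assms(2)] Sub_unique[OF assms, of "Zer C a b"] by metis
qed

lemma Sub_Zer_right:
  assumes f: "f \<in> Hom C a b"
  shows "Sub C f (Zer C a b) = f"
proof (rule Sub_unique[OF f Zer_Hom[OF Hom_ObjD[OF f]] f])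
  show "Add C f (Zer C a b) = f"
    using comm_groupE(4)[OF Hom_comm_group[OF Hom_ObjD[OF f]], of f "Zer C a b"] f
      Zer_Hom[OF Hom_ObjD[OF f]] Add_Zer_left[OF f] by (simp add: hom_group_def)
qed

lemma Cmp_Sub_right:
  assumes "f \<in> Hom C a b" "g \<in> Hom C a b" "h \<in> Hom C b c"
  shows "h \<cdot> Sub C f g = Sub C (h \<cdot> f) (h \<cdot> g)"
  using Sub_unique[OF Cmp_Hom[OF assms(1,3)] Cmp_Hom[OF assms(2,3)]
      Cmp_Hom[OF Sub_Hom[OF assms(1,2)] assms(3)]]
    Cmp_Add_right[OF Sub_Hom[OF assms(1,2)] assms(2,3)] Add_Sub[OF assms(1,2)] by simp

lemma Cmp_Sub_left:
  assumes "h \<in> Hom C a b" "f \<in> Hom C b c" "g \<in> Hom C b c"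
  shows "Sub C f g \<cdot> h = Sub C (f \<cdot> h) (g \<cdot> h)"
  using Sub_unique[OF Cmp_Hom[OF assms(1,2)] Cmp_Hom[OF assms(1,3)]
      Cmp_Hom[OF assms(1) Sub_Hom[OF assms(2,3)]]]
    Cmp_Add_left[OF assms(1) Sub_Hom[OF assms(2,3)] assms(3)] Add_Sub[OF assms(2,3)] by simp

lemma Cmp_Zer_right [simp]:
  assumes "g \<in> Arr C" "Dom C g = b" "a \<in> Obj C"
  shows "g \<cdot> Zer C a b = Zer C a (Cod C g)"
proof -
  have g: "g \<in> Hom C b (Cod C g)" and z: "Zer C a b \<in> Hom C a b"
    using assms Zer_Hom Dom_Obj by (auto simp: Hom_def)
  have "Sub C (Zer C a b) (Zer C a b) = Zer C a b" using Sub_eq_Zer_iff[OF z z] by simp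
  then show ?thesis
    using Cmp_Sub_right[OF z z g] Sub_eq_Zer_iff[OF Cmp_Hom[OF z g] Cmp_Hom[OF z g]] by simp
qed

lemma Cmp_Zer_left [simp]:
  assumes "f \<in> Arr C" "Cod C f = b" "c \<in> Obj C"
  shows "Zer C b c \<cdot> f = Zer C (Dom C f) c"
proof -
  have f: "f \<in> Hom C (Dom C f) b" and z: "Zer C b c \<in> Hom C b c"
    using assms Zer_Hom Cod_Obj by (auto simp: Hom_def)
  have "Sub C (Zer C b c) (Zer C b c) = Zer C b c" using Sub_eq_Zer_iff[OF z z] by simp
  then show ?thesis
    using Cmp_Sub_left[OF f z z] Sub_eq_Zer_iff[OF Cmp_Hom[OF f z] Cmp_Hom[OF f z]] by simp
qed

lemma zero_object_iff: "is_zero_object C z \<longleftrightarrow> z \<in> Obj C \<and> Ide C z = Zer C z z"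
proof
  assume "is_zero_object C z"
  then show "z \<in> Obj C \<and> Ide C z = Zer C z z"
    unfolding is_zero_object_def using Ide_Hom[of z] Zer_Hom[of z z] by blast
next
  assume z: "z \<in> Obj C \<and> Ide C z = Zer C z z"
  have 1: "f = Zer C z a" if f: "f \<in> Hom C z a" for f a
  proof -
    have "f \<cdot> Zer C z z = Zer C z a" using f by (simp add: Hom_iff)
    then show ?thesis using Cmp_Ide_right[OF f] z by simp
  qed
  have 2: "f = Zer C a z" if f: "f \<in> Hom C a z" for f a
  proof -
    have "Zer C z z \<cdot> f = Zer C a z" using f by (simp add: Hom_iff)
    then show ?thesis using Cmp_Ide_left[OF f] z by simp
  qed
  show "is_zero_object C z"
    unfolding is_zero_object_def using z 1 2 Zer_Hom by blast
qed

lemma zero_object_Hom: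
  assumes "is_zero_object C z"
  shows "f \<in> Hom C z a \<Longrightarrow> f = Zer C z a" "f \<in> Hom C a z \<Longrightarrow> f = Zer C a z"
  using assms unfolding is_zero_object_def by (metis Hom_iff Zer_Hom)+

lemma is_monoI:
  assumes m: "m \<in> Hom C a b"
    and z: "\<And>t g. g \<in> Hom C t a \<Longrightarrow> m \<cdot> g = Zer C t b \<Longrightarrow> g = Zer C t a"
  shows "is_mono C m"
proof (rule is_monoI_cancel[OF m])
  fix t g h assume g: "g \<in> Hom C t a" and h: "h \<in> Hom C t a" and "m \<cdot> g = m \<cdot> h"
  then have "m \<cdot> Sub C g h = Zer C t b"
    using Cmp_Sub_right[OF g h m] Sub_eq_Zer_iff[OF Cmp_Hom[OF g m] Cmp_Hom[OF h m]] by simp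
  then show "g = h" using z Sub_Hom[OF g h] Sub_eq_Zer_iff[OF g h] by blast
qed

lemma mono_zero:
  assumes "is_mono C m" "m \<in> Hom C a b" "g \<in> Hom C t a" "m \<cdot> g = Zer C t b"
  shows "g = Zer C t a"
  using mono_cancel[OF assms(1-3), of "Zer C t a"] assms by (simp add: Hom_iff)

lemma is_epiI:
  assumes e: "e \<in> Hom C a b"
    and z: "\<And>t g. g \<in> Hom C b t \<Longrightarrow> g \<cdot> e = Zer C a t \<Longrightarrow> g = Zer C b t"
  shows "is_epi C e"
proof (rule is_epiI_cancel[OF e])
  fix t g h assume g: "g \<in> Hom C b t" and h: "h \<in> Hom C b t" and "g \<cdot> e = h \<cdot> e"
  then have "Sub C g h \<cdot> e = Zer C a t"
    using Cmp_Sub_left[OF e g h] Sub_eq_Zer_iff[OF Cmp_Hom[OF e g] Cmp_Hom[OF e h]] by simp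
  then show "g = h" using z Sub_Hom[OF g h] Sub_eq_Zer_iff[OF g h] by blast
qed

lemma epi_zero:
  assumes "is_epi C e" "e \<in> Hom C a b" "g \<in> Hom C b t" "g \<cdot> e = Zer C a t"
  shows "g = Zer C b t"
  using epi_cancel[OF assms(1-3), of "Zer C b t"] assms by (simp add: Hom_iff)

lemma mono_zero_imp_zero_object:
  assumes "is_mono C m" "m \<in> Hom C a b" "m = Zer C a b"
  shows "is_zero_object C a"
  using mono_zero[OF assms(1,2), of "Ide C a" a] assms by (auto simp: zero_object_iff Hom_iff)

lemma epi_zero_imp_zero_object:
  assumes "is_epi C e" "e \<in> Hom C a b" "e = Zer C a b"
  shows "is_zero_object C b"
  using epi_zero[OF assms(1,2), of "Ide C b" b] assms by (auto simp: zero_object_iff Hom_iff)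

lemma kernelD:
  assumes "is_kernel C k f" "f \<in> Hom C a b" "k \<in> Hom C c a"
  shows "f \<cdot> k = Zer C c b"
    and "is_mono C k"
    and "\<And>t g. g \<in> Hom C t a \<Longrightarrow> f \<cdot> g = Zer C t b \<Longrightarrow> \<exists>u \<in> Hom C t c. k \<cdot> u = g"
proof -
  have U: "\<exists>!u. u \<in> Hom C t c \<and> k \<cdot> u = g" if "g \<in> Hom C t a" "f \<cdot> g = Zer C t b" for t g
    using assms that unfolding is_kernel_def by (metis HomD)
  show fk: "f \<cdot> k = Zer C c b"
    using assms unfolding is_kernel_def by (simp add: Hom_def)
  show "is_mono C k"
  proof (rule is_monoI_cancel[OF assms(3)])
    fix t g h assume g: "g \<in> Hom C t c" and h: "h \<in> Hom C t c" and e: "k \<cdot> g = k \<cdot> h"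
    have "f \<cdot> (k \<cdot> h) = (f \<cdot> k) \<cdot> h" using assms h by (simp add: Hom_iff)
    also have "\<dots> = Zer C t b" unfolding fk using assms h by (simp add: Hom_iff)
    finally have "f \<cdot> (k \<cdot> h) = Zer C t b" .
    then show "g = h" using U[of "k \<cdot> h" t] Cmp_Hom[OF h assms(3)] g h e by auto
  qed
  show "\<And>t g. g \<in> Hom C t a \<Longrightarrow> f \<cdot> g = Zer C t b \<Longrightarrow> \<exists>u \<in> Hom C t c. k \<cdot> u = g"
    using U by blast
qed

lemma kernelI:
  assumes "f \<in> Hom C a b" "k \<in> Hom C c a" "f \<cdot> k = Zer C c b" "is_mono C k"
    and "\<And>t g. g \<in> Hom C t a \<Longrightarrow> f \<cdot> g = Zer C t b \<Longrightarrow> \<exists>u \<in> Hom C t c. k \<cdot> u = g"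
  shows "is_kernel C k f"
proof -
  have "\<exists>!u. u \<in> Hom C t c \<and> k \<cdot> u = g" if "g \<in> Hom C t a" "f \<cdot> g = Zer C t b" for t g
    using assms(5)[OF that] mono_cancel[OF assms(4,2)] by metis
  then show ?thesis using assms(1-3) unfolding is_kernel_def by (simp add: Hom_def)
qed

lemma cokernelD:
  assumes "is_cokernel C q f" "f \<in> Hom C a b" "q \<in> Hom C b c"
  shows "q \<cdot> f = Zer C a c"
    and "is_epi C q"
    and "\<And>t g. g \<in> Hom C b t \<Longrightarrow> g \<cdot> f = Zer C a t \<Longrightarrow> \<exists>u \<in> Hom C c t. u \<cdot> q = g"
proof -
  have U: "\<exists>!u. u \<in> Hom C c t \<and> u \<cdot> q = g" if "g \<in> Hom C b t" "g \<cdot> f = Zer C a t" for t g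
    using assms that unfolding is_cokernel_def by (metis HomD)
  show qf: "q \<cdot> f = Zer C a c"
    using assms unfolding is_cokernel_def by (simp add: Hom_def)
  show "is_epi C q"
  proof (rule is_epiI_cancel[OF assms(3)])
    fix t g h assume g: "g \<in> Hom C c t" and h: "h \<in> Hom C c t" and e: "g \<cdot> q = h \<cdot> q"
    have "(h \<cdot> q) \<cdot> f = h \<cdot> (q \<cdot> f)" using assms h by (simp add: Hom_iff)
    also have "\<dots> = Zer C a t" unfolding qf using assms h by (simp add: Hom_iff)
    finally have "(h \<cdot> q) \<cdot> f = Zer C a t" .
    then show "g = h" using U[of "h \<cdot> q" t] Cmp_Hom[OF assms(3) h] g h e by auto
  qed
  show "\<And>t g. g \<in> Hom C b t \<Longrightarrow> g \<cdot> f = Zer C a t \<Longrightarrow> \<exists>u \<in> Hom C c t. u \<cdot> q = g"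
    using U by blast
qed

lemma cokernelI:
  assumes "f \<in> Hom C a b" "q \<in> Hom C b c" "q \<cdot> f = Zer C a c" "is_epi C q"
    and "\<And>t g. g \<in> Hom C b t \<Longrightarrow> g \<cdot> f = Zer C a t \<Longrightarrow> \<exists>u \<in> Hom C c t. u \<cdot> q = g"
  shows "is_cokernel C q f"
proof -
  have "\<exists>!u. u \<in> Hom C c t \<and> u \<cdot> q = g" if "g \<in> Hom C b t" "g \<cdot> f = Zer C a t" for t g
    using assms(5)[OF that] epi_cancel[OF assms(4,2)] by metis
  then show ?thesis using assms(1-3) unfolding is_cokernel_def by (simp add: Hom_def)
qed

lemma short_exact_typing:
  assumes "short_exact C f g"
  shows "f \<in> Hom C (Dom C f) (Dom C g)" "g \<in> Hom C (Dom C g) (Cod C g)"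
  using assms unfolding short_exact_def is_kernel_def by (auto simp: Hom_iff Cod_Obj Dom_Obj)

end

section \<open>Factorisations and pullbacks in abelian categories\<close>

definition is_pullback :: "('o, 'm) addcat \<Rightarrow> 'm \<Rightarrow> 'm \<Rightarrow> 'm \<Rightarrow> 'm \<Rightarrow> bool" where
  "is_pullback C p q p' q' \<longleftrightarrow>
     p' \<in> Hom C (Dom C p') (Dom C p) \<and> q' \<in> Hom C (Dom C p') (Dom C q) \<and>
     p \<cdot>\<^bsub>C\<^esub> p' = q \<cdot>\<^bsub>C\<^esub> q' \<and>
     (\<forall>t. \<forall>x \<in> Hom C t (Dom C p). \<forall>y \<in> Hom C t (Dom C q). p \<cdot>\<^bsub>C\<^esub> x = q \<cdot>\<^bsub>C\<^esub> y \<longrightarrow>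
        (\<exists>!u. u \<in> Hom C t (Dom C p') \<and> p' \<cdot>\<^bsub>C\<^esub> u = x \<and> q' \<cdot>\<^bsub>C\<^esub> u = y))"

context abelian_category
begin

lemma obtain_kernel:
  assumes "f \<in> Hom C a b"
  obtains c k where "k \<in> Hom C c a" "is_kernel C k f"
proof -
  from kernels[of f] assms obtain k where k: "is_kernel C k f" by (auto simp: Hom_iff)
  then have "k \<in> Hom C (Dom C k) a" using assms unfolding is_kernel_def by (auto simp: Hom_def)
  with k that show thesis by blast
qed

lemma obtain_cokernel:
  assumes "f \<in> Hom C a b"
  obtains c q where "q \<in> Hom C b c" "is_cokernel C q f"
proof -
  from cokernels[of f] assms obtain q where q: "is_cokernel C q f" by (auto simp: Hom_iff)
  then have "q \<in> Hom C b (Cod C q)" using assms unfolding is_cokernel_def by (auto simp: Hom_def)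
  with q that show thesis by blast
qed

lemma mono_is_kernel_of_cokernel:
  assumes m: "is_mono C m" "m \<in> Hom C a b" and q: "is_cokernel C q m" "q \<in> Hom C b c"
  shows "is_kernel C m q"
proof (rule kernelI[OF q(2) m(2) cokernelD(1)[OF q(1) m(2) q(2)] m(1)])
  fix t x assume x: "x \<in> Hom C t b" and qx: "q \<cdot> x = Zer C t c"
  obtain g where g: "is_kernel C m g" using mono_normal[OF m(1)] by blast
  then have gH: "g \<in> Hom C b (Cod C g)" using m(2) unfolding is_kernel_def by (auto simp: Hom_def)
  obtain w where w: "w \<in> Hom C c (Cod C g)" "w \<cdot> q = g"
    using cokernelD(3)[OF q(1) m(2) q(2) gH] kernelD(1)[OF g gH m(2)] by blast
  have "g \<cdot> x = w \<cdot> (q \<cdot> x)" using w x q by (auto simp: Hom_iff)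
  also have "\<dots> = Zer C t (Cod C g)" unfolding qx using w x by (simp add: Hom_iff)
  finally show "\<exists>u \<in> Hom C t a. m \<cdot> u = x" using kernelD(3)[OF g gH m(2) x] by blast
qed

lemma epi_is_cokernel_of_kernel:
  assumes e: "is_epi C e" "e \<in> Hom C a b" and k: "is_kernel C k e" "k \<in> Hom C c a"
  shows "is_cokernel C e k"
proof (rule cokernelI[OF k(2) e(2) kernelD(1)[OF k(1) e(2) k(2)] e(1)])
  fix t x assume x: "x \<in> Hom C a t" and xk: "x \<cdot> k = Zer C c t"
  obtain g where g: "is_cokernel C e g" using epi_normal[OF e(1)] by blast
  then have gH: "g \<in> Hom C (Dom C g) a" using e(2) unfolding is_cokernel_def by (auto simp: Hom_def)
  obtain w where w: "w \<in> Hom C (Dom C g) c" "k \<cdot> w = g"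
    using kernelD(3)[OF k(1) e(2) k(2) gH] cokernelD(1)[OF g gH e(2)] by blast
  have "x \<cdot> g = (x \<cdot> k) \<cdot> w" using w x k by (auto simp: Hom_iff)
  also have "\<dots> = Zer C (Dom C g) t" unfolding xk using w x by (simp add: Hom_iff)
  finally show "\<exists>u \<in> Hom C b t. u \<cdot> e = x" using cokernelD(3)[OF g gH e(2) x] by blast
qed

lemma short_exactI:
  assumes "f \<in> Hom C a b" "g \<in> Hom C b c" "is_mono C f" "is_cokernel C g f"
  shows "short_exact C f g"
  using mono_is_kernel_of_cokernel assms unfolding short_exact_def by blast

lemma kernel_zero_imp_mono:
  assumes k: "is_kernel C k f" "f \<in> Hom C a b" "k \<in> Hom C c a" and "k = Zer C c a"
  shows "is_mono C f"
proof (rule is_monoI[OF k(2)])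
  fix t g assume g: "g \<in> Hom C t a" "f \<cdot> g = Zer C t b"
  then obtain u where "u \<in> Hom C t c" "k \<cdot> u = g" using kernelD(3)[OF k] by blast
  then show "g = Zer C t a" using assms by (auto simp: Hom_iff)
qed

lemma cokernel_zero_imp_epi:
  assumes q: "is_cokernel C q f" "f \<in> Hom C a b" "q \<in> Hom C b c" and "q = Zer C b c"
  shows "is_epi C f"
proof (rule is_epiI[OF q(2)])
  fix t g assume g: "g \<in> Hom C b t" "g \<cdot> f = Zer C a t"
  then obtain u where "u \<in> Hom C c t" "u \<cdot> q = g" using cokernelD(3)[OF q] by blast
  then show "g = Zer C b t" using assms by (auto simp: Hom_iff)
qed

lemma mono_epi_imp_iso:
  assumes f: "is_mono C f" "is_epi C f" "f \<in> Hom C a b"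
  shows "is_iso C f"
proof -
  obtain c q where q: "q \<in> Hom C b c" "is_cokernel C q f" using obtain_cokernel[OF f(3)] .
  have fk: "is_kernel C f q" using mono_is_kernel_of_cokernel[OF f(1,3) q(2,1)] .
  have "q = Zer C b c" using epi_zero[OF f(2,3) q(1)] cokernelD(1)[OF q(2) f(3) q(1)] .
  then have "q \<cdot> Ide C b = Zer C b c" using q by (simp add: Hom_iff)
  then obtain g where g: "g \<in> Hom C b a" "f \<cdot> g = Ide C b"
    using kernelD(3)[OF fk q(1) f(3) Ide_Hom] f(3) by (auto simp: Hom_iff)
  have "f \<cdot> (g \<cdot> f) = (f \<cdot> g) \<cdot> f" using f(3) g(1) by (simp add: Hom_iff)
  also have "\<dots> = f \<cdot> Ide C a" unfolding g(2) using f(3) by (simp add: Hom_iff)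
  finally have "g \<cdot> f = Ide C a"
    using mono_cancel[OF f(1,3) Cmp_Hom[OF f(3) g(1)] Ide_Hom] f(3) by (simp add: Hom_iff)
  then show ?thesis using is_isoI[OF f(3) g(1)] g(2) by blast
qed

text \<open>Every arrow is an epimorphism followed by a monomorphism, the latter being the kernel of any cokernel of
  the arrow.\<close>

lemma obtain_image_factorisation:
  assumes f: "f \<in> Hom C a b"
  obtains c e m where "e \<in> Hom C a c" "m \<in> Hom C c b" "is_epi C e" "is_mono C m" "m \<cdot> e = f"
    "\<And>q d. is_cokernel C q f \<Longrightarrow> q \<in> Hom C b d \<Longrightarrow> is_kernel C m q"
proof -
  obtain d q where q: "q \<in> Hom C b d" "is_cokernel C q f" using obtain_cokernel[OF f] .
  obtain c m where m: "m \<in> Hom C c b" "is_kernel C m q" using obtain_kernel[OF q(1)] .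
  note qm = kernelD(1)[OF m(2) q(1) m(1)] and mono = kernelD(2)[OF m(2) q(1) m(1)]
  obtain e where e: "e \<in> Hom C a c" "m \<cdot> e = f"
    using kernelD(3)[OF m(2) q(1) m(1) f] cokernelD(1)[OF q(2) f q(1)] by blast
  have "is_epi C e"
  proof (rule is_epiI[OF e(1)])
    fix t x assume x: "x \<in> Hom C c t" and xe: "x \<cdot> e = Zer C a t"
    \<comment> \<open>If \<open>x\<close> kills \<open>e\<close>, then \<open>f\<close> factors through the smaller subobject \<open>m \<cdot> k\<close>, \<open>k\<close> the kernel of \<open>x\<close>;
      the cokernel of that subobject then kills \<open>m\<close> as well, so \<open>m \<cdot> k\<close> is all of \<open>m\<close>.\<close>
    obtain c' k where k: "k \<in> Hom C c' c" "is_kernel C k x" using obtain_kernel[OF x] .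
    note kmono = kernelD(2)[OF k(2) x k(1)]
    obtain e' where e': "e' \<in> Hom C a c'" "k \<cdot> e' = e" using kernelD(3)[OF k(2) x k(1) e(1) xe] by blast
    have mk: "m \<cdot> k \<in> Hom C c' b" using Cmp_Hom[OF k(1) m(1)] .
    have mkmono: "is_mono C (m \<cdot> k)"
    proof (rule is_monoI[OF mk])
      fix s g assume g: "g \<in> Hom C s c'" "(m \<cdot> k) \<cdot> g = Zer C s b"
      have "m \<cdot> (k \<cdot> g) = Zer C s b" using g k m by (simp add: Hom_iff)
      then have "k \<cdot> g = Zer C s c" using mono_zero[OF mono m(1) Cmp_Hom[OF g(1) k(1)]] by blast
      then show "g = Zer C s c'" using mono_zero[OF kmono k(1) g(1)] by blast
    qed
    obtain d' p where p: "p \<in> Hom C b d'" "is_cokernel C p (m \<cdot> k)" using obtain_cokernel[OF mk] .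
    have "p \<cdot> f = (p \<cdot> (m \<cdot> k)) \<cdot> e'"
      using p(1) mk k m e' e by (auto simp: Hom_iff)
    also have "\<dots> = Zer C a d'" using cokernelD(1)[OF p(2) mk p(1)] e' p(1) by (simp add: Hom_iff)
    finally obtain w where w: "w \<in> Hom C d d'" "w \<cdot> q = p" using cokernelD(3)[OF q(2) f q(1) p(1)] by blast
    have "p \<cdot> m = w \<cdot> (q \<cdot> m)" using w q(1) m(1) by (auto simp: Hom_iff)
    also have "\<dots> = Zer C c d'" unfolding qm using w m by (simp add: Hom_iff)
    finally obtain s where s: "s \<in> Hom C c c'" "(m \<cdot> k) \<cdot> s = m"
      using kernelD(3)[OF mono_is_kernel_of_cokernel[OF mkmono mk p(2,1)] p(1) mk m(1)] by blast
    have "m \<cdot> (k \<cdot> s) = m \<cdot> Ide C c" using s m k by (simp add: Hom_iff)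
    then have ks: "k \<cdot> s = Ide C c"
      using mono_cancel[OF mono m(1) Cmp_Hom[OF s(1) k(1)] Ide_Hom] m by (simp add: Hom_iff)
    have "x = (x \<cdot> k) \<cdot> s" using ks x k s by (simp add: Hom_iff)
    also have "\<dots> = Zer C c t" using kernelD(1)[OF k(2) x k(1)] s x by (simp add: Hom_iff)
    finally show "x = Zer C c t" .
  qed
  moreover have "is_kernel C m q'" if q': "is_cokernel C q' f" "q' \<in> Hom C b d'" for q' d'
  proof (rule kernelI[OF q'(2) m(1) _ mono])
    have "(q' \<cdot> m) \<cdot> e = Zer C a d'"
      using cokernelD(1)[OF q'(1) f q'(2)] q'(2) m(1) e by (simp add: Hom_iff)
    then show "q' \<cdot> m = Zer C c d'" using epi_zero[OF \<open>is_epi C e\<close> e(1) Cmp_Hom[OF m(1) q'(2)]] by blast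
    fix t g assume g: "g \<in> Hom C t b" "q' \<cdot> g = Zer C t d'"
    obtain w where w: "w \<in> Hom C d' d" "w \<cdot> q' = q"
      using cokernelD(3)[OF q'(1) f q'(2) q(1)] cokernelD(1)[OF q(2) f q(1)] by blast
    have "q \<cdot> g = w \<cdot> (q' \<cdot> g)" using w g(1) q'(2) by (auto simp: Hom_iff)
    also have "\<dots> = Zer C t d" using g w by (simp add: Hom_iff)
    finally show "\<exists>u \<in> Hom C t c. m \<cdot> u = g" using kernelD(3)[OF m(2) q(1) m(1) g(1)] by blast
  qed
  ultimately show thesis using that e m(1) mono by blast
qed

lemma pullbackD:
  assumes "is_pullback C p q p' q'" "p \<in> Hom C a c" "q \<in> Hom C b c"
  obtains r where "p' \<in> Hom C r a" "q' \<in> Hom C r b" "p \<cdot> p' = q \<cdot> q'"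
    "\<And>t x y. x \<in> Hom C t a \<Longrightarrow> y \<in> Hom C t b \<Longrightarrow> p \<cdot> x = q \<cdot> y \<Longrightarrow> \<exists>u \<in> Hom C t r. p' \<cdot> u = x \<and> q' \<cdot> u = y"
    "\<And>t x. x \<in> Hom C t r \<Longrightarrow> p' \<cdot> x = Zer C t a \<Longrightarrow> q' \<cdot> x = Zer C t b \<Longrightarrow> x = Zer C t r"
proof -
  let ?r = "Dom C p'"
  have 1: "p' \<in> Hom C ?r a" "q' \<in> Hom C ?r b" "p \<cdot> p' = q \<cdot> q'"
    using assms unfolding is_pullback_def by (auto simp: Hom_iff)
  have U: "\<exists>!u. u \<in> Hom C t ?r \<and> p' \<cdot> u = x \<and> q' \<cdot> u = y"
    if "x \<in> Hom C t a" "y \<in> Hom C t b" "p \<cdot> x = q \<cdot> y" for t x y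
    using assms(1) that HomD(1)[OF assms(2)] HomD(1)[OF assms(3)] unfolding is_pullback_def by blast
  have Z: "x = Zer C t ?r" if x: "x \<in> Hom C t ?r" "p' \<cdot> x = Zer C t a" "q' \<cdot> x = Zer C t b" for t x
  proof -
    have "p \<cdot> Zer C t a = q \<cdot> Zer C t b" using assms x by (simp add: Hom_iff)
    then have "\<exists>!u. u \<in> Hom C t ?r \<and> p' \<cdot> u = Zer C t a \<and> q' \<cdot> u = Zer C t b"
      using U[of "Zer C t a" t "Zer C t b"] assms x by (simp add: Hom_iff)
    moreover have "Zer C t ?r \<in> Hom C t ?r" "p' \<cdot> Zer C t ?r = Zer C t a" "q' \<cdot> Zer C t ?r = Zer C t b"
      using x 1 by (simp_all add: Hom_iff)
    ultimately show ?thesis using x by metis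
  qed
  show thesis by (rule that[OF 1]) (use U in blast, rule Z)
qed

lemma
  assumes p: "p \<in> Hom C a c" and q: "q \<in> Hom C b c"
  shows pullback_exists: "\<exists>p' q'. is_pullback C p q p' q'"
    and pullback_of_epi: "is_epi C p \<Longrightarrow> is_pullback C p q p' q' \<Longrightarrow> is_epi C q'"
proof -
  have ab: "a \<in> Obj C" "b \<in> Obj C" using p q by (auto simp: Hom_iff)
  from biproducts[OF this] obtain s \<iota>\<^sub>1 \<iota>\<^sub>2 \<pi>\<^sub>1 \<pi>\<^sub>2 where bp: "is_biproduct C a b s \<iota>\<^sub>1 \<iota>\<^sub>2 \<pi>\<^sub>1 \<pi>\<^sub>2" by blast
  then have i1: "\<iota>\<^sub>1 \<in> Hom C a s" and i2: "\<iota>\<^sub>2 \<in> Hom C b s" and p1: "\<pi>\<^sub>1 \<in> Hom C s a" and p2: "\<pi>\<^sub>2 \<in> Hom C s b"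
    and e: "\<pi>\<^sub>1 \<cdot> \<iota>\<^sub>1 = Ide C a" "\<pi>\<^sub>2 \<cdot> \<iota>\<^sub>2 = Ide C b" "\<pi>\<^sub>1 \<cdot> \<iota>\<^sub>2 = Zer C b a" "\<pi>\<^sub>2 \<cdot> \<iota>\<^sub>1 = Zer C a b"
    and sum: "Add C (\<iota>\<^sub>1 \<cdot> \<pi>\<^sub>1) (\<iota>\<^sub>2 \<cdot> \<pi>\<^sub>2) = Ide C s"
    by (auto simp: is_biproduct_def)
  \<comment> \<open>The pullback is the kernel of the difference of the two maps out of the biproduct.\<close>
  define d where "d = Sub C (p \<cdot> \<pi>\<^sub>1) (q \<cdot> \<pi>\<^sub>2)"
  have pp: "p \<cdot> \<pi>\<^sub>1 \<in> Hom C s c" "q \<cdot> \<pi>\<^sub>2 \<in> Hom C s c" using Cmp_Hom[OF p1 p] Cmp_Hom[OF p2 q] by auto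
  have d: "d \<in> Hom C s c" unfolding d_def using Sub_Hom[OF pp] .
  have dz: "d \<cdot> x = Zer C t c \<longleftrightarrow> p \<cdot> (\<pi>\<^sub>1 \<cdot> x) = q \<cdot> (\<pi>\<^sub>2 \<cdot> x)" if x: "x \<in> Hom C t s" for t x
  proof -
    have "d \<cdot> x = Sub C ((p \<cdot> \<pi>\<^sub>1) \<cdot> x) ((q \<cdot> \<pi>\<^sub>2) \<cdot> x)" unfolding d_def using Cmp_Sub_left[OF x pp] .
    then show ?thesis
      using Sub_eq_Zer_iff[OF Cmp_Hom[OF x pp(1)] Cmp_Hom[OF x pp(2)]] x p q p1 p2
      by (simp add: Hom_iff)
  qed
  obtain r k where k: "k \<in> Hom C r s" "is_kernel C k d" using obtain_kernel[OF d] .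
  note kmono = kernelD(2)[OF k(2) d k(1)]
  have H: "\<pi>\<^sub>1 \<cdot> k \<in> Hom C r a" "\<pi>\<^sub>2 \<cdot> k \<in> Hom C r b" using Cmp_Hom[OF k(1) p1] Cmp_Hom[OF k(1) p2] by auto
  have comm: "p \<cdot> (\<pi>\<^sub>1 \<cdot> k) = q \<cdot> (\<pi>\<^sub>2 \<cdot> k)" using dz[OF k(1)] kernelD(1)[OF k(2) d k(1)] by blast
  have pair: "\<exists>z \<in> Hom C t s. \<pi>\<^sub>1 \<cdot> z = x \<and> \<pi>\<^sub>2 \<cdot> z = y" if x: "x \<in> Hom C t a" and y: "y \<in> Hom C t b" for t x y
  proof -
    let ?z = "Sub C (\<iota>\<^sub>1 \<cdot> x) (\<iota>\<^sub>2 \<cdot> Sub C (Zer C t b) y)"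
    have z0: "Zer C t b \<in> Hom C t b" using y by (simp add: Hom_iff)
    have ny: "Sub C (Zer C t b) y \<in> Hom C t b" using Sub_Hom[OF z0 y] .
    have h: "\<iota>\<^sub>1 \<cdot> x \<in> Hom C t s" "\<iota>\<^sub>2 \<cdot> Sub C (Zer C t b) y \<in> Hom C t s"
      using Cmp_Hom[OF x i1] Cmp_Hom[OF ny i2] by auto
    have zH: "?z \<in> Hom C t s" using Sub_Hom[OF h] .
    have "\<pi>\<^sub>1 \<cdot> ?z = Sub C ((\<pi>\<^sub>1 \<cdot> \<iota>\<^sub>1) \<cdot> x) ((\<pi>\<^sub>1 \<cdot> \<iota>\<^sub>2) \<cdot> Sub C (Zer C t b) y)"
      using Cmp_Sub_right[OF h p1] p1 i1 i2 x ny by (simp add: Hom_iff)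
    also have "\<dots> = Sub C x (Zer C t a)" unfolding e using x ny by (simp add: Hom_iff)
    also have "\<dots> = x" using Sub_Zer_right[OF x] .
    finally have 1: "\<pi>\<^sub>1 \<cdot> ?z = x" .
    have "\<pi>\<^sub>2 \<cdot> ?z = Sub C ((\<pi>\<^sub>2 \<cdot> \<iota>\<^sub>1) \<cdot> x) ((\<pi>\<^sub>2 \<cdot> \<iota>\<^sub>2) \<cdot> Sub C (Zer C t b) y)"
      using Cmp_Sub_right[OF h p2] p2 i1 i2 x ny by (simp add: Hom_iff)
    also have "\<dots> = Sub C (Zer C t b) (Sub C (Zer C t b) y)" unfolding e using x ny by (simp add: Hom_iff)
    also have "\<dots> = y" using Sub_unique[OF z0 ny y] Add_Sub[OF z0 y]
       comm_groupE(4)[OF Hom_comm_group[of t b], of y "Sub C (Zer C t b) y"] ny y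
      by (simp add: Hom_iff hom_group_def)
    finally show ?thesis using 1 zH by blast
  qed
  have jm: "x = y" if x: "x \<in> Hom C t s" and y: "y \<in> Hom C t s" and xy: "\<pi>\<^sub>1 \<cdot> x = \<pi>\<^sub>1 \<cdot> y" "\<pi>\<^sub>2 \<cdot> x = \<pi>\<^sub>2 \<cdot> y" for t x y
  proof -
    have *: "z = Add C (\<iota>\<^sub>1 \<cdot> (\<pi>\<^sub>1 \<cdot> z)) (\<iota>\<^sub>2 \<cdot> (\<pi>\<^sub>2 \<cdot> z))" if z: "z \<in> Hom C t s" for z
      using Cmp_Add_left[OF z Cmp_Hom[OF p1 i1] Cmp_Hom[OF p2 i2]] sum z i1 i2 p1 p2
      by (simp add: Hom_iff)
    show ?thesis using *[OF x] *[OF y] xy by simp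
  qed
  have "is_pullback C p q (\<pi>\<^sub>1 \<cdot> k) (\<pi>\<^sub>2 \<cdot> k)"
    unfolding is_pullback_def
  proof (intro conjI allI ballI impI)
    show "\<pi>\<^sub>1 \<cdot> k \<in> Hom C (Dom C (\<pi>\<^sub>1 \<cdot> k)) (Dom C p)" "\<pi>\<^sub>2 \<cdot> k \<in> Hom C (Dom C (\<pi>\<^sub>1 \<cdot> k)) (Dom C q)"
      using H p q by (auto simp: Hom_iff)
    fix t x y assume x: "x \<in> Hom C t (Dom C p)" and y: "y \<in> Hom C t (Dom C q)" and xy: "p \<cdot> x = q \<cdot> y"
    have x': "x \<in> Hom C t a" and y': "y \<in> Hom C t b" using x y p q by (auto simp: Hom_iff)
    obtain z where z: "z \<in> Hom C t s" "\<pi>\<^sub>1 \<cdot> z = x" "\<pi>\<^sub>2 \<cdot> z = y" using pair[OF x' y'] by blast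
    have "d \<cdot> z = Zer C t c" using dz[OF z(1)] z xy by simp
    then obtain u where u: "u \<in> Hom C t r" "k \<cdot> u = z" using kernelD(3)[OF k(2) d k(1) z(1)] by blast
    have D: "Dom C (\<pi>\<^sub>1 \<cdot> k) = r" using H by (simp add: Hom_iff)
    have ass: "(\<pi>\<^sub>1 \<cdot> k) \<cdot> v = \<pi>\<^sub>1 \<cdot> (k \<cdot> v)" "(\<pi>\<^sub>2 \<cdot> k) \<cdot> v = \<pi>\<^sub>2 \<cdot> (k \<cdot> v)" if "v \<in> Hom C t r" for v
      using that k(1) p1 p2 by (simp_all add: Hom_iff)
    show "\<exists>!u. u \<in> Hom C t (Dom C (\<pi>\<^sub>1 \<cdot> k)) \<and> (\<pi>\<^sub>1 \<cdot> k) \<cdot> u = x \<and> (\<pi>\<^sub>2 \<cdot> k) \<cdot> u = y"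
      unfolding D
    proof (rule ex1I[of _ u])
      show "u \<in> Hom C t r \<and> (\<pi>\<^sub>1 \<cdot> k) \<cdot> u = x \<and> (\<pi>\<^sub>2 \<cdot> k) \<cdot> u = y" using u z ass[OF u(1)] by simp
      fix v assume v: "v \<in> Hom C t r \<and> (\<pi>\<^sub>1 \<cdot> k) \<cdot> v = x \<and> (\<pi>\<^sub>2 \<cdot> k) \<cdot> v = y"
      then have "k \<cdot> v = k \<cdot> u" using jm[of "k \<cdot> v" t "k \<cdot> u"] ass[of v] ass[OF u(1)] u z Cmp_Hom[OF _ k(1)] by simp
      then show "v = u" using mono_cancel[OF kmono k(1)] v u by blast
    qed
  qed (use comm in simp)
  then show "\<exists>p' q'. is_pullback C p q p' q'" by blast
  assume pe: "is_epi C p" and pb: "is_pullback C p q p' q'"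
  obtain r' where R: "p' \<in> Hom C r' a" "q' \<in> Hom C r' b" "p \<cdot> p' = q \<cdot> q'"
    "\<And>t x y. x \<in> Hom C t a \<Longrightarrow> y \<in> Hom C t b \<Longrightarrow> p \<cdot> x = q \<cdot> y \<Longrightarrow> \<exists>u \<in> Hom C t r'. p' \<cdot> u = x \<and> q' \<cdot> u = y"
    using pullbackD[OF pb p q] by metis
  have di1: "d \<cdot> \<iota>\<^sub>1 = p"
  proof -
    have "d \<cdot> \<iota>\<^sub>1 = Sub C (p \<cdot> (\<pi>\<^sub>1 \<cdot> \<iota>\<^sub>1)) (q \<cdot> (\<pi>\<^sub>2 \<cdot> \<iota>\<^sub>1))"
      unfolding d_def using Cmp_Sub_left[OF i1 pp] p1 p2 i1 p q by (simp add: Hom_iff)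
    also have "\<dots> = Sub C p (Zer C a c)" unfolding e using p q ab by (simp add: Hom_iff)
    also have "\<dots> = p" using Sub_Zer_right[OF p] .
    finally show ?thesis .
  qed
  have de: "is_epi C d"
  proof (rule is_epiI[OF d])
    fix t g assume g: "g \<in> Hom C c t" and gd: "g \<cdot> d = Zer C s t"
    have "g \<cdot> p = (g \<cdot> d) \<cdot> \<iota>\<^sub>1" using di1 g d i1 by (auto simp: Hom_iff)
    also have "\<dots> = Zer C a t" unfolding gd using g i1 by (simp add: Hom_iff)
    finally show "g = Zer C c t" using epi_zero[OF pe p g] by blast
  qed
  note dcok = epi_is_cokernel_of_kernel[OF de d k(2,1)]
  show "is_epi C q'"
  proof (rule is_epiI[OF R(2)])
    fix t g assume g: "g \<in> Hom C b t" and gq: "g \<cdot> q' = Zer C r' t"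
    \<comment> \<open>\<open>g \<cdot> \<pi>\<^sub>2\<close> vanishes on the pullback, hence factors through the epimorphism \<open>d\<close>; restricted to
      the summand \<open>a\<close> this factorisation reads \<open>0 = \<tau> \<cdot> p\<close>.\<close>
    obtain u where u: "u \<in> Hom C r r'" "p' \<cdot> u = \<pi>\<^sub>1 \<cdot> k" "q' \<cdot> u = \<pi>\<^sub>2 \<cdot> k" using R(4)[OF H comm] by blast
    have "(g \<cdot> \<pi>\<^sub>2) \<cdot> k = (g \<cdot> q') \<cdot> u" using g p2 k(1) u R(2) by (simp add: Hom_iff)
    also have "\<dots> = Zer C r t" unfolding gq using u g by (simp add: Hom_iff)
    finally obtain \<tau> where \<tau>: "\<tau> \<in> Hom C c t" "\<tau> \<cdot> d = g \<cdot> \<pi>\<^sub>2"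
      using cokernelD(3)[OF dcok k(1) d Cmp_Hom[OF p2 g]] by blast
    have "\<tau> \<cdot> p = (\<tau> \<cdot> d) \<cdot> \<iota>\<^sub>1" using di1 \<tau>(1) d i1 by (auto simp: Hom_iff)
    also have "\<dots> = g \<cdot> (\<pi>\<^sub>2 \<cdot> \<iota>\<^sub>1)" unfolding \<tau>(2) using g p2 i1 by (simp add: Hom_iff)
    also have "\<dots> = Zer C a t" unfolding e using g ab by (simp add: Hom_iff)
    finally have t0: "\<tau> = Zer C c t" using epi_zero[OF pe p \<tau>(1)] by blast
    have "g = (g \<cdot> \<pi>\<^sub>2) \<cdot> \<iota>\<^sub>2" using e g p2 i2 by (simp add: Hom_iff)
    also have "\<dots> = Zer C b t" unfolding \<tau>(2)[symmetric] t0 using d i2 g by (simp add: Hom_iff)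
    finally show "g = Zer C b t" .
  qed
qed

end

section \<open>Additive functors and adjunctions\<close>

context additive_functor
begin

lemma Farr_typing [simp]:
  assumes "f \<in> Arr C"
  shows "Farr F f \<in> Arr D" "Dom D (Farr F f) = Fobj F (Dom C f)" "Cod D (Farr F f) = Fobj F (Cod C f)"
  using Farr_Hom[OF dom.Arr_Hom[OF assms]] by (simp_all add: Hom_def)

declare Fobj_Obj [simp] and Farr_Ide [simp]

lemma Farr_Cmp_Arr [simp]:
  assumes "f \<in> Arr C" "g \<in> Arr C" "Cod C f = Dom C g"
  shows "Farr F (g \<cdot>\<^bsub>C\<^esub> f) = Farr F g \<cdot>\<^bsub>D\<^esub> Farr F f"
  using assms by (intro Farr_Cmp[of f "Dom C f" "Dom C g" g "Cod C g"]) (simp_all add: Hom_def)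

lemma Farr_Zer [simp]:
  assumes "a \<in> Obj C" "b \<in> Obj C"
  shows "Farr F (Zer C a b) = Zer D (Fobj F a) (Fobj F b)"
proof -
  have z: "Zer C a b \<in> Hom C a b" using dom.Zer_Hom[OF assms] .
  note Fz = Farr_Hom[OF z]
  have z0: "Zer D (Fobj F a) (Fobj F b) \<in> Hom D (Fobj F a) (Fobj F b)" using cod.Zer_Hom assms by simp
  show ?thesis
    using cod.Add_cancel_right[OF Fz z0 Fz] cod.Add_Zer_left[OF Fz]
      Farr_Add[OF z z] dom.Add_Zer_left[OF z] by simp
qed

lemma Farr_direct_system:
  assumes "direct_system C I r A \<alpha>" "r \<subseteq> I \<times> I"
  shows "direct_system D I r (\<lambda>i. Fobj F (A i)) (\<lambda>i j. Farr F (\<alpha> i j))"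
  unfolding direct_system_def
proof (intro conjI ballI allI impI)
  fix i j k assume ijk: "(i, j) \<in> r \<and> (j, k) \<in> r"
  then have "\<alpha> i j \<in> Hom C (A i) (A j)" "\<alpha> j k \<in> Hom C (A j) (A k)" "\<alpha> j k \<cdot>\<^bsub>C\<^esub> \<alpha> i j = \<alpha> i k"
    using assms(1) unfolding direct_system_def by blast+
  then show "Farr F (\<alpha> j k) \<cdot>\<^bsub>D\<^esub> Farr F (\<alpha> i j) = Farr F (\<alpha> i k)" using Farr_Cmp by metis
qed (use assms Farr_Hom in \<open>auto simp: direct_system_def\<close>)

lemma Farr_direct_system_map:
  assumes "direct_system_map C I r A \<alpha> B \<beta> f" "direct_system C I r A \<alpha>" "direct_system C I r B \<beta>" "r \<subseteq> I \<times> I"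
  shows "direct_system_map D I r (\<lambda>i. Fobj F (A i)) (\<lambda>i j. Farr F (\<alpha> i j))
    (\<lambda>i. Fobj F (B i)) (\<lambda>i j. Farr F (\<beta> i j)) (\<lambda>i. Farr F (f i))"
  unfolding direct_system_map_def
proof (intro conjI ballI allI impI)
  fix i j assume ij: "(i, j) \<in> r"
  then have "\<alpha> i j \<in> Hom C (A i) (A j)" "\<beta> i j \<in> Hom C (B i) (B j)" "i \<in> I" "j \<in> I"
    using assms(2-4) unfolding direct_system_def by blast+
  moreover have "f i \<in> Hom C (A i) (B i)" "f j \<in> Hom C (A j) (B j)" "f j \<cdot>\<^bsub>C\<^esub> \<alpha> i j = \<beta> i j \<cdot>\<^bsub>C\<^esub> f i"
    using assms(1) calculation ij unfolding direct_system_map_def by blast+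
  ultimately show "Farr F (f j) \<cdot>\<^bsub>D\<^esub> Farr F (\<alpha> i j) = Farr F (\<beta> i j) \<cdot>\<^bsub>D\<^esub> Farr F (f i)"
    using Farr_Cmp by metis
qed (use assms(1) Farr_Hom in \<open>auto simp: direct_system_map_def\<close>)

lemma fully_faithful_full:
  assumes "fully_faithful C D F" "a \<in> Obj C" "b \<in> Obj C" "g \<in> Hom D (Fobj F a) (Fobj F b)"
  obtains f where "f \<in> Hom C a b" "Farr F f = g"
proof -
  have "Farr F ` Hom C a b = Hom D (Fobj F a) (Fobj F b)"
    using assms(1-3) unfolding fully_faithful_def bij_betw_def by blast
  then have "g \<in> Farr F ` Hom C a b" using assms(4) by simp
  then show thesis using that by blast
qed

lemma fully_faithful_faithful:
  assumes "fully_faithful C D F" "f \<in> Hom C a b" "f' \<in> Hom C a b" "Farr F f = Farr F f'"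
  shows "f = f'"
proof -
  have "inj_on (Farr F) (Hom C a b)"
    using assms dom.Hom_ObjD[OF assms(2)] unfolding fully_faithful_def bij_betw_def by blast
  then show ?thesis using assms by (auto dest: inj_onD)
qed

lemma fully_faithful_reflects_kernel:
  assumes ff: "fully_faithful C D F" and k: "k \<in> Hom C c a" and f: "f \<in> Hom C a b"
    and ker: "is_kernel D (Farr F k) (Farr F f)"
  shows "is_kernel C k f"
proof (rule dom.kernelI[OF f k])
  note Fk = Farr_Hom[OF k] and Ff = Farr_Hom[OF f]
  note K = cod.kernelD[OF ker Ff Fk]
  have z: "Zer C c b \<in> Hom C c b" using k f dom.Zer_Hom by (simp add: dom.Hom_iff)
  show "f \<cdot>\<^bsub>C\<^esub> k = Zer C c b"
    using fully_faithful_faithful[OF ff dom.Cmp_Hom[OF k f] z] K(1) k f by (simp add: dom.Hom_iff)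
  show "is_mono C k"
  proof (rule dom.is_monoI_cancel[OF k])
    fix t g h assume g: "g \<in> Hom C t c" and h: "h \<in> Hom C t c" and e: "k \<cdot>\<^bsub>C\<^esub> g = k \<cdot>\<^bsub>C\<^esub> h"
    have "Farr F g = Farr F h"
      using cod.mono_cancel[OF K(2) Fk Farr_Hom[OF g] Farr_Hom[OF h]] Farr_Cmp[OF g k] Farr_Cmp[OF h k] e by simp
    then show "g = h" using fully_faithful_faithful[OF ff g h] by blast
  qed
  fix t g assume g: "g \<in> Hom C t a" and e: "f \<cdot>\<^bsub>C\<^esub> g = Zer C t b"
  have tb: "t \<in> Obj C" "b \<in> Obj C" "c \<in> Obj C" using g f k by (auto simp: dom.Hom_iff)
  have "Farr F f \<cdot>\<^bsub>D\<^esub> Farr F g = Zer D (Fobj F t) (Fobj F b)" using Farr_Cmp[OF g f] e tb by simp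
  then obtain u where u: "u \<in> Hom D (Fobj F t) (Fobj F c)" "Farr F k \<cdot>\<^bsub>D\<^esub> u = Farr F g"
    using K(3)[OF Farr_Hom[OF g]] by blast
  obtain v where v: "v \<in> Hom C t c" "Farr F v = u" using fully_faithful_full[OF ff tb(1,3) u(1)] .
  have "k \<cdot>\<^bsub>C\<^esub> v = g"
    using fully_faithful_faithful[OF ff dom.Cmp_Hom[OF v(1) k] g] Farr_Cmp[OF v(1) k] v u by simp
  then show "\<exists>u \<in> Hom C t c. k \<cdot>\<^bsub>C\<^esub> u = g" using v by blast
qed

lemma fully_faithful_reflects_cokernel:
  assumes ff: "fully_faithful C D F" and f: "f \<in> Hom C a b" and q: "q \<in> Hom C b c"
    and cok: "is_cokernel D (Farr F q) (Farr F f)"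
  shows "is_cokernel C q f"
proof (rule dom.cokernelI[OF f q])
  note Fq = Farr_Hom[OF q] and Ff = Farr_Hom[OF f]
  note K = cod.cokernelD[OF cok Ff Fq]
  have z: "Zer C a c \<in> Hom C a c" using q f dom.Zer_Hom by (simp add: dom.Hom_iff)
  show "q \<cdot>\<^bsub>C\<^esub> f = Zer C a c"
    using fully_faithful_faithful[OF ff dom.Cmp_Hom[OF f q] z] K(1) q f by (simp add: dom.Hom_iff)
  show "is_epi C q"
  proof (rule dom.is_epiI_cancel[OF q])
    fix t g h assume g: "g \<in> Hom C c t" and h: "h \<in> Hom C c t" and e: "g \<cdot>\<^bsub>C\<^esub> q = h \<cdot>\<^bsub>C\<^esub> q"
    have "Farr F g = Farr F h"
      using cod.epi_cancel[OF K(2) Fq Farr_Hom[OF g] Farr_Hom[OF h]] Farr_Cmp[OF q g] Farr_Cmp[OF q h] e by simp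
    then show "g = h" using fully_faithful_faithful[OF ff g h] by blast
  qed
  fix t g assume g: "g \<in> Hom C b t" and e: "g \<cdot>\<^bsub>C\<^esub> f = Zer C a t"
  have ta: "t \<in> Obj C" "a \<in> Obj C" "c \<in> Obj C" using g f q by (auto simp: dom.Hom_iff)
  have "Farr F g \<cdot>\<^bsub>D\<^esub> Farr F f = Zer D (Fobj F a) (Fobj F t)" using Farr_Cmp[OF f g] e ta by simp
  then obtain u where u: "u \<in> Hom D (Fobj F c) (Fobj F t)" "u \<cdot>\<^bsub>D\<^esub> Farr F q = Farr F g"
    using K(3)[OF Farr_Hom[OF g]] by blast
  obtain v where v: "v \<in> Hom C c t" "Farr F v = u" using fully_faithful_full[OF ff ta(3,1) u(1)] .
  have "v \<cdot>\<^bsub>C\<^esub> q = g"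
    using fully_faithful_faithful[OF ff dom.Cmp_Hom[OF q v(1)] g] Farr_Cmp[OF q v(1)] v u by simp
  then show "\<exists>u \<in> Hom C c t. u \<cdot>\<^bsub>C\<^esub> q = g" using v by blast
qed

end

text \<open>An adjunction is given by its unit; the hom set bijection is then transposition, \<open>h \<mapsto> R h \<cdot> \<eta> a\<close>.\<close>

locale adjunction =
  L: additive_functor C D L + R: additive_functor D C R
  for C :: "('o, 'm) addcat" and D :: "('p, 'n) addcat"
    and L :: "('o, 'm, 'p, 'n) cat_functor" and R :: "('p, 'n, 'o, 'm) cat_functor" +
  fixes \<eta> :: "'o \<Rightarrow> 'm"
  assumes unit_Hom: "a \<in> Obj C \<Longrightarrow> \<eta> a \<in> Hom C a (Fobj R (Fobj L a))"
    and unit_natural: "f \<in> Hom C a a' \<Longrightarrow> \<eta> a' \<cdot>\<^bsub>C\<^esub> f = Farr R (Farr L f) \<cdot>\<^bsub>C\<^esub> \<eta> a"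
    and unit_universal: "a \<in> Obj C \<Longrightarrow> b \<in> Obj D \<Longrightarrow> f \<in> Hom C a (Fobj R b)
      \<Longrightarrow> \<exists>!h. h \<in> Hom D (Fobj L a) b \<and> Farr R h \<cdot>\<^bsub>C\<^esub> \<eta> a = f"

definition adj_unit where
  "adj_unit C D L R = (SOME \<eta>. adjunction C D L R \<eta>)"

text \<open>The unit at \<open>a\<close> corresponds to the identity of \<open>L a\<close>; naturality of the bijections turns each of them
  into \<open>h \<mapsto> R h \<cdot> \<eta> a\<close>.\<close>

lemma left_adjoint_imp_adjunction:
  assumes "additive_functor C D L" "additive_functor D C R" "left_adjoint C D L R"
  shows "adjunction C D L R (adj_unit C D L R)"
proof -
  interpret L: additive_functor C D L by fact
  interpret R: additive_functor D C R by fact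
  obtain \<Phi> where bij: "\<And>a b. a \<in> Obj C \<Longrightarrow> b \<in> Obj D \<Longrightarrow>
      bij_betw (\<Phi> a b) (Hom D (Fobj L a) b) (Hom C a (Fobj R b))"
    and nat: "\<And>a a' b b' f g h. f \<in> Hom C a' a \<Longrightarrow> g \<in> Hom D b b' \<Longrightarrow> h \<in> Hom D (Fobj L a) b \<Longrightarrow>
        \<Phi> a' b' (g \<cdot>\<^bsub>D\<^esub> h \<cdot>\<^bsub>D\<^esub> Farr L f) = Farr R g \<cdot>\<^bsub>C\<^esub> \<Phi> a b h \<cdot>\<^bsub>C\<^esub> f"
    using assms(3) unfolding left_adjoint_def by blast
  define \<eta> where "\<eta> a = \<Phi> a (Fobj L a) (Ide D (Fobj L a))" for a
  have I: "Ide D (Fobj L a) \<in> Hom D (Fobj L a) (Fobj L a)" "Ide C a \<in> Hom C a a" if "a \<in> Obj C" for a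
    using that L.cod.Ide_Hom L.dom.Ide_Hom by simp_all
  have uH: "\<eta> a \<in> Hom C a (Fobj R (Fobj L a))" if "a \<in> Obj C" for a
    using bij_betwE[OF bij[OF that, of "Fobj L a"]] I that unfolding \<eta>_def by simp
  have \<Phi>: "\<Phi> a b h = Farr R h \<cdot>\<^bsub>C\<^esub> \<eta> a" if "a \<in> Obj C" "h \<in> Hom D (Fobj L a) b" for a b h
  proof -
    have "\<Phi> a b (h \<cdot>\<^bsub>D\<^esub> Ide D (Fobj L a) \<cdot>\<^bsub>D\<^esub> Farr L (Ide C a)) = Farr R h \<cdot>\<^bsub>C\<^esub> \<eta> a \<cdot>\<^bsub>C\<^esub> Ide C a"
      unfolding \<eta>_def using nat[OF I(2)[OF that(1)] that(2) I(1)[OF that(1)]] .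
    then show ?thesis using that uH[OF that(1)] by (simp add: L.dom.Hom_iff L.cod.Hom_iff)
  qed
  have "adjunction C D L R \<eta>"
  proof
    show "\<eta> a \<in> Hom C a (Fobj R (Fobj L a))" if "a \<in> Obj C" for a using uH[OF that] .
    show "\<eta> a' \<cdot>\<^bsub>C\<^esub> f = Farr R (Farr L f) \<cdot>\<^bsub>C\<^esub> \<eta> a" if f: "f \<in> Hom C a a'" for a a' f
    proof -
      have o: "a \<in> Obj C" "a' \<in> Obj C" using L.dom.Hom_ObjD[OF f] .
      have "\<Phi> a (Fobj L a') (Ide D (Fobj L a') \<cdot>\<^bsub>D\<^esub> Ide D (Fobj L a') \<cdot>\<^bsub>D\<^esub> Farr L f)
          = Farr R (Ide D (Fobj L a')) \<cdot>\<^bsub>C\<^esub> \<eta> a' \<cdot>\<^bsub>C\<^esub> f"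
        unfolding \<eta>_def using nat[OF f I(1)[OF o(2)] I(1)[OF o(2)]] .
      then have "\<Phi> a (Fobj L a') (Farr L f) = \<eta> a' \<cdot>\<^bsub>C\<^esub> f"
        using f uH[OF o(2)] by (simp add: L.dom.Hom_iff)
      then show ?thesis using \<Phi>[OF o(1) L.Farr_Hom[OF f]] by simp
    qed
    fix a b f assume a: "a \<in> Obj C" and b: "b \<in> Obj D" and f: "f \<in> Hom C a (Fobj R b)"
    have "inj_on (\<Phi> a b) (Hom D (Fobj L a) b)" "f \<in> \<Phi> a b ` Hom D (Fobj L a) b"
      using bij[OF a b] f unfolding bij_betw_def by simp_all
    then have "\<exists>!h. h \<in> Hom D (Fobj L a) b \<and> \<Phi> a b h = f" by (auto dest: inj_onD)
    then show "\<exists>!h. h \<in> Hom D (Fobj L a) b \<and> Farr R h \<cdot>\<^bsub>C\<^esub> \<eta> a = f"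
      using \<Phi>[OF a] by metis
  qed
  then show ?thesis unfolding adj_unit_def by (rule someI[of "adjunction C D L R"])
qed

context adjunction
begin

lemma unit_typing [simp]:
  assumes "a \<in> Obj C"
  shows "\<eta> a \<in> Arr C" "Dom C (\<eta> a) = a" "Cod C (\<eta> a) = Fobj R (Fobj L a)"
  using unit_Hom[OF assms] by (simp_all add: L.dom.Hom_iff)

lemma transpose_exists:
  assumes "f \<in> Hom C a (Fobj R b)" "b \<in> Obj D"
  obtains h where "h \<in> Hom D (Fobj L a) b" "Farr R h \<cdot>\<^bsub>C\<^esub> \<eta> a = f"
  using unit_universal[OF L.dom.Hom_ObjD(1)[OF assms(1)] assms(2,1)] by blast

lemma transpose_Hom:
  assumes "a \<in> Obj C" "h \<in> Hom D (Fobj L a) b"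
  shows "Farr R h \<cdot>\<^bsub>C\<^esub> \<eta> a \<in> Hom C a (Fobj R b)"
  using L.dom.Cmp_Hom[OF unit_Hom[OF assms(1)] R.Farr_Hom[OF assms(2)]] .

lemma transpose_inject:
  assumes "a \<in> Obj C" "h \<in> Hom D (Fobj L a) b" "h' \<in> Hom D (Fobj L a) b"
    and "Farr R h \<cdot>\<^bsub>C\<^esub> \<eta> a = Farr R h' \<cdot>\<^bsub>C\<^esub> \<eta> a"
  shows "h = h'"
  using unit_universal[OF assms(1) L.cod.Hom_ObjD(2)[OF assms(2)] transpose_Hom[OF assms(1,2)]] assms by metis

lemma transpose_Cmp_left:
  assumes "a \<in> Obj C" "h \<in> Hom D (Fobj L a) b" "g \<in> Hom D b c"
  shows "Farr R (g \<cdot>\<^bsub>D\<^esub> h) \<cdot>\<^bsub>C\<^esub> \<eta> a = Farr R g \<cdot>\<^bsub>C\<^esub> (Farr R h \<cdot>\<^bsub>C\<^esub> \<eta> a)"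
  using assms by (simp add: L.cod.Hom_iff)

lemma transpose_Cmp_right:
  assumes "f \<in> Hom C a a'" "h \<in> Hom D (Fobj L a') b"
  shows "Farr R (h \<cdot>\<^bsub>D\<^esub> Farr L f) \<cdot>\<^bsub>C\<^esub> \<eta> a = (Farr R h \<cdot>\<^bsub>C\<^esub> \<eta> a') \<cdot>\<^bsub>C\<^esub> f"
  using assms unit_natural[OF assms(1)] by (simp add: L.cod.Hom_iff L.dom.Hom_iff)

lemma transpose_Zer:
  assumes "a \<in> Obj C" "b \<in> Obj D"
  shows "Farr R (Zer D (Fobj L a) b) \<cdot>\<^bsub>C\<^esub> \<eta> a = Zer C a (Fobj R b)"
  using assms by simp

lemma transpose_eq_Zer:
  assumes "a \<in> Obj C" "h \<in> Hom D (Fobj L a) b" "Farr R h \<cdot>\<^bsub>C\<^esub> \<eta> a = Zer C a (Fobj R b)"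
  shows "h = Zer D (Fobj L a) b"
proof -
  have b: "b \<in> Obj D" using L.cod.Hom_ObjD[OF assms(2)] by blast
  show ?thesis
    using transpose_inject[OF assms(1,2) L.cod.Zer_Hom] transpose_Zer assms b by simp
qed

lemma left_adjoint_preserves_epi:
  assumes e: "is_epi C e" "e \<in> Hom C a b"
  shows "is_epi D (Farr L e)"
proof (rule L.cod.is_epiI[OF L.Farr_Hom[OF e(2)]])
  fix t g assume g: "g \<in> Hom D (Fobj L b) t" and z: "g \<cdot>\<^bsub>D\<^esub> Farr L e = Zer D (Fobj L a) t"
  have o: "a \<in> Obj C" "b \<in> Obj C" "t \<in> Obj D" using e g by (auto simp: L.dom.Hom_iff L.cod.Hom_iff)
  have "(Farr R g \<cdot>\<^bsub>C\<^esub> \<eta> b) \<cdot>\<^bsub>C\<^esub> e = Zer C a (Fobj R t)"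
    using transpose_Cmp_right[OF e(2) g] z transpose_Zer o by simp
  then have "Farr R g \<cdot>\<^bsub>C\<^esub> \<eta> b = Zer C b (Fobj R t)"
    using L.dom.epi_zero[OF e transpose_Hom[OF o(2) g]] by blast
  then show "g = Zer D (Fobj L b) t" using transpose_eq_Zer[OF o(2) g] by blast
qed

lemma left_adjoint_preserves_cokernel:
  assumes "is_cokernel C q f" and f: "f \<in> Hom C a b" and q: "q \<in> Hom C b c"
  shows "is_cokernel D (Farr L q) (Farr L f)"
proof (rule L.cod.cokernelI[OF L.Farr_Hom[OF f] L.Farr_Hom[OF q]])
  note K = L.dom.cokernelD[OF assms]
  have o: "a \<in> Obj C" "b \<in> Obj C" "c \<in> Obj C" using f q by (auto simp: L.dom.Hom_iff)
  show "Farr L q \<cdot>\<^bsub>D\<^esub> Farr L f = Zer D (Fobj L a) (Fobj L c)"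
    using L.Farr_Cmp[OF f q] K(1) o by simp
  show "is_epi D (Farr L q)" using left_adjoint_preserves_epi[OF K(2) q] .
  fix t g assume g: "g \<in> Hom D (Fobj L b) t" and z: "g \<cdot>\<^bsub>D\<^esub> Farr L f = Zer D (Fobj L a) t"
  have t: "t \<in> Obj D" using g by (simp add: L.cod.Hom_iff)
  have "(Farr R g \<cdot>\<^bsub>C\<^esub> \<eta> b) \<cdot>\<^bsub>C\<^esub> f = Zer C a (Fobj R t)"
    using transpose_Cmp_right[OF f g] z transpose_Zer o t by simp
  then obtain w where w: "w \<in> Hom C c (Fobj R t)" "w \<cdot>\<^bsub>C\<^esub> q = Farr R g \<cdot>\<^bsub>C\<^esub> \<eta> b"
    using K(3)[OF transpose_Hom[OF o(2) g]] by blast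
  obtain h where h: "h \<in> Hom D (Fobj L c) t" "Farr R h \<cdot>\<^bsub>C\<^esub> \<eta> c = w" using transpose_exists[OF w(1) t] .
  have "h \<cdot>\<^bsub>D\<^esub> Farr L q = g"
    using transpose_inject[OF o(2) L.cod.Cmp_Hom[OF L.Farr_Hom[OF q] h(1)] g] transpose_Cmp_right[OF q h(1)] h w
    by simp
  then show "\<exists>u \<in> Hom D (Fobj L c) t. u \<cdot>\<^bsub>D\<^esub> Farr L q = g" using h by blast
qed

lemma right_adjoint_preserves_mono:
  assumes m: "is_mono D m" "m \<in> Hom D a b"
  shows "is_mono C (Farr R m)"
proof (rule L.dom.is_monoI[OF R.Farr_Hom[OF m(2)]])
  fix t g assume g: "g \<in> Hom C t (Fobj R a)" and z: "Farr R m \<cdot>\<^bsub>C\<^esub> g = Zer C t (Fobj R b)"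
  have o: "a \<in> Obj D" "b \<in> Obj D" "t \<in> Obj C" using m g by (auto simp: L.dom.Hom_iff L.cod.Hom_iff)
  obtain h where h: "h \<in> Hom D (Fobj L t) a" "Farr R h \<cdot>\<^bsub>C\<^esub> \<eta> t = g" using transpose_exists[OF g o(1)] .
  have "m \<cdot>\<^bsub>D\<^esub> h = Zer D (Fobj L t) b"
    using transpose_eq_Zer[OF o(3) L.cod.Cmp_Hom[OF h(1) m(2)]] transpose_Cmp_left[OF o(3) h(1) m(2)] h z by simp
  then have "h = Zer D (Fobj L t) a" using L.cod.mono_zero[OF m h(1)] by blast
  then show "g = Zer C t (Fobj R a)" using h transpose_Zer o by simp
qed

lemma right_adjoint_preserves_kernel:
  assumes "is_kernel D k f" and f: "f \<in> Hom D a b" and k: "k \<in> Hom D c a"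
  shows "is_kernel C (Farr R k) (Farr R f)"
proof (rule L.dom.kernelI[OF R.Farr_Hom[OF f] R.Farr_Hom[OF k]])
  note K = L.cod.kernelD[OF assms]
  have o: "a \<in> Obj D" "b \<in> Obj D" "c \<in> Obj D" using f k by (auto simp: L.cod.Hom_iff)
  show "Farr R f \<cdot>\<^bsub>C\<^esub> Farr R k = Zer C (Fobj R c) (Fobj R b)"
    using R.Farr_Cmp[OF k f] K(1) o by simp
  show "is_mono C (Farr R k)" using right_adjoint_preserves_mono[OF K(2) k] .
  fix t g assume g: "g \<in> Hom C t (Fobj R a)" and z: "Farr R f \<cdot>\<^bsub>C\<^esub> g = Zer C t (Fobj R b)"
  have t: "t \<in> Obj C" using g by (simp add: L.dom.Hom_iff)
  obtain h where h: "h \<in> Hom D (Fobj L t) a" "Farr R h \<cdot>\<^bsub>C\<^esub> \<eta> t = g" using transpose_exists[OF g o(1)] .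
  have "f \<cdot>\<^bsub>D\<^esub> h = Zer D (Fobj L t) b"
    using transpose_eq_Zer[OF t L.cod.Cmp_Hom[OF h(1) f]] transpose_Cmp_left[OF t h(1) f] h z by simp
  then obtain w where w: "w \<in> Hom D (Fobj L t) c" "k \<cdot>\<^bsub>D\<^esub> w = h" using K(3)[OF h(1)] by blast
  have "Farr R k \<cdot>\<^bsub>C\<^esub> (Farr R w \<cdot>\<^bsub>C\<^esub> \<eta> t) = g"
    using transpose_Cmp_left[OF t w(1) k] w h by simp
  then show "\<exists>u \<in> Hom C t (Fobj R c). Farr R k \<cdot>\<^bsub>C\<^esub> u = g" using transpose_Hom[OF t w(1)] by blast
qed

lemma left_adjoint_preserves_direct_limit:
  assumes lim: "is_direct_limit C I r A \<alpha> S l" and sys: "direct_system C I r A \<alpha>" and r: "r \<subseteq> I \<times> I"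
  shows "is_direct_limit D I r (\<lambda>i. Fobj L (A i)) (\<lambda>i j. Farr L (\<alpha> i j)) (Fobj L S) (\<lambda>i. Farr L (l i))"
  unfolding is_direct_limit_def
proof (intro conjI allI impI)
  have S: "S \<in> Obj C" and l: "\<And>i. i \<in> I \<Longrightarrow> l i \<in> Hom C (A i) S"
    and lc: "\<And>i j. (i, j) \<in> r \<Longrightarrow> l j \<cdot>\<^bsub>C\<^esub> \<alpha> i j = l i"
    using lim unfolding is_direct_limit_def is_cocone_def by blast+
  have \<alpha>: "\<And>i j. (i, j) \<in> r \<Longrightarrow> \<alpha> i j \<in> Hom C (A i) (A j)" and A: "\<And>i. i \<in> I \<Longrightarrow> A i \<in> Obj C"
    using sys unfolding direct_system_def by blast+
  show "is_cocone D I r (\<lambda>i. Fobj L (A i)) (\<lambda>i j. Farr L (\<alpha> i j)) (Fobj L S) (\<lambda>i. Farr L (l i))"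
    unfolding is_cocone_def
  proof (intro conjI ballI allI impI)
    fix i j assume ij: "(i, j) \<in> r"
    then have "j \<in> I" using r by blast
    from L.Farr_Cmp[OF \<alpha>[OF ij] l[OF this]] show "Farr L (l j) \<cdot>\<^bsub>D\<^esub> Farr L (\<alpha> i j) = Farr L (l i)"
      using lc[OF ij] by simp
  qed (use S L.Farr_Hom[OF l] in auto)
  fix T t assume T: "is_cocone D I r (\<lambda>i. Fobj L (A i)) (\<lambda>i j. Farr L (\<alpha> i j)) T t"
  then have To: "T \<in> Obj D" and t: "\<And>i. i \<in> I \<Longrightarrow> t i \<in> Hom D (Fobj L (A i)) T"
    and tc: "\<And>i j. (i, j) \<in> r \<Longrightarrow> t j \<cdot>\<^bsub>D\<^esub> Farr L (\<alpha> i j) = t i"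
    unfolding is_cocone_def by blast+
  have "is_cocone C I r A \<alpha> (Fobj R T) (\<lambda>i. Farr R (t i) \<cdot>\<^bsub>C\<^esub> \<eta> (A i))"
    unfolding is_cocone_def
  proof (intro conjI ballI allI impI)
    show "Farr R (t i) \<cdot>\<^bsub>C\<^esub> \<eta> (A i) \<in> Hom C (A i) (Fobj R T)" if "i \<in> I" for i
      using transpose_Hom[OF A t] that by blast
    fix i j assume ij: "(i, j) \<in> r"
    then have "j \<in> I" using r by blast
    then show "(Farr R (t j) \<cdot>\<^bsub>C\<^esub> \<eta> (A j)) \<cdot>\<^bsub>C\<^esub> \<alpha> i j = Farr R (t i) \<cdot>\<^bsub>C\<^esub> \<eta> (A i)"
      using transpose_Cmp_right[OF \<alpha>[OF ij] t[of j]] tc[OF ij] by simp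
  qed (use To in simp)
  then have U: "\<exists>!u. u \<in> Hom C S (Fobj R T) \<and> (\<forall>i \<in> I. u \<cdot>\<^bsub>C\<^esub> l i = Farr R (t i) \<cdot>\<^bsub>C\<^esub> \<eta> (A i))"
    using lim unfolding is_direct_limit_def by blast
  have eq: "h \<cdot>\<^bsub>D\<^esub> Farr L (l i) = t i \<longleftrightarrow> (Farr R h \<cdot>\<^bsub>C\<^esub> \<eta> S) \<cdot>\<^bsub>C\<^esub> l i = Farr R (t i) \<cdot>\<^bsub>C\<^esub> \<eta> (A i)"
    if h: "h \<in> Hom D (Fobj L S) T" and i: "i \<in> I" for h i
    using transpose_Cmp_right[OF l[OF i] h]
      transpose_inject[OF A[OF i] L.cod.Cmp_Hom[OF L.Farr_Hom[OF l[OF i]] h] t[OF i]] by metis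
  from U obtain u where u: "u \<in> Hom C S (Fobj R T)" "\<forall>i \<in> I. u \<cdot>\<^bsub>C\<^esub> l i = Farr R (t i) \<cdot>\<^bsub>C\<^esub> \<eta> (A i)" by blast
  obtain h where h: "h \<in> Hom D (Fobj L S) T" "Farr R h \<cdot>\<^bsub>C\<^esub> \<eta> S = u" using transpose_exists[OF u(1) To] .
  show "\<exists>!u. u \<in> Hom D (Fobj L S) T \<and> (\<forall>i \<in> I. u \<cdot>\<^bsub>D\<^esub> Farr L (l i) = t i)"
  proof (rule ex1I[of _ h])
    show "h \<in> Hom D (Fobj L S) T \<and> (\<forall>i \<in> I. h \<cdot>\<^bsub>D\<^esub> Farr L (l i) = t i)" using eq h u by auto
    fix h' assume h': "h' \<in> Hom D (Fobj L S) T \<and> (\<forall>i \<in> I. h' \<cdot>\<^bsub>D\<^esub> Farr L (l i) = t i)"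
    then have "\<forall>i \<in> I. (Farr R h' \<cdot>\<^bsub>C\<^esub> \<eta> S) \<cdot>\<^bsub>C\<^esub> l i = Farr R (t i) \<cdot>\<^bsub>C\<^esub> \<eta> (A i)" using eq by blast
    then have hu: "Farr R h' \<cdot>\<^bsub>C\<^esub> \<eta> S = u" using U u transpose_Hom[OF S conjunct1[OF h']] by (metis (no_types, lifting))
    show "h' = h" using transpose_inject[OF S conjunct1[OF h'] h(1)] hu h(2) by simp
  qed
qed

text \<open>Arrows from \<open>a\<close> to \<open>R b\<close> correspond to arrows out of \<open>L a\<close>, so all vanish if \<open>L a\<close> does.\<close>

lemma transpose_zero_object:
  assumes a: "a \<in> Obj C" "is_zero_object D (Fobj L a)" and f: "f \<in> Hom C a (Fobj R b)" and b: "b \<in> Obj D"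
  shows "f = Zer C a (Fobj R b)"
proof -
  obtain h where h: "h \<in> Hom D (Fobj L a) b" "Farr R h \<cdot>\<^bsub>C\<^esub> \<eta> a = f" using transpose_exists[OF f b] .
  show ?thesis using L.cod.zero_object_Hom(1)[OF a(2) h(1)] h(2) transpose_Zer[OF a(1) b] by simp
qed

text \<open>The inverse of \<open>L (\<eta> a)\<close> is the counit at \<open>L a\<close>. One composite is a triangle identity. For the other,
  the counit itself has to be invertible: since \<open>R\<close> is full, \<open>\<eta>\<close> at \<open>R (L a)\<close> comes from an arrow of \<open>D\<close>,
  which is its inverse.\<close>

lemma left_adjoint_unit_iso:
  assumes ff: "fully_faithful D C R" and a: "a \<in> Obj C"
  shows "is_iso D (Farr L (\<eta> a))"
proof -
  let ?b = "Fobj L a" and ?Ra = "Fobj R (Fobj L a)"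
  have b: "?b \<in> Obj D" and Ra: "?Ra \<in> Obj C" using a by simp_all
  note Lu = L.Farr_Hom[OF unit_Hom[OF a]]
  have Rb: "Ide C ?Ra \<in> Hom C ?Ra (Fobj R ?b)" using L.dom.Ide_Hom Ra by blast
  obtain \<epsilon> where e: "\<epsilon> \<in> Hom D (Fobj L ?Ra) ?b" "Farr R \<epsilon> \<cdot>\<^bsub>C\<^esub> \<eta> ?Ra = Ide C ?Ra" using transpose_exists[OF Rb b] .
  obtain \<delta> where d: "\<delta> \<in> Hom D ?b (Fobj L ?Ra)" "Farr R \<delta> = \<eta> ?Ra"
    using R.fully_faithful_full[OF ff b _ unit_Hom[OF Ra]] Ra by auto
  have ed: "\<epsilon> \<cdot>\<^bsub>D\<^esub> \<delta> = Ide D ?b"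
    using R.fully_faithful_faithful[OF ff L.cod.Cmp_Hom[OF d(1) e(1)] L.cod.Ide_Hom[OF b]]
      R.Farr_Cmp[OF d(1) e(1)] d e b by simp
  have de: "\<delta> \<cdot>\<^bsub>D\<^esub> \<epsilon> = Ide D (Fobj L ?Ra)"
  proof (rule transpose_inject[OF Ra L.cod.Cmp_Hom[OF e(1) d(1)] L.cod.Ide_Hom])
    have "Farr R (\<delta> \<cdot>\<^bsub>D\<^esub> \<epsilon>) \<cdot>\<^bsub>C\<^esub> \<eta> ?Ra = Farr R \<delta>"
      using transpose_Cmp_left[OF Ra e(1) d(1)] e(2) d(1) by (simp add: L.cod.Hom_iff)
    then show "Farr R (\<delta> \<cdot>\<^bsub>D\<^esub> \<epsilon>) \<cdot>\<^bsub>C\<^esub> \<eta> ?Ra = Farr R (Ide D (Fobj L ?Ra)) \<cdot>\<^bsub>C\<^esub> \<eta> ?Ra"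
      using d Ra by simp
  qed (use Ra in simp)
  have eL: "\<epsilon> \<cdot>\<^bsub>D\<^esub> Farr L (\<eta> a) = Ide D ?b"
  proof (rule transpose_inject[OF a L.cod.Cmp_Hom[OF Lu e(1)] L.cod.Ide_Hom[OF b]])
    show "Farr R (\<epsilon> \<cdot>\<^bsub>D\<^esub> Farr L (\<eta> a)) \<cdot>\<^bsub>C\<^esub> \<eta> a = Farr R (Ide D ?b) \<cdot>\<^bsub>C\<^esub> \<eta> a"
      using transpose_Cmp_right[OF unit_Hom[OF a] e(1)] e(2) a by simp
  qed
  have "Farr L (\<eta> a) = (\<delta> \<cdot>\<^bsub>D\<^esub> \<epsilon>) \<cdot>\<^bsub>D\<^esub> Farr L (\<eta> a)" unfolding de using a by simp
  also have "\<dots> = \<delta> \<cdot>\<^bsub>D\<^esub> (\<epsilon> \<cdot>\<^bsub>D\<^esub> Farr L (\<eta> a))" using d(1) e(1) a by (simp add: L.cod.Hom_iff)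
  also have "\<dots> = \<delta>" unfolding eL using d(1) by (simp add: L.cod.Hom_iff)
  finally have "Farr L (\<eta> a) = \<delta>" .
  then show ?thesis using L.cod.is_isoI[OF d(1) e(1) ed de] by simp
qed

text \<open>Here the inverse is the arrow that \<open>L\<close> takes to the counit at \<open>L a\<close>.\<close>

lemma fully_faithful_left_adjoint_unit_iso:
  assumes ff: "fully_faithful C D L" and a: "a \<in> Obj C"
  shows "is_iso C (\<eta> a)"
proof -
  let ?b = "Fobj L a" and ?Ra = "Fobj R (Fobj L a)"
  have b: "?b \<in> Obj D" and Ra: "?Ra \<in> Obj C" using a by simp_all
  note u = unit_Hom[OF a]
  have Rb: "Ide C ?Ra \<in> Hom C ?Ra (Fobj R ?b)" using L.dom.Ide_Hom Ra by blast
  obtain \<epsilon> where e: "\<epsilon> \<in> Hom D (Fobj L ?Ra) ?b" "Farr R \<epsilon> \<cdot>\<^bsub>C\<^esub> \<eta> ?Ra = Ide C ?Ra" using transpose_exists[OF Rb b] .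
  obtain \<delta> where d: "\<delta> \<in> Hom C ?Ra a" "Farr L \<delta> = \<epsilon>" using L.fully_faithful_full[OF ff Ra a e(1)] .
  have 1: "\<eta> a \<cdot>\<^bsub>C\<^esub> \<delta> = Ide C ?Ra" using unit_natural[OF d(1)] d e by simp
  have "Farr L (\<delta> \<cdot>\<^bsub>C\<^esub> \<eta> a) = Ide D ?b"
  proof (rule transpose_inject[OF a])
    have "Farr R (\<epsilon> \<cdot>\<^bsub>D\<^esub> Farr L (\<eta> a)) \<cdot>\<^bsub>C\<^esub> \<eta> a = \<eta> a"
      using transpose_Cmp_right[OF u e(1)] e(2) a by simp
    then show "Farr R (Farr L (\<delta> \<cdot>\<^bsub>C\<^esub> \<eta> a)) \<cdot>\<^bsub>C\<^esub> \<eta> a = Farr R (Ide D ?b) \<cdot>\<^bsub>C\<^esub> \<eta> a"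
      using L.Farr_Cmp[OF u d(1)] d a by simp
    show "Farr L (\<delta> \<cdot>\<^bsub>C\<^esub> \<eta> a) \<in> Hom D ?b ?b" using L.Farr_Hom[OF L.dom.Cmp_Hom[OF u d(1)]] .
  qed (use a L.cod.Ide_Hom in simp)
  then have "\<delta> \<cdot>\<^bsub>C\<^esub> \<eta> a = Ide C a"
    using L.fully_faithful_faithful[OF ff L.dom.Cmp_Hom[OF u d(1)] L.dom.Ide_Hom[OF a]] a by simp
  then show ?thesis using L.dom.is_isoI[OF u d(1) _ 1] by blast
qed

end

section \<open>Coproducts and generators\<close>

text \<open>Coproducts and direct systems are indexed by subsets of the type of \<open>\<kappa>\<close>; this brings families indexed
  by hom sets into that form.\<close>

lemma small_set_indexed:
  fixes \<kappa> :: "'u rel" and S :: "'a set"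
  assumes "Card_order \<kappa>" "is_set \<kappa> S"
  obtains I :: "'u set" and e where "is_set \<kappa> I" "bij_betw e I S"
proof -
  have "|S| \<le>o \<kappa>" using assms(2) unfolding is_set_def by (rule ordLess_imp_ordLeq)
  also have "\<kappa> =o |Field \<kappa>|" using card_of_Field_ordIso[OF assms(1)] ordIso_symmetric by blast
  finally obtain f where f: "inj_on f S" "f ` S \<subseteq> Field \<kappa>" using card_of_ordLeq[of S "Field \<kappa>"] by blast
  have b: "bij_betw f S (f ` S)" using f(1) by (simp add: bij_betw_def)
  have "|f ` S| =o |S|" using card_of_ordIsoI[OF b] ordIso_symmetric by blast
  then have "is_set \<kappa> (f ` S)" using assms(2) ordIso_ordLess_trans unfolding is_set_def by blast
  then show thesis using that[OF _ bij_betw_inv_into[OF b]] by blast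
qed

lemma AB3D:
  fixes \<kappa> :: "'u rel" and I :: "'u set"
  assumes "AB3 \<kappa> C" "is_set \<kappa> I" "\<And>i. i \<in> I \<Longrightarrow> A i \<in> Obj C"
  shows "\<exists>S \<iota>. is_coproduct C I A S \<iota>"
  using assms unfolding AB3_def by blast

context category
begin

lemma coproductD:
  assumes "is_coproduct C I A S \<iota>"
  shows "S \<in> Obj C"
    and "\<And>i. i \<in> I \<Longrightarrow> \<iota> i \<in> Hom C (A i) S"
    and "\<And>T f. T \<in> Obj C \<Longrightarrow> (\<And>i. i \<in> I \<Longrightarrow> f i \<in> Hom C (A i) T)
      \<Longrightarrow> \<exists>u \<in> Hom C S T. \<forall>i \<in> I. u \<cdot> \<iota> i = f i"
    and "\<And>T u v. u \<in> Hom C S T \<Longrightarrow> v \<in> Hom C S T \<Longrightarrow> (\<And>i. i \<in> I \<Longrightarrow> u \<cdot> \<iota> i = v \<cdot> \<iota> i) \<Longrightarrow> u = v"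
proof -
  show S: "S \<in> Obj C" and \<iota>: "\<And>i. i \<in> I \<Longrightarrow> \<iota> i \<in> Hom C (A i) S"
    using assms unfolding is_coproduct_def by blast+
  have U: "\<exists>!u. u \<in> Hom C S T \<and> (\<forall>i \<in> I. u \<cdot> \<iota> i = f i)"
    if "T \<in> Obj C" "\<And>i. i \<in> I \<Longrightarrow> f i \<in> Hom C (A i) T" for T f
    using assms that unfolding is_coproduct_def by blast
  show "\<exists>u \<in> Hom C S T. \<forall>i \<in> I. u \<cdot> \<iota> i = f i"
    if "T \<in> Obj C" "\<And>i. i \<in> I \<Longrightarrow> f i \<in> Hom C (A i) T" for T f
    using U[OF that] by blast
  fix T u v assume u: "u \<in> Hom C S T" and v: "v \<in> Hom C S T" and e: "\<And>i. i \<in> I \<Longrightarrow> u \<cdot> \<iota> i = v \<cdot> \<iota> i"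
  have "\<exists>!w. w \<in> Hom C S T \<and> (\<forall>i \<in> I. w \<cdot> \<iota> i = v \<cdot> \<iota> i)"
    using U[OF Hom_ObjD(2)[OF v], of "\<lambda>i. v \<cdot> \<iota> i"] Cmp_Hom[OF \<iota> v] by blast
  then show "u = v" using u v e by (metis (no_types, lifting))
qed

end

context preadditive_category
begin

lemma coproduct_eq_Zer:
  assumes "is_coproduct C I A S \<iota>" "u \<in> Hom C S T" "\<And>i. i \<in> I \<Longrightarrow> u \<cdot> \<iota> i = Zer C (A i) T"
  shows "u = Zer C S T"
proof -
  have o: "S \<in> Obj C" "T \<in> Obj C" using assms(2) by (auto simp: Hom_iff)
  show ?thesis
  proof (rule coproductD(4)[OF assms(1,2) Zer_Hom[OF o]])
    fix i assume i: "i \<in> I"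
    show "u \<cdot> \<iota> i = Zer C S T \<cdot> \<iota> i"
      using coproductD(2)[OF assms(1) i] assms(3)[OF i] o by (simp add: Hom_iff)
  qed
qed

text \<open>Membership in \<open>Gen\<close> says that arrows out of the object are detected on arrows from \<open>G\<close>: the
  coproduct over all of the small set \<open>Hom(G, B)\<close> has an epimorphism to \<open>B\<close> if any coproduct has.\<close>

lemma Gen_iff:
  fixes \<kappa> :: "'u rel"
  assumes \<kappa>: "Card_order \<kappa>" and ab3: "AB3 \<kappa> C" and small: "hom_sets \<kappa> C"
    and G: "G \<in> Obj C" and B: "B \<in> Obj C"
  shows "B \<in> Gen \<kappa> C G \<longleftrightarrow>
    (\<forall>T. \<forall>t \<in> Hom C B T. t \<noteq> Zer C B T \<longrightarrow> (\<exists>h \<in> Hom C G B. t \<cdot> h \<noteq> Zer C G T))"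
proof
  assume "B \<in> Gen \<kappa> C G"
  then obtain I :: "'u set" and S \<iota> p where cop: "is_coproduct C I (\<lambda>_. G) S \<iota>" and p: "p \<in> Hom C S B" "is_epi C p"
    unfolding Gen_def by blast
  show "\<forall>T. \<forall>t \<in> Hom C B T. t \<noteq> Zer C B T \<longrightarrow> (\<exists>h \<in> Hom C G B. t \<cdot> h \<noteq> Zer C G T)"
  proof (intro allI ballI impI, rule ccontr)
    fix T t assume t: "t \<in> Hom C B T" "t \<noteq> Zer C B T" and n: "\<not> (\<exists>h \<in> Hom C G B. t \<cdot> h \<noteq> Zer C G T)"
    have "t \<cdot> p = Zer C S T"
    proof (rule coproduct_eq_Zer[OF cop Cmp_Hom[OF p(1) t(1)]])
      fix i assume i: "i \<in> I"
      note ii = coproductD(2)[OF cop i]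
      have "t \<cdot> (p \<cdot> \<iota> i) = Zer C G T" using n Cmp_Hom[OF ii p(1)] by blast
      then show "(t \<cdot> p) \<cdot> \<iota> i = Zer C G T" using ii p t by (simp add: Hom_iff)
    qed
    then show False using epi_zero[OF p(2,1) t(1)] t(2) by blast
  qed
next
  assume det: "\<forall>T. \<forall>t \<in> Hom C B T. t \<noteq> Zer C B T \<longrightarrow> (\<exists>h \<in> Hom C G B. t \<cdot> h \<noteq> Zer C G T)"
  have "is_set \<kappa> (Hom C G B)" using small G B unfolding hom_sets_def by blast
  then obtain I :: "'u set" and e where I: "is_set \<kappa> I" "bij_betw e I (Hom C G B)" using small_set_indexed[OF \<kappa>] by blast
  obtain S \<iota> where cop: "is_coproduct C I (\<lambda>_. G) S \<iota>" using AB3D[OF ab3 I(1), of "\<lambda>_. G"] G by blast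
  obtain p where p: "p \<in> Hom C S B" "\<forall>i \<in> I. p \<cdot> \<iota> i = e i"
    using coproductD(3)[OF cop B, of e] bij_betwE[OF I(2)] by blast
  have "is_epi C p"
  proof (rule is_epiI[OF p(1)], rule ccontr)
    fix T t assume t: "t \<in> Hom C B T" and tp: "t \<cdot> p = Zer C S T" and nz: "t \<noteq> Zer C B T"
    then obtain h where h: "h \<in> Hom C G B" "t \<cdot> h \<noteq> Zer C G T" using det by blast
    obtain i where i: "i \<in> I" "e i = h" using bij_betw_imp_surj_on[OF I(2)] h(1) by (metis imageE)
    note ii = coproductD(2)[OF cop i(1)]
    have "t \<cdot> h = (t \<cdot> p) \<cdot> \<iota> i" using p i ii t by (auto simp: Hom_iff)
    also have "\<dots> = Zer C G T" unfolding tp using ii t by (simp add: Hom_iff)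
    finally show False using h by blast
  qed
  then show "B \<in> Gen \<kappa> C G"
    unfolding Gen_def mem_Collect_eq using B I(1) cop p(1) by (intro conjI exI)
qed

lemma small_separating_family_imp_generator:
  fixes \<kappa> :: "'u rel"
  assumes \<kappa>: "Card_order \<kappa>" and ab3: "AB3 \<kappa> C" and J: "is_set \<kappa> J" "\<And>j. j \<in> J \<Longrightarrow> E j \<in> Obj C"
    and sep: "\<And>a b \<phi>. \<phi> \<in> Hom C a b \<Longrightarrow> \<phi> \<noteq> Zer C a b \<Longrightarrow> \<exists>j \<in> J. \<exists>h \<in> Hom C (E j) a. \<phi> \<cdot> h \<noteq> Zer C (E j) b"
  shows "\<exists>G. is_generator C G"
proof -
  obtain I :: "'u set" and e where I: "is_set \<kappa> I" "bij_betw e I J" using small_set_indexed[OF \<kappa> J(1)] by blast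
  have eI: "e i \<in> J" if "i \<in> I" for i using bij_betwE[OF I(2)] that by blast
  obtain S \<iota> where cop: "is_coproduct C I (\<lambda>i. E (e i)) S \<iota>"
    using AB3D[OF ab3 I(1), of "\<lambda>i. E (e i)"] J(2) eI by blast
  have "\<exists>h \<in> Hom C S a. \<phi> \<cdot> h \<noteq> Zer C S b" if f: "\<phi> \<in> Hom C a b" "\<phi> \<noteq> Zer C a b" for a b \<phi>
  proof -
    obtain j h where j: "j \<in> J" and h: "h \<in> Hom C (E j) a" "\<phi> \<cdot> h \<noteq> Zer C (E j) b" using sep[OF f] by blast
    obtain i where i: "i \<in> I" "e i = j" using bij_betw_imp_surj_on[OF I(2)] j by (metis imageE)
    note ii = coproductD(2)[OF cop i(1)]
    have a: "a \<in> Obj C" using f by (simp add: Hom_iff)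
    have "\<And>k. k \<in> I \<Longrightarrow> (if k = i then h else Zer C (E (e k)) a) \<in> Hom C (E (e k)) a"
      using h(1) i(2) Zer_Hom[OF J(2)[OF eI] a] by auto
    then obtain u where u: "u \<in> Hom C S a" "u \<cdot> \<iota> i = h"
      using coproductD(3)[OF cop a, of "\<lambda>k. if k = i then h else Zer C (E (e k)) a"] i(1) by auto
    have "\<phi> \<cdot> u \<noteq> Zer C S b"
    proof
      assume z: "\<phi> \<cdot> u = Zer C S b"
      have "\<phi> \<cdot> h = (\<phi> \<cdot> u) \<cdot> \<iota> i" using u f(1) ii by (auto simp: Hom_iff)
      also have "\<dots> = Zer C (E j) b" unfolding z using ii f(1) i(2) by (simp add: Hom_iff)
      finally show False using h(2) by blast
    qed
    then show ?thesis using u(1) by blast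
  qed
  then show ?thesis using coproductD(1)[OF cop] unfolding is_generator_def by blast
qed

end

section \<open>Exact sequences of direct limits\<close>

text \<open>The data and hypotheses in the definition of exact direct limits, as one predicate, so that its transport
  along functors can be stated.\<close>

definition exact_limit_sequence where
  "exact_limit_sequence C I r A \<alpha> B \<beta> D \<delta> f g L l M m N n u v \<longleftrightarrow>
     directed_set I r \<and>
     direct_system C I r A \<alpha> \<and> direct_system C I r B \<beta> \<and> direct_system C I r D \<delta> \<and>
     direct_system_map C I r A \<alpha> B \<beta> f \<and> direct_system_map C I r B \<beta> D \<delta> g \<and>
     (\<forall>i \<in> I. short_exact C (f i) (g i)) \<and>
     is_direct_limit C I r A \<alpha> L l \<and> is_direct_limit C I r B \<beta> M m \<and>
     is_direct_limit C I r D \<delta> N n \<and>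
     u \<in> Hom C L M \<and> (\<forall>i \<in> I. u \<cdot>\<^bsub>C\<^esub> l i = m i \<cdot>\<^bsub>C\<^esub> f i) \<and>
     v \<in> Hom C M N \<and> (\<forall>i \<in> I. v \<cdot>\<^bsub>C\<^esub> m i = n i \<cdot>\<^bsub>C\<^esub> g i)"

lemma direct_limits_exact_iff:
  fixes \<kappa> :: "'u rel"
  shows "direct_limits_exact \<kappa> C \<longleftrightarrow> (\<forall>(I :: 'u set) r A \<alpha> B \<beta> D \<delta> f g L l M m N n u v.
     is_set \<kappa> I \<longrightarrow> exact_limit_sequence C I r A \<alpha> B \<beta> D \<delta> f g L l M m N n u v \<longrightarrow> short_exact C u v)"
  unfolding direct_limits_exact_def exact_limit_sequence_def by (simp only: imp_conjL)

context category
begin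

lemma direct_limitD:
  assumes "is_direct_limit C I r A \<alpha> L l"
  shows "L \<in> Obj C"
    and "\<And>i. i \<in> I \<Longrightarrow> l i \<in> Hom C (A i) L"
    and "\<And>i j. (i, j) \<in> r \<Longrightarrow> l j \<cdot> \<alpha> i j = l i"
    and "\<And>T t. is_cocone C I r A \<alpha> T t \<Longrightarrow> \<exists>u \<in> Hom C L T. \<forall>i \<in> I. u \<cdot> l i = t i"
    and "\<And>T u v. r \<subseteq> I \<times> I \<Longrightarrow> direct_system C I r A \<alpha> \<Longrightarrow> u \<in> Hom C L T \<Longrightarrow> v \<in> Hom C L T
      \<Longrightarrow> (\<And>i. i \<in> I \<Longrightarrow> u \<cdot> l i = v \<cdot> l i) \<Longrightarrow> u = v"
proof -
  show L: "L \<in> Obj C" and l: "\<And>i. i \<in> I \<Longrightarrow> l i \<in> Hom C (A i) L"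
    and lc: "\<And>i j. (i, j) \<in> r \<Longrightarrow> l j \<cdot> \<alpha> i j = l i"
    using assms unfolding is_direct_limit_def is_cocone_def by blast+
  have U: "\<exists>!u. u \<in> Hom C L T \<and> (\<forall>i \<in> I. u \<cdot> l i = t i)" if "is_cocone C I r A \<alpha> T t" for T t
    using assms that unfolding is_direct_limit_def by blast
  show "\<exists>u \<in> Hom C L T. \<forall>i \<in> I. u \<cdot> l i = t i" if "is_cocone C I r A \<alpha> T t" for T t
    using U[OF that] by blast
  fix T u v
  assume r: "r \<subseteq> I \<times> I" and sys: "direct_system C I r A \<alpha>"
    and u: "u \<in> Hom C L T" and v: "v \<in> Hom C L T" and e: "\<And>i. i \<in> I \<Longrightarrow> u \<cdot> l i = v \<cdot> l i"
  have "is_cocone C I r A \<alpha> T (\<lambda>i. v \<cdot> l i)"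
    unfolding is_cocone_def
  proof (intro conjI ballI allI impI)
    show "T \<in> Obj C" using v by (simp add: Hom_iff)
    show "v \<cdot> l i \<in> Hom C (A i) T" if "i \<in> I" for i using Cmp_Hom[OF l[OF that] v] .
    fix i j assume ij: "(i, j) \<in> r"
    then have "i \<in> I" "j \<in> I" "\<alpha> i j \<in> Hom C (A i) (A j)" using r sys unfolding direct_system_def by blast+
    then show "(v \<cdot> l j) \<cdot> \<alpha> i j = v \<cdot> l i" using Cmp_assoc[OF _ l v] lc[OF ij] by metis
  qed
  from U[OF this] show "u = v" using u v e by (metis (no_types, lifting))
qed

end

context preadditive_category
begin

text \<open>Colimits commute with colimits: that the limit of the cokernels is the cokernel of the limits
  holds without any exactness assumption.\<close>

lemma exact_limit_sequence_cokernel: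
  assumes S: "exact_limit_sequence C I r A \<alpha> B \<beta> D \<delta> f g L l M m N n u v"
  shows "is_cokernel C v u"
proof -
  from S have r: "r \<subseteq> I \<times> I"
    and sA: "direct_system C I r A \<alpha>" and sB: "direct_system C I r B \<beta>" and sD: "direct_system C I r D \<delta>"
    and mf: "direct_system_map C I r A \<alpha> B \<beta> f" and mg: "direct_system_map C I r B \<beta> D \<delta> g"
    and se: "\<And>i. i \<in> I \<Longrightarrow> short_exact C (f i) (g i)"
    and lL: "is_direct_limit C I r A \<alpha> L l" and lM: "is_direct_limit C I r B \<beta> M m"
    and lN: "is_direct_limit C I r D \<delta> N n"
    and u: "u \<in> Hom C L M" and ul: "\<And>i. i \<in> I \<Longrightarrow> u \<cdot> l i = m i \<cdot> f i"
    and v: "v \<in> Hom C M N" and vm: "\<And>i. i \<in> I \<Longrightarrow> v \<cdot> m i = n i \<cdot> g i"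
    unfolding exact_limit_sequence_def directed_set_def preorder_on_def by blast+
  note L = direct_limitD[OF lL] and M = direct_limitD[OF lM] and N = direct_limitD[OF lN]
  have fi: "f i \<in> Hom C (A i) (B i)" and gi: "g i \<in> Hom C (B i) (D i)" if "i \<in> I" for i
    using that mf mg unfolding direct_system_map_def by blast+
  have bij: "\<beta> i j \<in> Hom C (B i) (B j)" and dij: "\<delta> i j \<in> Hom C (D i) (D j)"
    and gb: "g j \<cdot> \<beta> i j = \<delta> i j \<cdot> g i" if "(i, j) \<in> r" for i j
    using that sB sD mg unfolding direct_system_def direct_system_map_def by blast+
  have K: "g i \<cdot> f i = Zer C (A i) (D i)" "is_epi C (g i)" if "i \<in> I" for i
    using se[OF that] cokernelD[OF _ fi[OF that] gi[OF that]] unfolding short_exact_def by blast+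
  have Kf: "\<exists>w \<in> Hom C (D i) t. w \<cdot> g i = x" if "i \<in> I" "x \<in> Hom C (B i) t" "x \<cdot> f i = Zer C (A i) t" for i x t
    using se[OF that(1)] cokernelD(3)[OF _ fi[OF that(1)] gi[OF that(1)] that(2,3)] unfolding short_exact_def by blast
  show ?thesis
  proof (rule cokernelI[OF u v])
    show "v \<cdot> u = Zer C L N"
    proof (rule L(5)[OF r sA Cmp_Hom[OF u v] Zer_Hom])
      fix i assume i: "i \<in> I"
      have "(v \<cdot> u) \<cdot> l i = (v \<cdot> m i) \<cdot> f i"
        using ul[OF i] u v L(2)[OF i] M(2)[OF i] fi[OF i] by (simp add: Hom_iff)
      also have "\<dots> = n i \<cdot> (g i \<cdot> f i)"
        unfolding vm[OF i] using fi[OF i] gi[OF i] N(2)[OF i] by (simp add: Hom_iff)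
      also have "\<dots> = Zer C L N \<cdot> l i"
        unfolding K(1)[OF i] using N(2)[OF i] L(2)[OF i] fi[OF i] by (simp add: Hom_iff)
      finally show "(v \<cdot> u) \<cdot> l i = Zer C L N \<cdot> l i" .
    qed (use L(1) N(1) in auto)
    show "is_epi C v"
    proof (rule is_epiI_cancel[OF v])
      fix t x y assume x: "x \<in> Hom C N t" and y: "y \<in> Hom C N t" and e: "x \<cdot> v = y \<cdot> v"
      show "x = y"
      proof (rule N(5)[OF r sD x y])
        fix i assume i: "i \<in> I"
        note ty = Cmp_assoc[OF gi[OF i] N(2)[OF i]] Cmp_assoc[OF M(2)[OF i] v]
        have "(x \<cdot> n i) \<cdot> g i = (y \<cdot> n i) \<cdot> g i" using ty x y e vm[OF i] by metis
        then show "x \<cdot> n i = y \<cdot> n i"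
          using epi_cancel[OF K(2)[OF i] gi[OF i] Cmp_Hom[OF N(2)[OF i] x] Cmp_Hom[OF N(2)[OF i] y]] by blast
      qed
    qed
    fix T t assume t: "t \<in> Hom C M T" and tu: "t \<cdot> u = Zer C L T"
    have "\<forall>i \<in> I. \<exists>w \<in> Hom C (D i) T. w \<cdot> g i = t \<cdot> m i"
    proof
      fix i assume i: "i \<in> I"
      have "(t \<cdot> m i) \<cdot> f i = (t \<cdot> u) \<cdot> l i"
        using ul[OF i] t u L(2)[OF i] M(2)[OF i] fi[OF i] by (simp add: Hom_iff)
      also have "\<dots> = Zer C (A i) T" unfolding tu using t L(2)[OF i] by (simp add: Hom_iff)
      finally show "\<exists>w \<in> Hom C (D i) T. w \<cdot> g i = t \<cdot> m i" using Kf[OF i Cmp_Hom[OF M(2)[OF i] t]] by blast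
    qed
    then obtain w where w: "\<And>i. i \<in> I \<Longrightarrow> w i \<in> Hom C (D i) T" "\<And>i. i \<in> I \<Longrightarrow> w i \<cdot> g i = t \<cdot> m i" by metis
    have "is_cocone C I r D \<delta> T w"
      unfolding is_cocone_def
    proof (intro conjI ballI allI impI)
      show "T \<in> Obj C" using t by (simp add: Hom_iff)
      fix i j assume ij: "(i, j) \<in> r"
      then have i: "i \<in> I" and j: "j \<in> I" using r by blast+
      have "(w j \<cdot> \<delta> i j) \<cdot> g i = w j \<cdot> (g j \<cdot> \<beta> i j)"
        using Cmp_assoc[OF gi[OF i] dij[OF ij] w(1)[OF j]] gb[OF ij] by simp
      also have "\<dots> = (t \<cdot> m j) \<cdot> \<beta> i j"
        using Cmp_assoc[OF bij[OF ij] gi[OF j] w(1)[OF j]] w(2)[OF j] by simp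
      also have "\<dots> = w i \<cdot> g i"
        using Cmp_assoc[OF bij[OF ij] M(2)[OF j] t] M(3)[OF ij] w(2)[OF i] by simp
      finally show "w j \<cdot> \<delta> i j = w i"
        using epi_cancel[OF K(2)[OF i] gi[OF i] Cmp_Hom[OF dij[OF ij] w(1)[OF j]] w(1)[OF i]] by blast
    qed (use w in blast)
    then obtain h where h: "h \<in> Hom C N T" "\<forall>i \<in> I. h \<cdot> n i = w i" using N(4) by blast
    have "h \<cdot> v = t"
    proof (rule M(5)[OF r sB Cmp_Hom[OF v h(1)] t])
      fix i assume i: "i \<in> I"
      show "(h \<cdot> v) \<cdot> m i = t \<cdot> m i"
        using Cmp_assoc[OF M(2)[OF i] v h(1)] Cmp_assoc[OF gi[OF i] N(2)[OF i] h(1)] vm[OF i] h(2) i w(2)[OF i]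
        by metis
    qed
    then show "\<exists>h \<in> Hom C N T. h \<cdot> v = t" using h by blast
  qed
qed

end

context adjunction
begin

lemma left_adjoint_preserves_exact_limit_sequence:
  assumes ex: "exact_functor C D L"
    and S: "exact_limit_sequence C I r A \<alpha> B \<beta> E \<delta> f g P l M m N n u v"
  shows "exact_limit_sequence D I r (\<lambda>i. Fobj L (A i)) (\<lambda>i j. Farr L (\<alpha> i j))
    (\<lambda>i. Fobj L (B i)) (\<lambda>i j. Farr L (\<beta> i j)) (\<lambda>i. Fobj L (E i)) (\<lambda>i j. Farr L (\<delta> i j))
    (\<lambda>i. Farr L (f i)) (\<lambda>i. Farr L (g i)) (Fobj L P) (\<lambda>i. Farr L (l i)) (Fobj L M) (\<lambda>i. Farr L (m i))
    (Fobj L N) (\<lambda>i. Farr L (n i)) (Farr L u) (Farr L v)"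
proof -
  from S have dir: "directed_set I r" and r: "r \<subseteq> I \<times> I"
    and sA: "direct_system C I r A \<alpha>" and sB: "direct_system C I r B \<beta>" and sE: "direct_system C I r E \<delta>"
    and mf: "direct_system_map C I r A \<alpha> B \<beta> f" and mg: "direct_system_map C I r B \<beta> E \<delta> g"
    and se: "\<And>i. i \<in> I \<Longrightarrow> short_exact C (f i) (g i)"
    and lL: "is_direct_limit C I r A \<alpha> P l" and lM: "is_direct_limit C I r B \<beta> M m"
    and lN: "is_direct_limit C I r E \<delta> N n"
    and u: "u \<in> Hom C P M" and ul: "\<And>i. i \<in> I \<Longrightarrow> u \<cdot>\<^bsub>C\<^esub> l i = m i \<cdot>\<^bsub>C\<^esub> f i"
    and v: "v \<in> Hom C M N" and vm: "\<And>i. i \<in> I \<Longrightarrow> v \<cdot>\<^bsub>C\<^esub> m i = n i \<cdot>\<^bsub>C\<^esub> g i"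
    unfolding exact_limit_sequence_def directed_set_def preorder_on_def by blast+
  have H: "l i \<in> Hom C (A i) P" "m i \<in> Hom C (B i) M" "n i \<in> Hom C (E i) N"
    "f i \<in> Hom C (A i) (B i)" "g i \<in> Hom C (B i) (E i)" if "i \<in> I" for i
    using that L.dom.direct_limitD(2)[OF lL] L.dom.direct_limitD(2)[OF lM] L.dom.direct_limitD(2)[OF lN] mf mg
    unfolding direct_system_map_def by blast+
  have "Farr L u \<cdot>\<^bsub>D\<^esub> Farr L (l i) = Farr L (m i) \<cdot>\<^bsub>D\<^esub> Farr L (f i)"
    "Farr L v \<cdot>\<^bsub>D\<^esub> Farr L (m i) = Farr L (n i) \<cdot>\<^bsub>D\<^esub> Farr L (g i)" if i: "i \<in> I" for i
    using L.Farr_Cmp[OF H(1)[OF i] u] L.Farr_Cmp[OF H(4)[OF i] H(2)[OF i]]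
      L.Farr_Cmp[OF H(2)[OF i] v] L.Farr_Cmp[OF H(5)[OF i] H(3)[OF i]] ul[OF i] vm[OF i] by metis+
  moreover have "short_exact D (Farr L (f i)) (Farr L (g i))" if "i \<in> I" for i
    using ex se[OF that] unfolding exact_functor_def by blast
  ultimately show ?thesis
    unfolding exact_limit_sequence_def
    using dir L.Farr_direct_system[OF sA r] L.Farr_direct_system[OF sB r] L.Farr_direct_system[OF sE r]
      L.Farr_direct_system_map[OF mf sA sB r] L.Farr_direct_system_map[OF mg sB sE r]
      left_adjoint_preserves_direct_limit[OF lL sA r] left_adjoint_preserves_direct_limit[OF lM sB r]
      left_adjoint_preserves_direct_limit[OF lN sE r] L.Farr_Hom[OF u] L.Farr_Hom[OF v]
    by blast
qed

text \<open>The image of an exact sequence of limits under an exact left adjoint is again one, and a fully faithful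
  functor reflects kernels and cokernels.\<close>

lemma direct_limits_exact_reflected:
  fixes \<kappa> :: "'u rel"
  assumes ex: "exact_functor C D L" and ff: "fully_faithful C D L" and lim: "direct_limits_exact \<kappa> D"
  shows "direct_limits_exact \<kappa> C"
  unfolding direct_limits_exact_iff
proof (intro allI impI)
  fix I :: "'u set" and r A \<alpha> B \<beta> E \<delta> f g P l M m N n u v
  assume I: "is_set \<kappa> I" and S: "exact_limit_sequence C I r A \<alpha> B \<beta> E \<delta> f g P l M m N n u v"
  then have u: "u \<in> Hom C P M" and v: "v \<in> Hom C M N" unfolding exact_limit_sequence_def by blast+
  have "short_exact D (Farr L u) (Farr L v)"
    using lim[unfolded direct_limits_exact_iff, rule_format, OF I
        left_adjoint_preserves_exact_limit_sequence[OF ex S]] .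
  then show "short_exact C u v"
    unfolding short_exact_def
    using L.fully_faithful_reflects_kernel[OF ff u v] L.fully_faithful_reflects_cokernel[OF ff u v] by blast
qed

text \<open>Coproducts in a reflective subcategory are reflections of coproducts in the ambient category.\<close>

lemma AB3_reflective:
  fixes \<kappa> :: "'u rel"
  assumes ff: "fully_faithful D C R" and ab3: "AB3 \<kappa> C"
  shows "AB3 \<kappa> D"
  unfolding AB3_def
proof (intro allI impI, elim conjE)
  fix I :: "'u set" and A assume I: "is_set \<kappa> I" and A: "\<forall>i \<in> I. A i \<in> Obj D"
  obtain S \<iota> where cop: "is_coproduct C I (\<lambda>i. Fobj R (A i)) S \<iota>"
    using AB3D[OF ab3 I, of "\<lambda>i. Fobj R (A i)"] A by auto
  note S = L.dom.coproductD[OF cop]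
  have "\<forall>i \<in> I. \<exists>k \<in> Hom D (A i) (Fobj L S). Farr R k = \<eta> S \<cdot>\<^bsub>C\<^esub> \<iota> i"
  proof
    fix i assume i: "i \<in> I"
    have "\<eta> S \<cdot>\<^bsub>C\<^esub> \<iota> i \<in> Hom C (Fobj R (A i)) (Fobj R (Fobj L S))"
      using L.dom.Cmp_Hom[OF S(2)[OF i] unit_Hom[OF S(1)]] .
    then show "\<exists>k \<in> Hom D (A i) (Fobj L S). Farr R k = \<eta> S \<cdot>\<^bsub>C\<^esub> \<iota> i"
      using R.fully_faithful_full[OF ff] A i S(1) L.Fobj_Obj by metis
  qed
  then obtain \<iota>' where k: "\<And>i. i \<in> I \<Longrightarrow> \<iota>' i \<in> Hom D (A i) (Fobj L S)"
    "\<And>i. i \<in> I \<Longrightarrow> Farr R (\<iota>' i) = \<eta> S \<cdot>\<^bsub>C\<^esub> \<iota> i" by metis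
  have key: "h \<cdot>\<^bsub>D\<^esub> \<iota>' i = f \<longleftrightarrow> (Farr R h \<cdot>\<^bsub>C\<^esub> \<eta> S) \<cdot>\<^bsub>C\<^esub> \<iota> i = Farr R f"
    if i: "i \<in> I" and h: "h \<in> Hom D (Fobj L S) T" and f: "f \<in> Hom D (A i) T" for i h f T
  proof -
    have "Farr R (h \<cdot>\<^bsub>D\<^esub> \<iota>' i) = (Farr R h \<cdot>\<^bsub>C\<^esub> \<eta> S) \<cdot>\<^bsub>C\<^esub> \<iota> i"
      using R.Farr_Cmp[OF k(1)[OF i] h] k(2)[OF i] L.dom.Cmp_assoc[OF S(2)[OF i] unit_Hom[OF S(1)] R.Farr_Hom[OF h]]
      by simp
    then show ?thesis using R.fully_faithful_faithful[OF ff L.cod.Cmp_Hom[OF k(1)[OF i] h] f] by metis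
  qed
  have "is_coproduct D I A (Fobj L S) \<iota>'"
    unfolding is_coproduct_def
  proof (intro conjI ballI allI impI)
    show "Fobj L S \<in> Obj D" using S(1) by simp
    show "\<iota>' i \<in> Hom D (A i) (Fobj L S)" if "i \<in> I" for i using k(1)[OF that] .
    fix T f assume T: "T \<in> Obj D" and f: "\<forall>i \<in> I. f i \<in> Hom D (A i) T"
    have "\<And>i. i \<in> I \<Longrightarrow> Farr R (f i) \<in> Hom C (Fobj R (A i)) (Fobj R T)" using f R.Farr_Hom by blast
    then obtain w where w: "w \<in> Hom C S (Fobj R T)" "\<forall>i \<in> I. w \<cdot>\<^bsub>C\<^esub> \<iota> i = Farr R (f i)"
      using S(3)[of "Fobj R T" "\<lambda>i. Farr R (f i)"] T by auto
    obtain h where h: "h \<in> Hom D (Fobj L S) T" "Farr R h \<cdot>\<^bsub>C\<^esub> \<eta> S = w" using transpose_exists[OF w(1) T] .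
    show "\<exists>!u. u \<in> Hom D (Fobj L S) T \<and> (\<forall>i \<in> I. u \<cdot>\<^bsub>D\<^esub> \<iota>' i = f i)"
    proof (rule ex1I[of _ h])
      show "h \<in> Hom D (Fobj L S) T \<and> (\<forall>i \<in> I. h \<cdot>\<^bsub>D\<^esub> \<iota>' i = f i)"
        using key[OF _ h(1)] f w(2) h by blast
      fix h' assume h': "h' \<in> Hom D (Fobj L S) T \<and> (\<forall>i \<in> I. h' \<cdot>\<^bsub>D\<^esub> \<iota>' i = f i)"
      have "Farr R h' \<cdot>\<^bsub>C\<^esub> \<eta> S = w"
      proof (rule S(4)[OF transpose_Hom[OF S(1) conjunct1[OF h']] w(1)])
        fix i assume i: "i \<in> I"
        then have "(Farr R h' \<cdot>\<^bsub>C\<^esub> \<eta> S) \<cdot>\<^bsub>C\<^esub> \<iota> i = Farr R (f i)"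
          using key[OF i conjunct1[OF h'], of "f i"] h' f by blast
        then show "(Farr R h' \<cdot>\<^bsub>C\<^esub> \<eta> S) \<cdot>\<^bsub>C\<^esub> \<iota> i = w \<cdot>\<^bsub>C\<^esub> \<iota> i" using w(2) i by metis
      qed
      then show "h' = h" using transpose_inject[OF S(1) conjunct1[OF h'] h(1)] h(2) by simp
    qed
  qed
  then show "\<exists>S \<iota>. is_coproduct D I A S \<iota>" by blast
qed

lemma generator_reflective:
  assumes ff: "fully_faithful D C R" and G: "is_generator C G"
  shows "is_generator D (Fobj L G)"
  unfolding is_generator_def
proof (intro conjI allI ballI impI)
  have GO: "G \<in> Obj C" using G unfolding is_generator_def by blast
  then show "Fobj L G \<in> Obj D" by simp
  fix a b \<phi> assume f: "\<phi> \<in> Hom D a b" "\<phi> \<noteq> Zer D a b"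
  have o: "a \<in> Obj D" "b \<in> Obj D" using f(1) by (auto simp: L.cod.Hom_iff)
  have "Farr R \<phi> \<noteq> Zer C (Fobj R a) (Fobj R b)"
    using R.fully_faithful_faithful[OF ff f(1) L.cod.Zer_Hom[OF o]] f(2) o by auto
  then obtain x where x: "x \<in> Hom C G (Fobj R a)" "Farr R \<phi> \<cdot>\<^bsub>C\<^esub> x \<noteq> Zer C G (Fobj R b)"
    using G R.Farr_Hom[OF f(1)] unfolding is_generator_def by blast
  obtain h where h: "h \<in> Hom D (Fobj L G) a" "Farr R h \<cdot>\<^bsub>C\<^esub> \<eta> G = x" using transpose_exists[OF x(1) o(1)] .
  have "\<phi> \<cdot>\<^bsub>D\<^esub> h \<noteq> Zer D (Fobj L G) b"
    using transpose_Cmp_left[OF GO h(1) f(1)] h(2) x(2) transpose_Zer[OF GO o(2)] by metis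
  then show "\<exists>h \<in> Hom D (Fobj L G) a. \<phi> \<cdot>\<^bsub>D\<^esub> h \<noteq> Zer D (Fobj L G) b" using h(1) by blast
qed

end

section \<open>Lifting along directed families in AB5 categories\<close>

context preadditive_category
begin

text \<open>Quotients of a fixed object, ordered by factorisation, form a direct system: transition maps are unique
  because the quotient maps are epimorphisms.\<close>

lemma quotient_system:
  assumes r: "r \<subseteq> I \<times> I" "refl_on I r" "trans r"
    and q: "\<And>i. i \<in> I \<Longrightarrow> q i \<in> Hom C V (Q i)" "\<And>i. i \<in> I \<Longrightarrow> is_epi C (q i)"
    and fac: "\<And>i j. (i, j) \<in> r \<Longrightarrow> \<exists>w \<in> Hom C (Q i) (Q j). w \<cdot> q i = q j"
  shows "\<exists>\<gamma>. direct_system C I r Q \<gamma> \<and> (\<forall>i j. (i, j) \<in> r \<longrightarrow> \<gamma> i j \<cdot> q i = q j)"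
proof -
  have "\<forall>i j. \<exists>w. (i, j) \<in> r \<longrightarrow> w \<in> Hom C (Q i) (Q j) \<and> w \<cdot> q i = q j" using fac by blast
  then obtain \<gamma> where g: "\<And>i j. (i, j) \<in> r \<Longrightarrow> \<gamma> i j \<in> Hom C (Q i) (Q j)"
    and gq: "\<And>i j. (i, j) \<in> r \<Longrightarrow> \<gamma> i j \<cdot> q i = q j" by metis
  have "direct_system C I r Q \<gamma>"
    unfolding direct_system_def
  proof (intro conjI ballI allI impI)
    show "Q i \<in> Obj C" if "i \<in> I" for i using q(1)[OF that] Hom_ObjD by blast
    show "\<gamma> i j \<in> Hom C (Q i) (Q j)" if "(i, j) \<in> r" for i j using g[OF that] .
    fix i assume i: "i \<in> I"
    then have ii: "(i, i) \<in> r" using r(2) by (auto dest: refl_onD)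
    have Qi: "Q i \<in> Obj C" using q(1)[OF i] Hom_ObjD by blast
    show "\<gamma> i i = Ide C (Q i)"
      using epi_cancel[OF q(2)[OF i] q(1)[OF i] g[OF ii] Ide_Hom[OF Qi]] gq[OF ii] Cmp_Ide_left[OF q(1)[OF i]] by simp
  next
    fix i j k assume a: "(i, j) \<in> r \<and> (j, k) \<in> r"
    then have ij: "(i, j) \<in> r" and jk: "(j, k) \<in> r" and ik: "(i, k) \<in> r" and i: "i \<in> I"
      using r(1) transD[OF r(3)] by blast+
    show "\<gamma> j k \<cdot> \<gamma> i j = \<gamma> i k"
      using epi_cancel[OF q(2)[OF i] q(1)[OF i] Cmp_Hom[OF g[OF ij] g[OF jk]] g[OF ik]]
        Cmp_assoc[OF q(1)[OF i] g[OF ij] g[OF jk]] gq[OF ij] gq[OF jk] gq[OF ik] by simp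
  qed
  then show ?thesis using gq by blast
qed

text \<open>A cocone on such a system is one arrow out of \<open>V\<close> that factors through all the quotients. Its limit is
  therefore the quotient of \<open>V\<close> that is universal for this property.\<close>

lemma quotient_system_limit:
  assumes dir: "directed_set I r" and sys: "direct_system C I r Q \<gamma>"
    and gq: "\<And>i j. (i, j) \<in> r \<Longrightarrow> \<gamma> i j \<cdot> q i = q j"
    and q: "\<And>i. i \<in> I \<Longrightarrow> q i \<in> Hom C V (Q i)" "\<And>i. i \<in> I \<Longrightarrow> is_epi C (q i)"
    and p: "p \<in> Hom C V L" "is_epi C p"
    and l: "\<And>i. i \<in> I \<Longrightarrow> l i \<in> Hom C (Q i) L" "\<And>i. i \<in> I \<Longrightarrow> l i \<cdot> q i = p"
    and univ: "\<And>T t. t \<in> Hom C V T \<Longrightarrow> \<forall>i \<in> I. \<exists>w \<in> Hom C (Q i) T. w \<cdot> q i = t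
      \<Longrightarrow> \<exists>w \<in> Hom C L T. w \<cdot> p = t"
  shows "is_direct_limit C I r Q \<gamma> L l"
proof -
  have r: "r \<subseteq> I \<times> I" and ne: "I \<noteq> {}"
    and ub: "\<And>i j. i \<in> I \<Longrightarrow> j \<in> I \<Longrightarrow> \<exists>k \<in> I. (i, k) \<in> r \<and> (j, k) \<in> r"
    using dir unfolding directed_set_def preorder_on_def by blast+
  have g: "\<And>i j. (i, j) \<in> r \<Longrightarrow> \<gamma> i j \<in> Hom C (Q i) (Q j)" using sys unfolding direct_system_def by blast
  show ?thesis
    unfolding is_direct_limit_def
  proof (intro conjI allI impI)
    show "is_cocone C I r Q \<gamma> L l"
      unfolding is_cocone_def
    proof (intro conjI ballI allI impI)
      show "L \<in> Obj C" using Hom_ObjD(2)[OF p(1)] .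
      fix i j assume ij: "(i, j) \<in> r"
      then have i: "i \<in> I" and j: "j \<in> I" using r by blast+
      show "l j \<cdot> \<gamma> i j = l i"
        using epi_cancel[OF q(2)[OF i] q(1)[OF i] Cmp_Hom[OF g[OF ij] l(1)[OF j]] l(1)[OF i]]
          Cmp_assoc[OF q(1)[OF i] g[OF ij] l(1)[OF j]] gq[OF ij] l(2)[OF i] l(2)[OF j] by simp
    qed (use l(1) in blast)
    fix T t assume "is_cocone C I r Q \<gamma> T t"
    then have t: "\<And>i. i \<in> I \<Longrightarrow> t i \<in> Hom C (Q i) T" and tg: "\<And>i j. (i, j) \<in> r \<Longrightarrow> t j \<cdot> \<gamma> i j = t i"
      unfolding is_cocone_def by blast+
    have tq: "t i \<cdot> q i = t k \<cdot> q k" if ik: "(i, k) \<in> r" for i k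
    proof -
      have i: "i \<in> I" and k: "k \<in> I" using r ik by blast+
      show ?thesis using Cmp_assoc[OF q(1)[OF i] g[OF ik] t[OF k]] tg[OF ik] gq[OF ik] by simp
    qed
    obtain i0 where i0: "i0 \<in> I" using ne by blast
    define t0 where "t0 = t i0 \<cdot> q i0"
    have t0: "t0 \<in> Hom C V T" unfolding t0_def using Cmp_Hom[OF q(1)[OF i0] t[OF i0]] .
    have tt: "t i \<cdot> q i = t0" if i: "i \<in> I" for i
    proof -
      obtain k where "(i, k) \<in> r" "(i0, k) \<in> r" using ub[OF i i0] by blast
      then show ?thesis using tq unfolding t0_def by metis
    qed
    have "\<forall>i \<in> I. \<exists>w \<in> Hom C (Q i) T. w \<cdot> q i = t0" using t tt by blast
    then obtain w where w: "w \<in> Hom C L T" "w \<cdot> p = t0" using univ[OF t0] by blast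
    show "\<exists>!u. u \<in> Hom C L T \<and> (\<forall>i \<in> I. u \<cdot> l i = t i)"
    proof (rule ex1I[of _ w], intro conjI ballI)
      fix i assume i: "i \<in> I"
      show "w \<cdot> l i = t i"
        using epi_cancel[OF q(2)[OF i] q(1)[OF i] Cmp_Hom[OF l(1)[OF i] w(1)] t[OF i]]
          Cmp_assoc[OF q(1)[OF i] l(1)[OF i] w(1)] l(2)[OF i] w(2) tt[OF i] by simp
    next
      fix w' assume w': "w' \<in> Hom C L T \<and> (\<forall>i \<in> I. w' \<cdot> l i = t i)"
      have "w' \<cdot> p = t0"
        using Cmp_assoc[OF q(1)[OF i0] l(1)[OF i0] conjunct1[OF w']] l(2)[OF i0] tt[OF i0] w' i0 by metis
      then show "w' = w" using epi_cancel[OF p(2,1) conjunct1[OF w'] w(1)] w(2) by simp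
    qed (use w in blast)
  qed
qed

lemma coproduct_map_exists:
  assumes "is_coproduct C I A S \<iota>" "T \<in> Obj C" "\<And>i. i \<in> I \<Longrightarrow> f i \<in> Hom C (A i) T"
  obtains u where "u \<in> Hom C S T" "\<And>i. i \<in> I \<Longrightarrow> u \<cdot> \<iota> i = f i"
  using coproductD(3)[OF assms(1,2), of f] assms(3) by blast

end

context abelian_category
begin

text \<open>An arrow with values in the image of \<open>p\<close> lifts along \<open>p\<close> on an epimorphic cover of its domain,
  obtained by pulling back the epimorphic part of \<open>p\<close>.\<close>

lemma lift_after_epi:
  assumes p: "p \<in> Hom C b z" and c: "is_cokernel C c p" "c \<in> Hom C z d"
    and v: "v \<in> Hom C g z" "c \<cdot> v = Zer C g d"
  obtains u \<pi> \<rho> where "\<pi> \<in> Hom C u g" "\<rho> \<in> Hom C u b" "is_epi C \<pi>" "p \<cdot> \<rho> = v \<cdot> \<pi>"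
proof -
  obtain i e m where e: "e \<in> Hom C b i" "is_epi C e" and m: "m \<in> Hom C i z" "m \<cdot> e = p"
    and k: "\<And>q d. is_cokernel C q p \<Longrightarrow> q \<in> Hom C z d \<Longrightarrow> is_kernel C m q"
    using obtain_image_factorisation[OF p] by metis
  obtain v' where v': "v' \<in> Hom C g i" "m \<cdot> v' = v" using kernelD(3)[OF k[OF c] c(2) m(1) v] by blast
  obtain \<rho> \<pi> where pb: "is_pullback C e v' \<rho> \<pi>" using pullback_exists[OF e(1) v'(1)] by blast
  obtain u where u: "\<rho> \<in> Hom C u b" "\<pi> \<in> Hom C u g" "e \<cdot> \<rho> = v' \<cdot> \<pi>"
    using pullbackD[OF pb e(1) v'(1)] by metis
  have "p \<cdot> \<rho> = m \<cdot> (e \<cdot> \<rho>)" using m e(1) u(1) by (auto simp: Hom_iff)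
  also have "\<dots> = v \<cdot> \<pi>" unfolding u(3) using m(1) v' u(2) by (auto simp: Hom_iff)
  finally show thesis using that u pullback_of_epi[OF e(1) v'(1) e(2) pb] by blast
qed

text \<open>A given arrow from \<open>G\<close> to \<open>V\<close> need not lift to any \<open>B i\<close>, but enough of them do to detect \<open>\<psi>\<close>. For
  \<open>V\<close> is the union of the preimages under \<open>a\<close> of the images of the \<open>p i\<close>: the quotients of \<open>V\<close> by these
  preimages embed into the cokernels of the \<open>p i\<close>, whose direct limit is zero, so by exactness the
  quotient of \<open>V\<close> by the union is zero.\<close>

lemma generator_lifts_along_directed_family:
  fixes \<kappa> :: "'u rel" and I :: "'u set"
  assumes ab3: "AB3 \<kappa> C" and exact: "direct_limits_exact \<kappa> C" and I: "is_set \<kappa> I" "I \<noteq> {}"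
    and p: "\<And>i. i \<in> I \<Longrightarrow> p i \<in> Hom C (B i) Z"
    and directed: "\<And>i j. i \<in> I \<Longrightarrow> j \<in> I \<Longrightarrow>
      \<exists>k \<in> I. (\<exists>w \<in> Hom C (B i) (B k). p k \<cdot> w = p i) \<and> (\<exists>w \<in> Hom C (B j) (B k). p k \<cdot> w = p j)"
    and jointly_epi: "\<And>T t. t \<in> Hom C Z T \<Longrightarrow> \<forall>i \<in> I. t \<cdot> p i = Zer C (B i) T \<Longrightarrow> t = Zer C Z T"
    and G: "is_generator C G" and a: "a \<in> Hom C V Z" and \<psi>: "\<psi> \<in> Hom C V V'" "\<psi> \<noteq> Zer C V V'"
  shows "\<exists>i \<in> I. \<exists>g \<in> Hom C G V. \<exists>\<beta> \<in> Hom C G (B i). p i \<cdot> \<beta> = a \<cdot> g \<and> \<psi> \<cdot> g \<noteq> Zer C G V'"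
proof -
  define r where "r = {(i, j). i \<in> I \<and> j \<in> I \<and> (\<exists>w \<in> Hom C (B i) (B j). p j \<cdot> w = p i)}"
  have rI: "r \<subseteq> I \<times> I" unfolding r_def by blast
  have refl: "refl_on I r"
  proof (rule refl_onI)
    fix i assume i: "i \<in> I"
    have "B i \<in> Obj C" using Hom_ObjD(1)[OF p[OF i]] .
    then show "(i, i) \<in> r" unfolding r_def using i Ide_Hom Cmp_Ide_right[OF p[OF i]] by blast
  qed
  have trans: "trans r"
  proof (rule transI)
    fix i j k assume "(i, j) \<in> r" "(j, k) \<in> r"
    then obtain w w' where ijk: "i \<in> I" "k \<in> I" and w: "w \<in> Hom C (B i) (B j)" "p j \<cdot> w = p i"
      and w': "w' \<in> Hom C (B j) (B k)" "p k \<cdot> w' = p j" unfolding r_def by blast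
    have "p k \<cdot> (w' \<cdot> w) = p i" using Cmp_assoc[OF w(1) w'(1) p[OF ijk(2)]] w(2) w'(2) by simp
    then show "(i, k) \<in> r" unfolding r_def using ijk Cmp_Hom[OF w(1) w'(1)] by blast
  qed
  have dir: "directed_set I r"
    unfolding directed_set_def preorder_on_def
  proof (intro conjI ballI)
    fix i j assume i: "i \<in> I" and j: "j \<in> I"
    then show "\<exists>k \<in> I. (i, k) \<in> r \<and> (j, k) \<in> r" using directed[OF i j] unfolding r_def by blast
  qed (use I(2) rI refl trans in auto)
  have ZO: "Z \<in> Obj C" and VO: "V \<in> Obj C" using Hom_ObjD[OF a] by auto
  obtain N where N: "is_zero_object C N" using zero_object by blast
  then have OO: "N \<in> Obj C" by (simp add: zero_object_iff)
  \<comment> \<open>The quotient \<open>Z \<rightarrow> Co i\<close> is the cokernel of \<open>p i\<close>; it cuts \<open>V\<close> down to its coimage \<open>V \<rightarrow> Q i\<close>, and the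
    quotients \<open>Q i \<hookrightarrow> Co i \<rightarrow> D i\<close> form a short exact sequence of direct systems.\<close>
  have "\<forall>i. \<exists>d c. i \<in> I \<longrightarrow> c \<in> Hom C Z d \<and> is_cokernel C c (p i)" using obtain_cokernel[OF p] by metis
  then obtain Co c where c: "\<And>i. i \<in> I \<Longrightarrow> c i \<in> Hom C Z (Co i)" "\<And>i. i \<in> I \<Longrightarrow> is_cokernel C (c i) (p i)"
    by metis
  have cp: "c i \<cdot> p i = Zer C (B i) (Co i)" and cepi: "is_epi C (c i)" if "i \<in> I" for i
    using cokernelD(1,2)[OF c(2) p c(1)] that by blast+
  have cfac: "\<exists>u \<in> Hom C (Co i) T. u \<cdot> c i = x" if "i \<in> I" "x \<in> Hom C Z T" "x \<cdot> p i = Zer C (B i) T" for i x T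
    using cokernelD(3)[OF c(2) p c(1)] that by blast
  have ca: "c i \<cdot> a \<in> Hom C V (Co i)" if "i \<in> I" for i using Cmp_Hom[OF a c(1)[OF that]] .
  have "\<forall>i. \<exists>q e m. i \<in> I \<longrightarrow> e \<in> Hom C V q \<and> m \<in> Hom C q (Co i) \<and> is_epi C e \<and> is_mono C m \<and> m \<cdot> e = c i \<cdot> a"
    using obtain_image_factorisation[OF ca] by metis
  then obtain Q e m where e: "\<And>i. i \<in> I \<Longrightarrow> e i \<in> Hom C V (Q i)" "\<And>i. i \<in> I \<Longrightarrow> is_epi C (e i)"
    and m: "\<And>i. i \<in> I \<Longrightarrow> m i \<in> Hom C (Q i) (Co i)" "\<And>i. i \<in> I \<Longrightarrow> is_mono C (m i)"
    and me: "\<And>i. i \<in> I \<Longrightarrow> m i \<cdot> e i = c i \<cdot> a" by metis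
  have "\<forall>i. \<exists>q d. i \<in> I \<longrightarrow> d \<in> Hom C (Co i) q \<and> is_cokernel C d (m i)" using obtain_cokernel[OF m(1)] by metis
  then obtain D d where d: "\<And>i. i \<in> I \<Longrightarrow> d i \<in> Hom C (Co i) (D i)" "\<And>i. i \<in> I \<Longrightarrow> is_cokernel C (d i) (m i)"
    by metis
  have dm: "d i \<cdot> m i = Zer C (Q i) (D i)" and depi: "is_epi C (d i)" if "i \<in> I" for i
    using cokernelD(1,2)[OF d(2) m(1) d(1)] that by blast+
  have dfac: "\<exists>u \<in> Hom C (D i) T. u \<cdot> d i = x" if "i \<in> I" "x \<in> Hom C (Co i) T" "x \<cdot> m i = Zer C (Q i) T" for i x T
    using cokernelD(3)[OF d(2) m(1) d(1)] that by blast
  have "\<forall>i. \<exists>w k. i \<in> I \<longrightarrow> k \<in> Hom C w V \<and> is_kernel C k (e i)" using obtain_kernel[OF e(1)] by metis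
  then obtain W k where k: "\<And>i. i \<in> I \<Longrightarrow> k i \<in> Hom C (W i) V" "\<And>i. i \<in> I \<Longrightarrow> is_kernel C (k i) (e i)"
    by metis
  have ek: "e i \<cdot> k i = Zer C (W i) (Q i)" and ecok: "is_cokernel C (e i) (k i)" if "i \<in> I" for i
    using kernelD(1)[OF k(2) e(1) k(1)] epi_is_cokernel_of_kernel[OF e(2) e(1) k(2) k(1)] that by blast+

  have cfactor: "\<exists>w \<in> Hom C (Co i) (Co j). w \<cdot> c i = c j" if "(i, j) \<in> r" for i j
  proof -
    from that obtain w where i: "i \<in> I" and j: "j \<in> I" and w: "w \<in> Hom C (B i) (B j)" "p j \<cdot> w = p i"
      unfolding r_def by blast
    have "c j \<cdot> p i = (c j \<cdot> p j) \<cdot> w" using Cmp_assoc[OF w(1) p[OF j] c(1)[OF j]] w(2) by simp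
    also have "\<dots> = Zer C (B i) (Co j)" unfolding cp[OF j] using w(1) c(1)[OF j] by (simp add: Hom_iff)
    finally show ?thesis using cfac[OF i c(1)[OF j]] by blast
  qed
  have "\<exists>\<gamma>. direct_system C I r Co \<gamma> \<and> (\<forall>i j. (i, j) \<in> r \<longrightarrow> \<gamma> i j \<cdot> c i = c j)"
    by (rule quotient_system[OF rI refl trans c(1) cepi cfactor])
  then obtain \<gamma> where sysC: "direct_system C I r Co \<gamma>" and gc: "\<And>i j. (i, j) \<in> r \<Longrightarrow> \<gamma> i j \<cdot> c i = c j"
    by blast
  have g: "\<gamma> i j \<in> Hom C (Co i) (Co j)" if "(i, j) \<in> r" for i j using sysC that unfolding direct_system_def by blast
  have gme: "\<gamma> i j \<cdot> (m i \<cdot> e i) = m j \<cdot> e j" if ij: "(i, j) \<in> r" for i j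
  proof -
    have i: "i \<in> I" and j: "j \<in> I" using rI ij by blast+
    show ?thesis using me[OF i] me[OF j] Cmp_assoc[OF a c(1)[OF i] g[OF ij]] gc[OF ij] by simp
  qed
  have efactor: "\<exists>w \<in> Hom C (Q i) (Q j). w \<cdot> e i = e j" if ij: "(i, j) \<in> r" for i j
  proof -
    have i: "i \<in> I" and j: "j \<in> I" using rI ij by blast+
    have "m j \<cdot> (e j \<cdot> k i) = (\<gamma> i j \<cdot> (m i \<cdot> e i)) \<cdot> k i"
      unfolding gme[OF ij] using m(1)[OF j] e(1)[OF j] k(1)[OF i] by (simp add: Hom_iff)
    also have "\<dots> = \<gamma> i j \<cdot> (m i \<cdot> (e i \<cdot> k i))"
      using g[OF ij] m(1)[OF i] e(1)[OF i] k(1)[OF i] by (simp add: Hom_iff)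
    also have "\<dots> = Zer C (W i) (Co j)"
      unfolding ek[OF i] using g[OF ij] m(1)[OF i] k(1)[OF i] by (simp add: Hom_iff)
    finally have "e j \<cdot> k i = Zer C (W i) (Q j)"
      using mono_zero[OF m(2)[OF j] m(1)[OF j] Cmp_Hom[OF k(1)[OF i] e(1)[OF j]]] by blast
    then show ?thesis using cokernelD(3)[OF ecok[OF i] k(1)[OF i] e(1)[OF i] e(1)[OF j]] by blast
  qed
  have "\<exists>\<theta>. direct_system C I r Q \<theta> \<and> (\<forall>i j. (i, j) \<in> r \<longrightarrow> \<theta> i j \<cdot> e i = e j)"
    by (rule quotient_system[OF rI refl trans e(1) e(2) efactor])
  then obtain \<theta> where sysQ: "direct_system C I r Q \<theta>" and te: "\<And>i j. (i, j) \<in> r \<Longrightarrow> \<theta> i j \<cdot> e i = e j"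
    by blast
  have th: "\<theta> i j \<in> Hom C (Q i) (Q j)" if "(i, j) \<in> r" for i j using sysQ that unfolding direct_system_def by blast
  have mapm: "m j \<cdot> \<theta> i j = \<gamma> i j \<cdot> m i" if ij: "(i, j) \<in> r" for i j
  proof -
    have i: "i \<in> I" and j: "j \<in> I" using rI ij by blast+
    have "(m j \<cdot> \<theta> i j) \<cdot> e i = (\<gamma> i j \<cdot> m i) \<cdot> e i"
      using Cmp_assoc[OF e(1)[OF i] th[OF ij] m(1)[OF j]] Cmp_assoc[OF e(1)[OF i] m(1)[OF i] g[OF ij]]
        te[OF ij] gme[OF ij] by simp
    then show ?thesis
      using epi_cancel[OF e(2)[OF i] e(1)[OF i] Cmp_Hom[OF th[OF ij] m(1)[OF j]] Cmp_Hom[OF m(1)[OF i] g[OF ij]]] by blast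
  qed
  have dc: "d i \<cdot> c i \<in> Hom C Z (D i)" if "i \<in> I" for i using Cmp_Hom[OF c(1)[OF that] d(1)[OF that]] .
  have dcepi: "is_epi C (d i \<cdot> c i)" if i: "i \<in> I" for i
  proof (rule is_epiI_cancel[OF dc[OF i]])
    fix t x y assume x: "x \<in> Hom C (D i) t" and y: "y \<in> Hom C (D i) t" and eq: "x \<cdot> (d i \<cdot> c i) = y \<cdot> (d i \<cdot> c i)"
    have "(x \<cdot> d i) \<cdot> c i = (y \<cdot> d i) \<cdot> c i"
      using eq Cmp_assoc[OF c(1)[OF i] d(1)[OF i] x] Cmp_assoc[OF c(1)[OF i] d(1)[OF i] y] by simp
    then have "x \<cdot> d i = y \<cdot> d i"
      using epi_cancel[OF cepi[OF i] c(1)[OF i] Cmp_Hom[OF d(1)[OF i] x] Cmp_Hom[OF d(1)[OF i] y]] by blast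
    then show "x = y" using epi_cancel[OF depi[OF i] d(1)[OF i] x y] by blast
  qed
  have dfactor0: "\<exists>w \<in> Hom C (D i) (D j). w \<cdot> d i = d j \<cdot> \<gamma> i j" if ij: "(i, j) \<in> r" for i j
  proof -
    have i: "i \<in> I" and j: "j \<in> I" using rI ij by blast+
    have "(d j \<cdot> \<gamma> i j) \<cdot> m i = (d j \<cdot> m j) \<cdot> \<theta> i j"
      using Cmp_assoc[OF m(1)[OF i] g[OF ij] d(1)[OF j]] Cmp_assoc[OF th[OF ij] m(1)[OF j] d(1)[OF j]] mapm[OF ij] by simp
    also have "\<dots> = Zer C (Q i) (D j)" unfolding dm[OF j] using th[OF ij] d(1)[OF j] by (simp add: Hom_iff)
    finally show ?thesis using dfac[OF i Cmp_Hom[OF g[OF ij] d(1)[OF j]]] by blast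
  qed
  have dfactor: "\<exists>w \<in> Hom C (D i) (D j). w \<cdot> (d i \<cdot> c i) = d j \<cdot> c j" if ij: "(i, j) \<in> r" for i j
  proof -
    have i: "i \<in> I" and j: "j \<in> I" using rI ij by blast+
    obtain w where w: "w \<in> Hom C (D i) (D j)" "w \<cdot> d i = d j \<cdot> \<gamma> i j" using dfactor0[OF ij] by blast
    have "w \<cdot> (d i \<cdot> c i) = d j \<cdot> c j"
      using Cmp_assoc[OF c(1)[OF i] d(1)[OF i] w(1)] Cmp_assoc[OF c(1)[OF i] g[OF ij] d(1)[OF j]] w(2) gc[OF ij] by simp
    then show ?thesis using w(1) by blast
  qed
  have "\<exists>\<delta>. direct_system C I r D \<delta> \<and> (\<forall>i j. (i, j) \<in> r \<longrightarrow> \<delta> i j \<cdot> (d i \<cdot> c i) = d j \<cdot> c j)"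
    by (rule quotient_system[OF rI refl trans dc dcepi dfactor])
  then obtain \<delta> where sysD: "direct_system C I r D \<delta>" and ddc: "\<And>i j. (i, j) \<in> r \<Longrightarrow> \<delta> i j \<cdot> (d i \<cdot> c i) = d j \<cdot> c j"
    by blast
  have de: "\<delta> i j \<in> Hom C (D i) (D j)" if "(i, j) \<in> r" for i j using sysD that unfolding direct_system_def by blast
  have mapd: "d j \<cdot> \<gamma> i j = \<delta> i j \<cdot> d i" if ij: "(i, j) \<in> r" for i j
  proof -
    have i: "i \<in> I" and j: "j \<in> I" using rI ij by blast+
    have "(d j \<cdot> \<gamma> i j) \<cdot> c i = (\<delta> i j \<cdot> d i) \<cdot> c i"
      using Cmp_assoc[OF c(1)[OF i] g[OF ij] d(1)[OF j]] Cmp_assoc[OF c(1)[OF i] d(1)[OF i] de[OF ij]]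
        gc[OF ij] ddc[OF ij] by simp
    then show ?thesis
      using epi_cancel[OF cepi[OF i] c(1)[OF i] Cmp_Hom[OF g[OF ij] d(1)[OF j]] Cmp_Hom[OF d(1)[OF i] de[OF ij]]] by blast
  qed

  \<comment> \<open>An arrow out of \<open>Z\<close> that factors through all the quotients \<open>Co i\<close> kills all \<open>p i\<close>, so \<open>Co\<close> and \<open>D\<close>
    have limit zero. The limit of \<open>Q\<close> is the quotient \<open>q\<close> of \<open>V\<close> by all the kernels \<open>k i\<close>.\<close>
  have zero_if_factors: "t = Zer C Z T" if t: "t \<in> Hom C Z T" "\<forall>i \<in> I. \<exists>w \<in> Hom C (Co i) T. w \<cdot> c i = t" for T t
  proof (rule jointly_epi[OF t(1)], intro ballI)
    fix i assume i: "i \<in> I"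
    then obtain w where w: "w \<in> Hom C (Co i) T" "w \<cdot> c i = t" using t(2) by blast
    have "t \<cdot> p i = w \<cdot> (c i \<cdot> p i)" using Cmp_assoc[OF p[OF i] c(1)[OF i] w(1)] w(2) by simp
    then show "t \<cdot> p i = Zer C (B i) T" unfolding cp[OF i] using w(1) p[OF i] by (simp add: Hom_iff)
  qed
  have zH: "Zer C x N \<in> Hom C x N" if "x \<in> Obj C" for x using Zer_Hom[OF that OO] .
  have zepi: "is_epi C (Zer C Z N)"
    by (rule is_epiI_cancel[OF zH[OF ZO]]) (use zero_object_Hom[OF N] in metis)
  have Oext: "\<exists>w \<in> Hom C N T. w \<cdot> Zer C Z N = t" if "t \<in> Hom C Z T" "t = Zer C Z T" for T t
    using that Zer_Hom[OF OO Hom_ObjD(2)[OF that(1)]] ZO OO by (intro bexI[of _ "Zer C N T"]) (auto simp: Hom_iff)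
  have limC: "is_direct_limit C I r Co \<gamma> N (\<lambda>i. Zer C (Co i) N)"
  proof (rule quotient_system_limit[OF dir sysC gc c(1) cepi zH[OF ZO] zepi])
    show "Zer C (Co i) N \<in> Hom C (Co i) N" if "i \<in> I" for i using zH[OF Hom_ObjD(2)[OF c(1)[OF that]]] .
    show "Zer C (Co i) N \<cdot> c i = Zer C Z N" if "i \<in> I" for i using c(1)[OF that] OO by (simp add: Hom_iff)
    show "\<exists>w \<in> Hom C N T. w \<cdot> Zer C Z N = t"
      if "t \<in> Hom C Z T" "\<forall>i \<in> I. \<exists>w \<in> Hom C (Co i) T. w \<cdot> c i = t" for T t
      using Oext[OF that(1) zero_if_factors[OF that]] .
  qed
  have limD: "is_direct_limit C I r D \<delta> N (\<lambda>i. Zer C (D i) N)"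
  proof (rule quotient_system_limit[OF dir sysD ddc dc dcepi zH[OF ZO] zepi])
    show "Zer C (D i) N \<in> Hom C (D i) N" if "i \<in> I" for i using zH[OF Hom_ObjD(2)[OF d(1)[OF that]]] .
    show "Zer C (D i) N \<cdot> (d i \<cdot> c i) = Zer C Z N" if "i \<in> I" for i using c(1)[OF that] d(1)[OF that] OO by (simp add: Hom_iff)
    fix T t assume t: "t \<in> Hom C Z T" and fac: "\<forall>i \<in> I. \<exists>w \<in> Hom C (D i) T. w \<cdot> (d i \<cdot> c i) = t"
    have "\<forall>i \<in> I. \<exists>w \<in> Hom C (Co i) T. w \<cdot> c i = t"
    proof
      fix i assume i: "i \<in> I"
      then obtain w where w: "w \<in> Hom C (D i) T" "w \<cdot> (d i \<cdot> c i) = t" using fac by blast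
      show "\<exists>w \<in> Hom C (Co i) T. w \<cdot> c i = t"
        using Cmp_Hom[OF d(1)[OF i] w(1)] Cmp_assoc[OF c(1)[OF i] d(1)[OF i] w(1)] w(2) by blast
    qed
    then show "\<exists>w \<in> Hom C N T. w \<cdot> Zer C Z N = t" using Oext[OF t zero_if_factors[OF t]] by blast
  qed
  have WO: "W i \<in> Obj C" if "i \<in> I" for i using Hom_ObjD(1)[OF k(1)[OF that]] .
  obtain S \<iota> where cop: "is_coproduct C I W S \<iota>" using AB3D[OF ab3 I(1), of W] WO by blast
  note \<iota> = coproductD(2)[OF cop]
  obtain s where s: "s \<in> Hom C S V" "\<And>i. i \<in> I \<Longrightarrow> s \<cdot> \<iota> i = k i" using coproduct_map_exists[OF cop VO, of k] k(1) by blast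
  obtain L q where q: "q \<in> Hom C V L" "is_cokernel C q s" using obtain_cokernel[OF s(1)] .
  have LO: "L \<in> Obj C" using Hom_ObjD(2)[OF q(1)] .
  have kill: "t \<cdot> s = Zer C S T" if t: "t \<in> Hom C V T" "\<And>i. i \<in> I \<Longrightarrow> t \<cdot> k i = Zer C (W i) T" for t T
  proof (rule coproduct_eq_Zer[OF cop Cmp_Hom[OF s(1) t(1)]])
    fix i assume i: "i \<in> I"
    show "(t \<cdot> s) \<cdot> \<iota> i = Zer C (W i) T" using Cmp_assoc[OF \<iota>[OF i] s(1) t(1)] s(2)[OF i] t(2)[OF i] by simp
  qed
  have "\<forall>i. \<exists>w. i \<in> I \<longrightarrow> w \<in> Hom C (Q i) L \<and> w \<cdot> e i = q"
  proof (intro allI)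
    fix i show "\<exists>w. i \<in> I \<longrightarrow> w \<in> Hom C (Q i) L \<and> w \<cdot> e i = q"
    proof (cases "i \<in> I")
      case True
      then have i: "i \<in> I" .
      have "q \<cdot> k i = (q \<cdot> s) \<cdot> \<iota> i" using Cmp_assoc[OF \<iota>[OF i] s(1) q(1)] s(2)[OF i] by simp
      also have "\<dots> = Zer C (W i) L" unfolding cokernelD(1)[OF q(2) s(1) q(1)] using \<iota>[OF i] LO by (simp add: Hom_iff)
      finally show ?thesis using cokernelD(3)[OF ecok[OF i] k(1)[OF i] e(1)[OF i] q(1)] by blast
    qed blast
  qed
  then obtain l where l: "\<And>i. i \<in> I \<Longrightarrow> l i \<in> Hom C (Q i) L" "\<And>i. i \<in> I \<Longrightarrow> l i \<cdot> e i = q" by metis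
  have limQ: "is_direct_limit C I r Q \<theta> L l"
  proof (rule quotient_system_limit[OF dir sysQ te e(1) e(2) q(1) cokernelD(2)[OF q(2) s(1) q(1)] l])
    fix T t assume t: "t \<in> Hom C V T" and fac: "\<forall>i \<in> I. \<exists>w \<in> Hom C (Q i) T. w \<cdot> e i = t"
    have "t \<cdot> k i = Zer C (W i) T" if i: "i \<in> I" for i
    proof -
      obtain w where w: "w \<in> Hom C (Q i) T" "w \<cdot> e i = t" using fac i by blast
      have "t \<cdot> k i = w \<cdot> (e i \<cdot> k i)" using Cmp_assoc[OF k(1)[OF i] e(1)[OF i] w(1)] w(2) by simp
      then show ?thesis unfolding ek[OF i] using w(1) k(1)[OF i] by (simp add: Hom_iff)
    qed
    then show "\<exists>w \<in> Hom C L T. w \<cdot> q = t" using cokernelD(3)[OF q(2) s(1) q(1) t] kill[OF t] by blast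
  qed
  have "exact_limit_sequence C I r Q \<theta> Co \<gamma> D \<delta> m d L l N (\<lambda>i. Zer C (Co i) N) N (\<lambda>i. Zer C (D i) N)
    (Zer C L N) (Zer C N N)"
    unfolding exact_limit_sequence_def direct_system_map_def
  proof (intro conjI ballI allI impI dir sysQ sysC sysD limQ limC limD m(1) d(1) mapm mapd zH LO OO)
    fix i assume i: "i \<in> I"
    show "short_exact C (m i) (d i)" using short_exactI[OF m(1)[OF i] d(1)[OF i] m(2)[OF i] d(2)[OF i]] .
    show "Zer C L N \<cdot> l i = Zer C (Co i) N \<cdot> m i" using l(1)[OF i] m(1)[OF i] OO by (simp add: Hom_iff)
    show "Zer C N N \<cdot> Zer C (Co i) N = Zer C (D i) N \<cdot> d i" using d(1)[OF i] OO by (simp add: Hom_iff)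
  qed
  then have "short_exact C (Zer C L N) (Zer C N N)"
    by (rule exact[unfolded direct_limits_exact_iff, rule_format, OF I(1)])
  then have "is_mono C (Zer C L N)" using kernelD(2)[OF _ zH[OF OO] zH[OF LO]] unfolding short_exact_def by blast
  then have L0: "is_zero_object C L" using mono_zero_imp_zero_object[OF _ zH[OF LO]] by blast

  have "\<exists>i \<in> I. \<psi> \<cdot> k i \<noteq> Zer C (W i) V'"
  proof (rule ccontr)
    assume "\<not> ?thesis"
    then have "\<psi> \<cdot> s = Zer C S V'" using kill[OF \<psi>(1)] by blast
    then obtain w where w: "w \<in> Hom C L V'" "w \<cdot> q = \<psi>" using cokernelD(3)[OF q(2) s(1) q(1) \<psi>(1)] by blast
    have "w = Zer C L V'" using zero_object_Hom(1)[OF L0 w(1)] .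
    then show False using w q(1) \<psi>(2) by (auto simp: Hom_iff)
  qed
  then obtain i where i: "i \<in> I" and nz: "\<psi> \<cdot> k i \<noteq> Zer C (W i) V'" by blast
  have GO: "G \<in> Obj C" using G unfolding is_generator_def by blast
  obtain h where h: "h \<in> Hom C G (W i)" "(\<psi> \<cdot> k i) \<cdot> h \<noteq> Zer C G V'"
    using G nz Cmp_Hom[OF k(1)[OF i] \<psi>(1)] unfolding is_generator_def by blast
  define x where "x = k i \<cdot> h"
  have x: "x \<in> Hom C G V" unfolding x_def using Cmp_Hom[OF h(1) k(1)[OF i]] .
  have px: "\<psi> \<cdot> x \<noteq> Zer C G V'" unfolding x_def using h(2) Cmp_assoc[OF h(1) k(1)[OF i] \<psi>(1)] by simp
  have ax: "a \<cdot> x \<in> Hom C G Z" using Cmp_Hom[OF x a] .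
  have "c i \<cdot> (a \<cdot> x) = m i \<cdot> ((e i \<cdot> k i) \<cdot> h)"
    using Cmp_assoc[OF x a c(1)[OF i]] me[OF i] Cmp_assoc[OF x e(1)[OF i] m(1)[OF i]]
      Cmp_assoc[OF h(1) k(1)[OF i] e(1)[OF i]] unfolding x_def by simp
  also have "\<dots> = Zer C G (Co i)" unfolding ek[OF i] using h(1) e(1)[OF i] m(1)[OF i] by (simp add: Hom_iff)
  finally have "c i \<cdot> (a \<cdot> x) = Zer C G (Co i)" .
  then obtain u \<pi> \<rho> where \<pi>: "\<pi> \<in> Hom C u G" "is_epi C \<pi>" and \<rho>: "\<rho> \<in> Hom C u (B i)" "p i \<cdot> \<rho> = (a \<cdot> x) \<cdot> \<pi>"
    using lift_after_epi[OF p[OF i] c(2)[OF i] c(1)[OF i] ax] by metis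
  have "(\<psi> \<cdot> x) \<cdot> \<pi> \<noteq> Zer C u V'" using epi_zero[OF \<pi>(2,1) Cmp_Hom[OF x \<psi>(1)]] px by blast
  then obtain f where f: "f \<in> Hom C G u" "((\<psi> \<cdot> x) \<cdot> \<pi>) \<cdot> f \<noteq> Zer C G V'"
    using G Cmp_Hom[OF \<pi>(1) Cmp_Hom[OF x \<psi>(1)]] unfolding is_generator_def by blast
  have 1: "x \<cdot> (\<pi> \<cdot> f) \<in> Hom C G V" "\<rho> \<cdot> f \<in> Hom C G (B i)"
    using Cmp_Hom[OF Cmp_Hom[OF f(1) \<pi>(1)] x] Cmp_Hom[OF f(1) \<rho>(1)] by auto
  have "p i \<cdot> (\<rho> \<cdot> f) = (p i \<cdot> \<rho>) \<cdot> f" using f(1) \<rho>(1) p[OF i] by (simp add: Hom_iff)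
  also have "\<dots> = a \<cdot> (x \<cdot> (\<pi> \<cdot> f))" unfolding \<rho>(2) using f(1) \<pi>(1) x a by (simp add: Hom_iff)
  finally have 2: "p i \<cdot> (\<rho> \<cdot> f) = a \<cdot> (x \<cdot> (\<pi> \<cdot> f))" .
  have "\<psi> \<cdot> (x \<cdot> (\<pi> \<cdot> f)) \<noteq> Zer C G V'" using f \<pi>(1) x \<psi>(1) by (simp add: Hom_iff)
  then show ?thesis using i 1 2 by blast
qed

end

section \<open>Exact functors\<close>

context additive_functor
begin

lemma exact_functor_preserves_mono:
  assumes ex: "exact_functor C D F" and ab: "abelian_category C" and m: "is_mono C m" "m \<in> Hom C a b"
  shows "is_mono D (Farr F m)"
proof -
  interpret C: abelian_category C by fact
  obtain c q where q: "q \<in> Hom C b c" "is_cokernel C q m" using C.obtain_cokernel[OF m(2)] .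
  have "short_exact D (Farr F m) (Farr F q)"
    using ex C.short_exactI[OF m(2) q(1) m(1) q(2)] unfolding exact_functor_def by blast
  then show ?thesis
    using cod.kernelD(2)[OF _ Farr_Hom[OF q(1)] Farr_Hom[OF m(2)]] unfolding short_exact_def by blast
qed

lemma exact_functor_preserves_epi:
  assumes ex: "exact_functor C D F" and ab: "abelian_category C" and e: "is_epi C e" "e \<in> Hom C a b"
  shows "is_epi D (Farr F e)"
proof -
  interpret C: abelian_category C by fact
  obtain c k where k: "k \<in> Hom C c a" "is_kernel C k e" using C.obtain_kernel[OF e(2)] .
  have "short_exact C k e" using k C.epi_is_cokernel_of_kernel[OF e k(2,1)] unfolding short_exact_def by blast
  then have "short_exact D (Farr F k) (Farr F e)" using ex unfolding exact_functor_def by blast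
  then show ?thesis
    using cod.cokernelD(2)[OF _ Farr_Hom[OF k(1)] Farr_Hom[OF e(2)]] unfolding short_exact_def by blast
qed

lemma exact_functor_zero_image:
  assumes ex: "exact_functor C D F" and ab: "abelian_category C"
    and e: "is_epi C e" "e \<in> Hom C a c" and m: "is_mono C m" "m \<in> Hom C c b"
    and z: "Farr F (m \<cdot>\<^bsub>C\<^esub> e) = Zer D (Fobj F a) (Fobj F b)"
  shows "is_zero_object D (Fobj F c)"
proof -
  note Fe = Farr_Hom[OF e(2)]
  have "Farr F e = Zer D (Fobj F a) (Fobj F c)"
    using cod.mono_zero[OF exact_functor_preserves_mono[OF ex ab m] Farr_Hom[OF m(2)] Fe]
      Farr_Cmp[OF e(2) m(2)] z by simp
  then show ?thesis
    using cod.epi_zero_imp_zero_object[OF exact_functor_preserves_epi[OF ex ab e] Fe] by blast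
qed

text \<open>Exactness is stated for short exact sequences only; the kernel of \<open>f\<close> is also the kernel of the
  epimorphic part of \<open>f\<close>, where it applies.\<close>

lemma exact_functor_preserves_kernel:
  assumes ex: "exact_functor C D F" and ab: "abelian_category C"
    and ker: "is_kernel C k f" and f: "f \<in> Hom C a b" and k: "k \<in> Hom C c a"
  shows "is_kernel D (Farr F k) (Farr F f)"
proof -
  interpret C: abelian_category C by fact
  obtain i e m where e: "e \<in> Hom C a i" "is_epi C e" and m: "m \<in> Hom C i b" "is_mono C m" "m \<cdot>\<^bsub>C\<^esub> e = f"
    using C.obtain_image_factorisation[OF f] by metis
  note K = dom.kernelD[OF ker f k]
  have ek: "e \<cdot>\<^bsub>C\<^esub> k = Zer C c i"
    using dom.mono_zero[OF m(2,1) dom.Cmp_Hom[OF k e(1)]] K(1) dom.Cmp_assoc[OF k e(1) m(1)] m(3) by simp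
  have "is_kernel C k e"
  proof (rule dom.kernelI[OF e(1) k ek K(2)])
    fix t g assume g: "g \<in> Hom C t a" and eg: "e \<cdot>\<^bsub>C\<^esub> g = Zer C t i"
    have "f \<cdot>\<^bsub>C\<^esub> g = Zer C t b" using dom.Cmp_assoc[OF g e(1) m(1)] m(1,3) eg g by (simp add: dom.Hom_iff)
    then show "\<exists>u \<in> Hom C t c. k \<cdot>\<^bsub>C\<^esub> u = g" using K(3)[OF g] by blast
  qed
  then have "short_exact C k e" using C.epi_is_cokernel_of_kernel[OF e(2,1) _ k] unfolding short_exact_def by blast
  then have Fk: "is_kernel D (Farr F k) (Farr F e)" using ex unfolding exact_functor_def short_exact_def by blast
  note Fe = Farr_Hom[OF e(1)] and Fkm = Farr_Hom[OF k] and Fm = Farr_Hom[OF m(1)]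
  note FK = cod.kernelD[OF Fk Fe Fkm]
  have Ff: "Farr F f = Farr F m \<cdot>\<^bsub>D\<^esub> Farr F e" using Farr_Cmp[OF e(1) m(1)] m(3) by simp
  note Fmm = exact_functor_preserves_mono[OF ex ab m(2,1)]
  show ?thesis
  proof (rule cod.kernelI[OF Farr_Hom[OF f] Fkm _ FK(2)])
    show "Farr F f \<cdot>\<^bsub>D\<^esub> Farr F k = Zer D (Fobj F c) (Fobj F b)"
      using Farr_Cmp[OF k f] K(1) dom.Hom_ObjD[OF k] dom.Hom_ObjD[OF f] by simp
    fix t g assume g: "g \<in> Hom D t (Fobj F a)" and z: "Farr F f \<cdot>\<^bsub>D\<^esub> g = Zer D t (Fobj F b)"
    have "Farr F m \<cdot>\<^bsub>D\<^esub> (Farr F e \<cdot>\<^bsub>D\<^esub> g) = Zer D t (Fobj F b)"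
      using z Ff cod.Cmp_assoc[OF g Fe Fm] by simp
    then have "Farr F e \<cdot>\<^bsub>D\<^esub> g = Zer D t (Fobj F i)" using cod.mono_zero[OF Fmm Fm cod.Cmp_Hom[OF g Fe]] by blast
    then show "\<exists>u \<in> Hom D t (Fobj F c). Farr F k \<cdot>\<^bsub>D\<^esub> u = g" using FK(3)[OF g] by blast
  qed
qed

text \<open>If \<open>F\<close> is exact and does not see the kernel of the projection \<open>p\<close>, then \<open>F p\<close> is a monomorphism, so
  an isomorphism \<open>F (p \<cdot> c)\<close> forces \<open>F c\<close> to be one. The hypothesis on the kernel is put on its other
  projection, which embeds it.\<close>

lemma exact_functor_comparison:
  assumes ex: "exact_functor C D F" and ab: "abelian_category C" "abelian_category D"
    and p: "p \<in> Hom C r a" and p': "p' \<in> Hom C r b" and c: "c \<in> Hom C x r"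
    and joint: "\<And>t z. z \<in> Hom C t r \<Longrightarrow> p \<cdot>\<^bsub>C\<^esub> z = Zer C t a \<Longrightarrow> p' \<cdot>\<^bsub>C\<^esub> z = Zer C t b \<Longrightarrow> z = Zer C t r"
    and iso: "is_iso D (Farr F (p \<cdot>\<^bsub>C\<^esub> c))"
    and inv: "\<And>t k. k \<in> Hom C t r \<Longrightarrow> is_kernel C k p \<Longrightarrow> Farr F (p' \<cdot>\<^bsub>C\<^esub> k) = Zer D (Fobj F t) (Fobj F b)"
  shows "k \<in> Hom C t x \<Longrightarrow> is_kernel C k c \<Longrightarrow> is_zero_object D (Fobj F t)"
    and "q \<in> Hom C r t \<Longrightarrow> is_cokernel C q c \<Longrightarrow> is_zero_object D (Fobj F t)"
proof -
  interpret C: abelian_category C by fact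
  interpret D: abelian_category D by fact
  have pc: "p \<cdot>\<^bsub>C\<^esub> c \<in> Hom C x a" using dom.Cmp_Hom[OF c p] .
  have o: "x \<in> Obj C" "a \<in> Obj C" "r \<in> Obj C" "b \<in> Obj C" using p p' c by (auto simp: dom.Hom_iff)
  obtain s where s: "s \<in> Hom D (Fobj F a) (Fobj F x)" "Farr F (p \<cdot>\<^bsub>C\<^esub> c) \<cdot>\<^bsub>D\<^esub> s = Ide D (Fobj F a)"
    using cod.iso_inverse[OF iso Farr_Hom[OF pc]] by blast
  {
    assume k: "k \<in> Hom C t x" "is_kernel C k c"
    have tO: "t \<in> Obj C" using k by (simp add: dom.Hom_iff)
    have "(p \<cdot>\<^bsub>C\<^esub> c) \<cdot>\<^bsub>C\<^esub> k = Zer C t a"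
      using dom.Cmp_assoc[OF k(1) c p] dom.kernelD(1)[OF k(2) c k(1)] p tO by (simp add: dom.Hom_iff)
    then have "Farr F (p \<cdot>\<^bsub>C\<^esub> c) \<cdot>\<^bsub>D\<^esub> Farr F k = Zer D (Fobj F t) (Fobj F a)"
      using Farr_Cmp[OF k(1) pc] tO o by simp
    then have "Farr F k = Zer D (Fobj F t) (Fobj F x)"
      using cod.mono_zero[OF cod.iso_imp_mono_epi(1)[OF iso Farr_Hom[OF pc]] Farr_Hom[OF pc] Farr_Hom[OF k(1)]] by blast
    then show "is_zero_object D (Fobj F t)"
      using cod.mono_zero_imp_zero_object[OF exact_functor_preserves_mono[OF ex ab(1) dom.kernelD(2)[OF k(2) c k(1)] k(1)]
          Farr_Hom[OF k(1)]] by blast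
  }
  assume q: "q \<in> Hom C r t" "is_cokernel C q c"
  have tO: "t \<in> Obj C" using q by (simp add: dom.Hom_iff)
  obtain w k where k: "k \<in> Hom C w r" "is_kernel C k p" using C.obtain_kernel[OF p] .
  have wO: "w \<in> Obj C" using k by (simp add: dom.Hom_iff)
  have p'k: "p' \<cdot>\<^bsub>C\<^esub> k \<in> Hom C w b" using dom.Cmp_Hom[OF k(1) p'] .
  have "is_mono C (p' \<cdot>\<^bsub>C\<^esub> k)"
  proof (rule dom.is_monoI[OF p'k])
    fix v z assume z: "z \<in> Hom C v w" "(p' \<cdot>\<^bsub>C\<^esub> k) \<cdot>\<^bsub>C\<^esub> z = Zer C v b"
    have 1: "p' \<cdot>\<^bsub>C\<^esub> (k \<cdot>\<^bsub>C\<^esub> z) = Zer C v b" using z dom.Cmp_assoc[OF z(1) k(1) p'] by simp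
    have 2: "p \<cdot>\<^bsub>C\<^esub> (k \<cdot>\<^bsub>C\<^esub> z) = Zer C v a"
      using dom.Cmp_assoc[OF z(1) k(1) p] dom.kernelD(1)[OF k(2) p k(1)] z(1) o by (simp add: dom.Hom_iff)
    have "k \<cdot>\<^bsub>C\<^esub> z = Zer C v r" using joint[OF dom.Cmp_Hom[OF z(1) k(1)] 2 1] .
    then show "z = Zer C v w" using dom.mono_zero[OF dom.kernelD(2)[OF k(2) p k(1)] k(1) z(1)] by blast
  qed
  then have "is_zero_object D (Fobj F w)"
    using cod.mono_zero_imp_zero_object[OF exact_functor_preserves_mono[OF ex ab(1) _ p'k] Farr_Hom[OF p'k]] inv[OF k] by blast
  then have "Farr F k = Zer D (Fobj F w) (Fobj F r)" using cod.zero_object_Hom(1) Farr_Hom[OF k(1)] by blast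
  then have Fp: "is_mono D (Farr F p)"
    using D.kernel_zero_imp_mono[OF exact_functor_preserves_kernel[OF ex ab(1) k(2) p k(1)] Farr_Hom[OF p] Farr_Hom[OF k(1)]]
    by blast
  note H = Farr_Hom[OF p] Farr_Hom[OF c] Farr_Hom[OF q(1)]
  have Fpc: "Farr F (p \<cdot>\<^bsub>C\<^esub> c) = Farr F p \<cdot>\<^bsub>D\<^esub> Farr F c" using Farr_Cmp[OF c p] .
  have csp: "Farr F c \<cdot>\<^bsub>D\<^esub> (s \<cdot>\<^bsub>D\<^esub> Farr F p) \<in> Hom D (Fobj F r) (Fobj F r)"
    using cod.Cmp_Hom[OF cod.Cmp_Hom[OF H(1) s(1)] H(2)] .
  have "Farr F p \<cdot>\<^bsub>D\<^esub> (Farr F c \<cdot>\<^bsub>D\<^esub> (s \<cdot>\<^bsub>D\<^esub> Farr F p)) = ((Farr F p \<cdot>\<^bsub>D\<^esub> Farr F c) \<cdot>\<^bsub>D\<^esub> s) \<cdot>\<^bsub>D\<^esub> Farr F p"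
    using H s(1) by (simp add: cod.Hom_iff)
  also have "\<dots> = Farr F p \<cdot>\<^bsub>D\<^esub> Ide D (Fobj F r)"
    using s(2) Fpc H(1) by (simp add: cod.Hom_iff)
  finally have split: "Farr F c \<cdot>\<^bsub>D\<^esub> (s \<cdot>\<^bsub>D\<^esub> Farr F p) = Ide D (Fobj F r)"
    using cod.mono_cancel[OF Fp H(1) csp] cod.Ide_Hom o by simp
  have qc: "Farr F q \<cdot>\<^bsub>D\<^esub> Farr F c = Zer D (Fobj F x) (Fobj F t)"
    using Farr_Cmp[OF c q(1)] dom.cokernelD(1)[OF q(2) c q(1)] o tO by simp
  have "Farr F q = Farr F q \<cdot>\<^bsub>D\<^esub> (Farr F c \<cdot>\<^bsub>D\<^esub> (s \<cdot>\<^bsub>D\<^esub> Farr F p))"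
    unfolding split using H(3) by (simp add: cod.Hom_iff)
  also have "\<dots> = (Farr F q \<cdot>\<^bsub>D\<^esub> Farr F c) \<cdot>\<^bsub>D\<^esub> (s \<cdot>\<^bsub>D\<^esub> Farr F p)" using H s(1) by (simp add: cod.Hom_iff)
  also have "\<dots> = Zer D (Fobj F r) (Fobj F t)" unfolding qc using H s(1) tO by (simp add: cod.Hom_iff)
  finally show "is_zero_object D (Fobj F t)"
    using cod.epi_zero_imp_zero_object[OF exact_functor_preserves_epi[OF ex ab(1) dom.cokernelD(2)[OF q(2) c q(1)] q(1)] H(3)]
    by blast
qed

end

context adjunction
begin

text \<open>\<open>L\<close> takes the limit \<open>u\<close> of monomorphisms to a monomorphism of \<open>D\<close>, which kills \<open>L k\<close>.\<close>

lemma left_adjoint_kills_limit_kernel: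
  fixes \<kappa> :: "'u rel" and I :: "'u set"
  assumes ex: "exact_functor C D L" and ab: "abelian_category C" and lim: "direct_limits_exact \<kappa> D"
    and I: "is_set \<kappa> I" and S: "exact_limit_sequence C I r A \<alpha> B \<beta> E \<delta> f g P l M m N n u v"
    and k: "k \<in> Hom C K P" "is_kernel C k u"
  shows "is_zero_object D (Fobj L K)"
proof -
  have u: "u \<in> Hom C P M" and v: "v \<in> Hom C M N" using S unfolding exact_limit_sequence_def by blast+
  note K = L.dom.kernelD[OF k(2) u k(1)] and Lu = L.Farr_Hom[OF u] and Lk = L.Farr_Hom[OF k(1)]
  have "short_exact D (Farr L u) (Farr L v)"
    using lim[unfolded direct_limits_exact_iff, rule_format, OF I
        left_adjoint_preserves_exact_limit_sequence[OF ex S]] .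
  then have "is_mono D (Farr L u)" using L.cod.kernelD(2)[OF _ L.Farr_Hom[OF v] Lu] unfolding short_exact_def by blast
  moreover have "Farr L u \<cdot>\<^bsub>D\<^esub> Farr L k = Zer D (Fobj L K) (Fobj L M)"
    using L.Farr_Cmp[OF k(1) u] K(1) k(1) u by (simp add: L.dom.Hom_iff)
  ultimately have "Farr L k = Zer D (Fobj L K) (Fobj L P)" using L.cod.mono_zero[OF _ Lu Lk] by blast
  then show ?thesis
    using L.cod.mono_zero_imp_zero_object[OF L.exact_functor_preserves_mono[OF ex ab K(2) k(1)] Lk] by blast
qed

end

section \<open>Recollements\<close>

locale exact_recollement = recollement +
  assumes i_up_exact: "exact_functor A Y i_up"

sublocale recollement \<subseteq> i_adj: adjunction A Y i_up i_lo "adj_unit A Y i_up i_lo"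
  by (rule left_adjoint_imp_adjunction[OF i_up.additive_functor_axioms i_lo.additive_functor_axioms i_up_i_lo_adjoint])

sublocale recollement \<subseteq> ish_adj: adjunction Y A i_lo i_up_sh "adj_unit Y A i_lo i_up_sh"
  by (rule left_adjoint_imp_adjunction[OF i_lo.additive_functor_axioms i_up_sh.additive_functor_axioms i_lo_i_up_sh_adjoint])

sublocale recollement \<subseteq> jsh_adj: adjunction X A j_lo_sh j_up "adj_unit X A j_lo_sh j_up"
  by (rule left_adjoint_imp_adjunction[OF j_lo_sh.additive_functor_axioms j_up.additive_functor_axioms j_lo_sh_j_up_adjoint])

sublocale recollement \<subseteq> j_adj: adjunction A X j_up j_lo "adj_unit A X j_up j_lo"
  by (rule left_adjoint_imp_adjunction[OF j_up.additive_functor_axioms j_lo.additive_functor_axioms j_up_j_lo_adjoint])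

context recollement
begin

abbreviation "\<eta>i \<equiv> adj_unit A Y i_up i_lo"
abbreviation "\<eta>j \<equiv> adj_unit A X j_up j_lo"

lemma j_up_i_lo_zero:
  assumes y: "y \<in> Obj Y"
  shows "is_zero_object X (Fobj j_up (Fobj i_lo y))"
proof -
  have o: "Fobj i_lo y \<in> Obj A" using y by simp
  have "is_iso A (Ide A (Fobj i_lo y))"
    using A.is_isoI[OF A.Ide_Hom[OF o] A.Ide_Hom[OF o]] o by simp
  then have "isomorphic A (Fobj i_lo y) (Fobj i_lo y)" unfolding isomorphic_def using A.Ide_Hom[OF o] by blast
  then have "Fobj i_lo y \<in> ess_image Y A i_lo" unfolding ess_image_def using o y by blast
  then show ?thesis unfolding image_i_lo_eq_kernel_j_up functor_kernel_def by blast
qed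

text \<open>Killed by \<open>j_up\<close> means isomorphic to some \<open>i_lo y\<close>, and the arrows from \<open>M\<close> to \<open>i_lo y\<close> are the
  arrows out of \<open>i_up M\<close>.\<close>

lemma zero_object_if_both_zero:
  assumes M: "M \<in> Obj A" and i: "is_zero_object Y (Fobj i_up M)" and j: "is_zero_object X (Fobj j_up M)"
  shows "is_zero_object A M"
proof -
  have "M \<in> ess_image Y A i_lo" unfolding image_i_lo_eq_kernel_j_up functor_kernel_def using M j by blast
  then obtain y f where y: "y \<in> Obj Y" and f: "f \<in> Hom A (Fobj i_lo y) M" "is_iso A f"
    unfolding ess_image_def isomorphic_def by blast
  obtain g where g: "g \<in> Hom A M (Fobj i_lo y)" "f \<cdot>\<^bsub>A\<^esub> g = Ide A M" using A.iso_inverse[OF f(2,1)] by blast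
  have "g = Zer A M (Fobj i_lo y)" using i_adj.transpose_zero_object[OF M i g(1) y] .
  then have "f \<cdot>\<^bsub>A\<^esub> g = Zer A M M" using f(1) M by (simp add: A.Hom_iff)
  then show ?thesis using g(2) M by (simp add: A.zero_object_iff)
qed

lemma j_up_exact: "exact_functor A X j_up"
  unfolding exact_functor_def
proof (intro allI impI)
  fix f g assume s: "short_exact A f g"
  note H = A.short_exact_typing[OF s]
  show "short_exact X (Farr j_up f) (Farr j_up g)"
    using s jsh_adj.right_adjoint_preserves_kernel[OF _ H(2,1)] j_adj.left_adjoint_preserves_cokernel[OF _ H(1,2)]
    unfolding short_exact_def by blast
qed

lemma i_lo_exact: "exact_functor Y A i_lo"
  unfolding exact_functor_def
proof (intro allI impI)
  fix f g assume s: "short_exact Y f g"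
  note H = Y.short_exact_typing[OF s]
  show "short_exact A (Farr i_lo f) (Farr i_lo g)"
    using s i_adj.right_adjoint_preserves_kernel[OF _ H(2,1)] ish_adj.left_adjoint_preserves_cokernel[OF _ H(1,2)]
    unfolding short_exact_def by blast
qed

text \<open>The cokernel of the unit is a quotient of an object in the image of \<open>i_lo\<close>, hence killed by \<open>j_up\<close>, and
  it is killed by \<open>i_up\<close>, which inverts the unit.\<close>

lemma \<eta>i_epi:
  assumes M: "M \<in> Obj A"
  shows "is_epi A (\<eta>i M)"
proof -
  note u = i_adj.unit_Hom[OF M]
  obtain Q q where q: "q \<in> Hom A (Fobj i_lo (Fobj i_up M)) Q" "is_cokernel A q (\<eta>i M)" using A.obtain_cokernel[OF u] .
  note qe = A.cokernelD(2)[OF q(2) u q(1)]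
  have QO: "Q \<in> Obj A" using q(1) by (simp add: A.Hom_iff)
  have iM: "Fobj i_up M \<in> Obj Y" using M by simp
  have "Farr j_up q = Zer X (Fobj j_up (Fobj i_lo (Fobj i_up M))) (Fobj j_up Q)"
    using X.zero_object_Hom(1)[OF j_up_i_lo_zero[OF iM] j_up.Farr_Hom[OF q(1)]] .
  then have 1: "is_zero_object X (Fobj j_up Q)"
    using X.epi_zero_imp_zero_object[OF j_adj.left_adjoint_preserves_epi[OF qe q(1)] j_up.Farr_Hom[OF q(1)]] by blast
  note iso = i_adj.left_adjoint_unit_iso[OF i_lo_fully_faithful M]
  have "Farr i_up q \<cdot>\<^bsub>Y\<^esub> Farr i_up (\<eta>i M) = Zer Y (Fobj i_up M) (Fobj i_up Q)"
    using i_up.Farr_Cmp[OF u q(1)] A.cokernelD(1)[OF q(2) u q(1)] M QO by simp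
  then have "Farr i_up q = Zer Y (Fobj i_up (Fobj i_lo (Fobj i_up M))) (Fobj i_up Q)"
    using Y.epi_zero[OF Y.iso_imp_mono_epi(2)[OF iso i_up.Farr_Hom[OF u]] i_up.Farr_Hom[OF u] i_up.Farr_Hom[OF q(1)]] by blast
  then have 2: "is_zero_object Y (Fobj i_up Q)"
    using Y.epi_zero_imp_zero_object[OF i_adj.left_adjoint_preserves_epi[OF qe q(1)] i_up.Farr_Hom[OF q(1)]] by blast
  have "q = Zer A (Fobj i_lo (Fobj i_up M)) Q"
    using A.zero_object_Hom(2)[OF zero_object_if_both_zero[OF QO 2 1] q(1)] .
  then show ?thesis using A.cokernel_zero_imp_epi[OF q(2) u q(1)] by blast
qed

text \<open>The functor \<open>i_up j_lo_sh\<close> is left adjoint to \<open>j_up i_lo = 0\<close>.\<close>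

lemma i_up_j_lo_sh_zero:
  assumes x: "x \<in> Obj X"
  shows "is_zero_object Y (Fobj i_up (Fobj j_lo_sh x))"
proof -
  let ?S = "Fobj j_lo_sh x" let ?y = "Fobj i_up ?S"
  have S: "?S \<in> Obj A" and y: "?y \<in> Obj Y" using x by simp_all
  note u = i_adj.unit_Hom[OF S]
  have iy: "Fobj i_lo ?y \<in> Obj A" using y by simp
  have "Farr j_up (\<eta>i ?S) \<cdot>\<^bsub>X\<^esub> adj_unit X A j_lo_sh j_up x = Zer X x (Fobj j_up (Fobj i_lo ?y))"
    using X.zero_object_Hom(2)[OF j_up_i_lo_zero[OF y] jsh_adj.transpose_Hom[OF x u]] .
  then have "\<eta>i ?S = Zer A ?S (Fobj i_lo ?y)" using jsh_adj.transpose_eq_Zer[OF x u] by blast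
  then have "Farr i_lo (Ide Y ?y) \<cdot>\<^bsub>A\<^esub> \<eta>i ?S = Zer A ?S (Fobj i_lo ?y)" using y iy S by simp
  then have "Ide Y ?y = Zer Y ?y ?y" using i_adj.transpose_eq_Zer[OF S Y.Ide_Hom[OF y]] by blast
  then show ?thesis using y by (simp add: Y.zero_object_iff)
qed

end

context exact_recollement
begin

text \<open>Exactness of both functors passes the vanishing of \<open>f\<close> to the image object of \<open>f\<close>.\<close>

lemma jointly_faithful:
  assumes f: "f \<in> Hom A M N" and i: "Farr i_up f = Zer Y (Fobj i_up M) (Fobj i_up N)"
    and j: "Farr j_up f = Zer X (Fobj j_up M) (Fobj j_up N)"
  shows "f = Zer A M N"
proof -
  obtain c e m where e: "e \<in> Hom A M c" "is_epi A e" and m: "m \<in> Hom A c N" "is_mono A m" "m \<cdot>\<^bsub>A\<^esub> e = f"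
    using A.obtain_image_factorisation[OF f] by metis
  have c: "c \<in> Obj A" using e by (simp add: A.Hom_iff)
  note ab = A.abelian_category_axioms
  have 1: "is_zero_object Y (Fobj i_up c)"
    using i_up.exact_functor_zero_image[OF i_up_exact ab e(2,1) m(2,1)] i m(3) by simp
  have 2: "is_zero_object X (Fobj j_up c)"
    using j_up.exact_functor_zero_image[OF j_up_exact ab e(2,1) m(2,1)] j m(3) by simp
  have "e = Zer A M c" using A.zero_object_Hom(2)[OF zero_object_if_both_zero[OF c 1 2] e(1)] .
  then show ?thesis using m f by (auto simp: A.Hom_iff)
qed

text \<open>A left adjoint is right exact, so only monomorphisms matter. The kernel of \<open>j_lo_sh f\<close> is killed by
  \<open>j_up\<close>, since \<open>j_up j_lo_sh\<close> is the identity up to isomorphism, and it is killed by \<open>i_up\<close> as a subobject of an object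
  in the image of \<open>j_lo_sh\<close>.\<close>

lemma j_lo_sh_exact: "exact_functor X A j_lo_sh"
  unfolding exact_functor_def
proof (intro allI impI)
  fix f g assume s: "short_exact X f g"
  obtain a b c where f: "f \<in> Hom X a b" and g: "g \<in> Hom X b c" using X.short_exact_typing[OF s] by blast
  have ker: "is_kernel X f g" and cok: "is_cokernel X g f" using s unfolding short_exact_def by auto
  note fm = X.kernelD(2)[OF ker g f]
  let ?u = "adj_unit X A j_lo_sh j_up" and ?T = "\<lambda>a. Fobj j_up (Fobj j_lo_sh a)" and ?Tf = "Farr j_up (Farr j_lo_sh f)"
  have o: "a \<in> Obj X" "b \<in> Obj X" using f by (auto simp: X.Hom_iff)
  note F = j_lo_sh.Farr_Hom[OF f]
  obtain K k where k: "k \<in> Hom A K (Fobj j_lo_sh a)" "is_kernel A k (Farr j_lo_sh f)" using A.obtain_kernel[OF F] .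
  note km = A.kernelD(2)[OF k(2) F k(1)]
  have K: "K \<in> Obj A" using k(1) by (simp add: A.Hom_iff)
  have ua: "is_iso X (?u a)" and ub: "is_iso X (?u b)"
    using jsh_adj.fully_faithful_left_adjoint_unit_iso[OF j_lo_sh_fully_faithful] o by auto
  note jF = j_up.Farr_Hom[OF F] and uaH = jsh_adj.unit_Hom[OF o(1)] and ubH = jsh_adj.unit_Hom[OF o(2)]
  obtain v where v: "v \<in> Hom X (?T a) a" "?u a \<cdot>\<^bsub>X\<^esub> v = Ide X (?T a)"
    using X.iso_inverse[OF ua uaH] by blast
  have "is_mono X ?Tf"
  proof (rule X.is_monoI[OF jF])
    fix t h assume h: "h \<in> Hom X t (?T a)"
      and z: "?Tf \<cdot>\<^bsub>X\<^esub> h = Zer X t (?T b)"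
    note vh = X.Cmp_Hom[OF h v(1)]
    have hh: "?u a \<cdot>\<^bsub>X\<^esub> (v \<cdot>\<^bsub>X\<^esub> h) = h" using X.Cmp_assoc[OF h v(1) uaH] v(2) X.Cmp_Ide_left[OF h] by simp
    have "?u b \<cdot>\<^bsub>X\<^esub> (f \<cdot>\<^bsub>X\<^esub> (v \<cdot>\<^bsub>X\<^esub> h)) = ?Tf \<cdot>\<^bsub>X\<^esub> (?u a \<cdot>\<^bsub>X\<^esub> (v \<cdot>\<^bsub>X\<^esub> h))"
      using X.Cmp_assoc[OF vh f ubH] X.Cmp_assoc[OF vh uaH jF] jsh_adj.unit_natural[OF f] by simp
    then have "?u b \<cdot>\<^bsub>X\<^esub> (f \<cdot>\<^bsub>X\<^esub> (v \<cdot>\<^bsub>X\<^esub> h)) = Zer X t (?T b)" using hh z by simp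
    then have "f \<cdot>\<^bsub>X\<^esub> (v \<cdot>\<^bsub>X\<^esub> h) = Zer X t b"
      using X.mono_zero[OF X.iso_imp_mono_epi(1)[OF ub ubH] ubH X.Cmp_Hom[OF vh f]] by blast
    then have "v \<cdot>\<^bsub>X\<^esub> h = Zer X t a" using X.mono_zero[OF fm f vh] by blast
    then have "h = ?u a \<cdot>\<^bsub>X\<^esub> Zer X t a" using hh by simp
    then show "h = Zer X t (?T a)" using h o by (simp add: X.Hom_iff)
  qed
  moreover have "?Tf \<cdot>\<^bsub>X\<^esub> Farr j_up k = Zer X (Fobj j_up K) (?T b)"
    using j_up.Farr_Cmp[OF k(1) F] A.kernelD(1)[OF k(2) F k(1)] K o by simp
  ultimately have "Farr j_up k = Zer X (Fobj j_up K) (?T a)"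
    using X.mono_zero[OF _ jF j_up.Farr_Hom[OF k(1)]] by blast
  then have 1: "is_zero_object X (Fobj j_up K)"
    using X.mono_zero_imp_zero_object[OF jsh_adj.right_adjoint_preserves_mono[OF km k(1)] j_up.Farr_Hom[OF k(1)]] by blast
  have "Farr i_up k = Zer Y (Fobj i_up K) (Fobj i_up (Fobj j_lo_sh a))"
    using Y.zero_object_Hom(2)[OF i_up_j_lo_sh_zero[OF o(1)] i_up.Farr_Hom[OF k(1)]] .
  then have 2: "is_zero_object Y (Fobj i_up K)"
    using Y.mono_zero_imp_zero_object[OF i_up.exact_functor_preserves_mono[OF i_up_exact A.abelian_category_axioms km k(1)]
        i_up.Farr_Hom[OF k(1)]] by blast
  have "k = Zer A K (Fobj j_lo_sh a)" using A.zero_object_Hom(1)[OF zero_object_if_both_zero[OF K 2 1] k(1)] .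
  then have "is_mono A (Farr j_lo_sh f)" using A.kernel_zero_imp_mono[OF k(2) F k(1)] by blast
  then show "short_exact A (Farr j_lo_sh f) (Farr j_lo_sh g)"
    using A.short_exactI[OF F j_lo_sh.Farr_Hom[OF g] _ jsh_adj.left_adjoint_preserves_cokernel[OF cok f g]] by blast
qed

text \<open>The cokernel half is formal. The kernel of the limit of monomorphisms is killed by \<open>j_up\<close> and by \<open>i_up\<close>,
  under which it becomes the kernel of a limit of monomorphisms of \<open>X\<close> or \<open>Y\<close>.\<close>

lemma direct_limits_exact_middle:
  fixes \<kappa> :: "'u rel"
  assumes X: "direct_limits_exact \<kappa> X" and Y: "direct_limits_exact \<kappa> Y"
  shows "direct_limits_exact \<kappa> A"
  unfolding direct_limits_exact_iff
proof (intro allI impI)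
  fix I :: "'u set" and r Q \<alpha> B \<beta> D \<delta> f g L l M m N n u v
  assume I: "is_set \<kappa> I" and S: "exact_limit_sequence A I r Q \<alpha> B \<beta> D \<delta> f g L l M m N n u v"
  have u: "u \<in> Hom A L M" and v: "v \<in> Hom A M N" using S unfolding exact_limit_sequence_def by blast+
  obtain K k where k: "k \<in> Hom A K L" "is_kernel A k u" using A.obtain_kernel[OF u] .
  have K: "K \<in> Obj A" using k(1) by (simp add: A.Hom_iff)
  note ab = A.abelian_category_axioms
  have i: "is_zero_object Y (Fobj i_up K)"
    using i_adj.left_adjoint_kills_limit_kernel[OF i_up_exact ab Y I S k] .
  have j: "is_zero_object X (Fobj j_up K)"
    using j_adj.left_adjoint_kills_limit_kernel[OF j_up_exact ab X I S k] .
  have "k = Zer A K L" using A.zero_object_Hom(1)[OF zero_object_if_both_zero[OF K i j] k(1)] .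
  then have "is_mono A u" using A.kernel_zero_imp_mono[OF k(2) u k(1)] by blast
  then show "short_exact A u v" using A.short_exactI[OF u v _ A.exact_limit_sequence_cokernel[OF S]] by blast
qed

text \<open>The comparison from \<open>M\<close> to the pullback \<open>R\<close> becomes an isomorphism under both functors: \<open>j_up\<close> inverts
  \<open>\<eta>j M\<close> and kills the two corners in the image of \<open>i_lo\<close>, while \<open>i_up\<close> inverts the two parallel
  arrows \<open>\<eta>i\<close>. So its kernel and cokernel vanish.\<close>

lemma gluing_lift:
  assumes M: "M \<in> Obj A" and a: "a \<in> Hom A T (Fobj j_lo (Fobj j_up M))" and b: "b \<in> Hom A T (Fobj i_lo (Fobj i_up M))"
    and ab: "\<eta>i (Fobj j_lo (Fobj j_up M)) \<cdot>\<^bsub>A\<^esub> a = Farr i_lo (Farr i_up (\<eta>j M)) \<cdot>\<^bsub>A\<^esub> b"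
  shows "\<exists>h \<in> Hom A T M. \<eta>j M \<cdot>\<^bsub>A\<^esub> h = a \<and> \<eta>i M \<cdot>\<^bsub>A\<^esub> h = b"
proof -
  let ?J = "Fobj j_lo (Fobj j_up M)" and ?I = "Fobj i_lo (Fobj i_up M)"
  let ?N = "Fobj i_lo (Fobj i_up ?J)" and ?w = "Farr i_lo (Farr i_up (\<eta>j M))"
  have J: "?J \<in> Obj A" and No: "?N \<in> Obj A" using M by simp_all
  note uj = j_adj.unit_Hom[OF M] and ui = i_adj.unit_Hom[OF M] and uJ = i_adj.unit_Hom[OF J]
  have w: "?w \<in> Hom A ?I ?N" using i_lo.Farr_Hom[OF i_up.Farr_Hom[OF uj]] .
  obtain p q where pb: "is_pullback A (\<eta>i ?J) ?w p q"
    using A.pullback_exists[OF uJ w] by blast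
  obtain R where p: "p \<in> Hom A R ?J" and q: "q \<in> Hom A R ?I"
    and pq: "\<eta>i ?J \<cdot>\<^bsub>A\<^esub> p = ?w \<cdot>\<^bsub>A\<^esub> q"
    and ex: "\<And>t x y. x \<in> Hom A t ?J \<Longrightarrow> y \<in> Hom A t ?I \<Longrightarrow> \<eta>i ?J \<cdot>\<^bsub>A\<^esub> x = ?w \<cdot>\<^bsub>A\<^esub> y
      \<Longrightarrow> \<exists>u \<in> Hom A t R. p \<cdot>\<^bsub>A\<^esub> u = x \<and> q \<cdot>\<^bsub>A\<^esub> u = y"
    and joint: "\<And>t x. x \<in> Hom A t R \<Longrightarrow> p \<cdot>\<^bsub>A\<^esub> x = Zer A t ?J \<Longrightarrow> q \<cdot>\<^bsub>A\<^esub> x = Zer A t ?I \<Longrightarrow> x = Zer A t R"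
    by (rule A.pullbackD[OF pb uJ w], rule that) blast+
  have RO: "R \<in> Obj A" using p by (simp add: A.Hom_iff)
  obtain c where c: "c \<in> Hom A M R" "p \<cdot>\<^bsub>A\<^esub> c = \<eta>j M" "q \<cdot>\<^bsub>A\<^esub> c = \<eta>i M"
    using ex[OF uj ui i_adj.unit_natural[OF uj]] by blast
  note abA = A.abelian_category_axioms and abX = X.abelian_category_axioms and abY = Y.abelian_category_axioms
  have isoj: "is_iso X (Farr j_up (p \<cdot>\<^bsub>A\<^esub> c))" using j_adj.left_adjoint_unit_iso[OF j_lo_fully_faithful M] c(2) by simp
  have isoi: "is_iso Y (Farr i_up (q \<cdot>\<^bsub>A\<^esub> c))" using i_adj.left_adjoint_unit_iso[OF i_lo_fully_faithful M] c(3) by simp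
  have kerj: "Farr j_up (q \<cdot>\<^bsub>A\<^esub> k) = Zer X (Fobj j_up t) (Fobj j_up ?I)" if k: "k \<in> Hom A t R" "is_kernel A k p" for t k
    using X.zero_object_Hom(2)[OF j_up_i_lo_zero j_up.Farr_Hom[OF A.Cmp_Hom[OF k(1) q]]] M by simp
  have keri: "Farr i_up (p \<cdot>\<^bsub>A\<^esub> k) = Zer Y (Fobj i_up t) (Fobj i_up ?J)" if k: "k \<in> Hom A t R" "is_kernel A k q" for t k
  proof -
    have t: "t \<in> Obj A" using k by (simp add: A.Hom_iff)
    note pk = A.Cmp_Hom[OF k(1) p]
    have "\<eta>i ?J \<cdot>\<^bsub>A\<^esub> (p \<cdot>\<^bsub>A\<^esub> k) = ?w \<cdot>\<^bsub>A\<^esub> (q \<cdot>\<^bsub>A\<^esub> k)"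
      using A.Cmp_assoc[OF k(1) p uJ] A.Cmp_assoc[OF k(1) q w] pq by simp
    also have "\<dots> = Zer A t ?N" using A.kernelD(1)[OF k(2) q k(1)] w t by (simp add: A.Hom_iff)
    finally have "Farr i_up (\<eta>i ?J) \<cdot>\<^bsub>Y\<^esub> Farr i_up (p \<cdot>\<^bsub>A\<^esub> k) = Zer Y (Fobj i_up t) (Fobj i_up ?N)"
      using i_up.Farr_Cmp[OF pk uJ] t No by simp
    moreover have "is_mono Y (Farr i_up (\<eta>i ?J))"
      using Y.iso_imp_mono_epi(1)[OF i_adj.left_adjoint_unit_iso[OF i_lo_fully_faithful J] i_up.Farr_Hom[OF uJ]] .
    ultimately show ?thesis using Y.mono_zero[OF _ i_up.Farr_Hom[OF uJ] i_up.Farr_Hom[OF pk]] by blast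
  qed
  have joint': "x = Zer A t R" if "x \<in> Hom A t R" "q \<cdot>\<^bsub>A\<^esub> x = Zer A t ?I" "p \<cdot>\<^bsub>A\<^esub> x = Zer A t ?J" for t x
    using joint that by blast
  obtain K k where k: "k \<in> Hom A K M" "is_kernel A k c" using A.obtain_kernel[OF c(1)] .
  have KO: "K \<in> Obj A" using k(1) by (simp add: A.Hom_iff)
  have "is_zero_object A K"
    using zero_object_if_both_zero[OF KO
        i_up.exact_functor_comparison(1)[OF i_up_exact abA abY q p c(1) joint' isoi keri k]
        j_up.exact_functor_comparison(1)[OF j_up_exact abA abX p q c(1) joint isoj kerj k]] by blast
  then have "k = Zer A K M" using A.zero_object_Hom(1) k(1) by blast
  then have cm: "is_mono A c" using A.kernel_zero_imp_mono[OF k(2) c(1) k(1)] by blast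
  obtain Q e where e: "e \<in> Hom A R Q" "is_cokernel A e c" using A.obtain_cokernel[OF c(1)] .
  have QO: "Q \<in> Obj A" using e(1) by (simp add: A.Hom_iff)
  have "is_zero_object A Q"
    using zero_object_if_both_zero[OF QO
        i_up.exact_functor_comparison(2)[OF i_up_exact abA abY q p c(1) joint' isoi keri e]
        j_up.exact_functor_comparison(2)[OF j_up_exact abA abX p q c(1) joint isoj kerj e]] by blast
  then have "e = Zer A R Q" using A.zero_object_Hom(2) e(1) by blast
  then have ce: "is_epi A c" using A.cokernel_zero_imp_epi[OF e(2) c(1) e(1)] by blast
  obtain d where d: "d \<in> Hom A R M" "c \<cdot>\<^bsub>A\<^esub> d = Ide A R"
    using A.iso_inverse[OF A.mono_epi_imp_iso[OF cm ce c(1)] c(1)] by blast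
  obtain h where h: "h \<in> Hom A T R" "p \<cdot>\<^bsub>A\<^esub> h = a" "q \<cdot>\<^bsub>A\<^esub> h = b" using ex[OF a b ab] by blast
  have cdh: "c \<cdot>\<^bsub>A\<^esub> (d \<cdot>\<^bsub>A\<^esub> h) = h" using A.Cmp_assoc[OF h(1) d(1) c(1)] d(2) A.Cmp_Ide_left[OF h(1)] by simp
  note dh = A.Cmp_Hom[OF h(1) d(1)]
  have "\<eta>j M \<cdot>\<^bsub>A\<^esub> (d \<cdot>\<^bsub>A\<^esub> h) = a" "\<eta>i M \<cdot>\<^bsub>A\<^esub> (d \<cdot>\<^bsub>A\<^esub> h) = b"
    using A.Cmp_assoc[OF dh c(1) p] A.Cmp_assoc[OF dh c(1) q] c(2,3) cdh h(2,3) by simp_all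
  then show ?thesis using dh by blast
qed

end

section \<open>A generator of the middle category\<close>

context category
begin

text \<open>A countable copower \<open>H\<close> of \<open>G\<close> absorbs two copies of itself, which makes the arrows from \<open>H\<close> to a fixed
  object directed under factorisation. This does the work of all finite copowers of \<open>G\<close> with
  one object.\<close>

lemma countable_copower:
  fixes \<kappa> :: "'u rel"
  assumes \<kappa>: "size_cardinal \<kappa>" and ab3: "AB3 \<kappa> C" and G: "G \<in> Obj C"
  obtains H \<sigma> where "H \<in> Obj C" "\<sigma> \<in> Hom C G H"
    "\<And>x f. f \<in> Hom C G x \<Longrightarrow> \<exists>s \<in> Hom C H x. s \<cdot> \<sigma> = f"
    "\<And>x s s'. s \<in> Hom C H x \<Longrightarrow> s' \<in> Hom C H x
      \<Longrightarrow> \<exists>z \<in> Hom C H x. (\<exists>w \<in> Hom C H H. z \<cdot> w = s) \<and> (\<exists>w \<in> Hom C H H. z \<cdot> w = s')"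
proof -
  have card: "Card_order \<kappa>" and "natLeq <o \<kappa>" using \<kappa> unfolding size_cardinal_def by auto
  then have "is_set \<kappa> (UNIV :: nat set)"
    unfolding is_set_def using ordIso_ordLess_trans[OF card_of_nat] by blast
  then obtain I :: "'u set" and e where I: "is_set \<kappa> I" "bij_betw e I (UNIV :: nat set)"
    using small_set_indexed[OF card] by blast
  define d where "d = inv_into I e"
  have dI: "d n \<in> I" and ed: "e (d n) = n" for n
    using bij_betw_imp_surj_on[OF I(2)] unfolding d_def by (simp_all add: inv_into_into f_inv_into_f)
  have de: "d (e i) = i" if "i \<in> I" for i
    using I(2) that unfolding d_def bij_betw_def by (simp add: inv_into_f_f)
  obtain H \<iota> where cop: "is_coproduct C I (\<lambda>_. G) H \<iota>" using AB3D[OF ab3 I(1), of "\<lambda>_. G"] G by blast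
  note H = coproductD(1)[OF cop] and \<iota> = coproductD(2)[OF cop dI]
  \<comment> \<open>Numbering the inclusions by the naturals, maps out of the copower are sequences of maps out of \<open>G\<close>.\<close>
  have ext: "\<exists>u \<in> Hom C H x. \<forall>n. u \<cdot> \<iota> (d n) = f n" if f: "\<And>n. f n \<in> Hom C G x" for f x
  proof -
    have "\<exists>u \<in> Hom C H x. \<forall>i \<in> I. u \<cdot> \<iota> i = f (e i)"
      using coproductD(3)[OF cop Hom_ObjD(2)[OF f], of "\<lambda>i. f (e i)"] f by blast
    then show ?thesis using dI ed by metis
  qed
  have uniq: "u = v" if "u \<in> Hom C H x" "v \<in> Hom C H x" "\<And>n. u \<cdot> \<iota> (d n) = v \<cdot> \<iota> (d n)" for u v x
    using coproductD(4)[OF cop that(1,2)] that(3) de by metis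
  have shift: "\<exists>w \<in> Hom C H H. z \<cdot> w = s"
    if z: "z \<in> Hom C H x" and s: "s \<in> Hom C H x" and zs: "\<And>n. z \<cdot> \<iota> (d (g n)) = s \<cdot> \<iota> (d n)" for z s x g
  proof -
    obtain w where w: "w \<in> Hom C H H" "\<forall>n. w \<cdot> \<iota> (d n) = \<iota> (d (g n))" using ext[of "\<lambda>n. \<iota> (d (g n))"] \<iota> by blast
    have "z \<cdot> w = s"
    proof (rule uniq[OF Cmp_Hom[OF w(1) z] s])
      show "(z \<cdot> w) \<cdot> \<iota> (d n) = s \<cdot> \<iota> (d n)" for n using Cmp_assoc[OF \<iota> w(1) z] w(2) zs by simp
    qed
    then show ?thesis using w(1) by blast
  qed
  show thesis
  proof (rule that[OF H \<iota>[of 0]])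
    show "\<exists>s \<in> Hom C H x. s \<cdot> \<iota> (d 0) = f" if "f \<in> Hom C G x" for x f using ext[of "\<lambda>_. f" x] that by blast
    fix x s s' assume s: "s \<in> Hom C H x" and s': "s' \<in> Hom C H x"
    define f where "f n = (if even n then s \<cdot> \<iota> (d (n div 2)) else s' \<cdot> \<iota> (d (n div 2)))" for n
    have "\<And>n. f n \<in> Hom C G x" unfolding f_def using Cmp_Hom[OF \<iota> s] Cmp_Hom[OF \<iota> s'] by simp
    then obtain z where z: "z \<in> Hom C H x" "\<forall>n. z \<cdot> \<iota> (d n) = f n" using ext by blast
    have "\<exists>w \<in> Hom C H H. z \<cdot> w = s" by (rule shift[OF z(1) s, of "\<lambda>n. 2 * n"]) (simp add: z(2) f_def)
    moreover have "\<exists>w \<in> Hom C H H. z \<cdot> w = s'" by (rule shift[OF z(1) s', of "\<lambda>n. 2 * n + 1"]) (simp add: z(2) f_def)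
    ultimately show "\<exists>z \<in> Hom C H x. (\<exists>w \<in> Hom C H H. z \<cdot> w = s) \<and> (\<exists>w \<in> Hom C H H. z \<cdot> w = s')"
      using z(1) by blast
  qed
qed

end

context exact_recollement
begin

text \<open>The coproduct of the objects \<open>E \<beta>\<close> glued from \<open>H\<close> and \<open>G\<^sub>Y\<close> is a generator. That \<open>\<beta>\<close> ranges over a hom
  set of \<open>Y\<close>, and not over subobjects, keeps the family small even though \<open>\<kappa>\<close> need not be closed
  under power sets.\<close>

lemma generator_middle:
  fixes \<kappa> :: "'u rel"
  assumes \<kappa>: "size_cardinal \<kappa>" and smallA: "hom_sets \<kappa> A" and smallX: "hom_sets \<kappa> X" and smallY: "hom_sets \<kappa> Y"
    and ab3A: "AB3 \<kappa> A" and ab3X: "AB3 \<kappa> X" and ab3Y: "AB3 \<kappa> Y" and exY: "direct_limits_exact \<kappa> Y"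
    and GX: "is_generator X G\<^sub>X" and GY: "is_generator Y G\<^sub>Y"
    and gen: "ess_image X A j_lo \<subseteq> Gen \<kappa> A (Fobj j_lo G\<^sub>X)"
  shows "\<exists>G. is_generator A G"
proof -
  have card: "Card_order \<kappa>" using \<kappa> unfolding size_cardinal_def by blast
  have GXO: "G\<^sub>X \<in> Obj X" and GYO: "G\<^sub>Y \<in> Obj Y" using GX GY unfolding is_generator_def by auto
  obtain H \<sigma> where H: "H \<in> Obj X" and \<sigma>: "\<sigma> \<in> Hom X G\<^sub>X H"
    and ext: "\<And>x f. f \<in> Hom X G\<^sub>X x \<Longrightarrow> \<exists>s \<in> Hom X H x. s \<cdot>\<^bsub>X\<^esub> \<sigma> = f"
    and dir: "\<And>x s s'. s \<in> Hom X H x \<Longrightarrow> s' \<in> Hom X H x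
      \<Longrightarrow> \<exists>z \<in> Hom X H x. (\<exists>w \<in> Hom X H H. z \<cdot>\<^bsub>X\<^esub> w = s) \<and> (\<exists>w \<in> Hom X H H. z \<cdot>\<^bsub>X\<^esub> w = s')"
    by (rule X.countable_copower[OF \<kappa> ab3X GXO], rule that) blast+
  let ?F = "\<lambda>x. Fobj i_up (Fobj j_lo x)" and ?f = "\<lambda>s. Farr i_up (Farr j_lo s)"
  have FO: "?F x \<in> Obj Y" "Fobj j_lo x \<in> Obj A" if "x \<in> Obj X" for x using that by simp_all
  have FH: "?f s \<in> Hom Y (?F x) (?F x')" if "s \<in> Hom X x x'" for s x x'
    using i_up.Farr_Hom[OF j_lo.Farr_Hom[OF that]] .

  have jointly_epi: "t = Zer Y (?F x) T"
    if x: "x \<in> Obj X" and t: "t \<in> Hom Y (?F x) T" and z: "\<forall>s \<in> Hom X H x. t \<cdot>\<^bsub>Y\<^esub> ?f s = Zer Y (?F H) T" for x t T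
  proof (rule i_adj.transpose_eq_Zer[OF FO(2)[OF x] t], rule ccontr)
    let ?j = "Fobj j_lo x" and ?t = "Farr i_lo t \<cdot>\<^bsub>A\<^esub> \<eta>i (Fobj j_lo x)"
    assume nz: "?t \<noteq> Zer A ?j (Fobj i_lo T)"
    have T: "T \<in> Obj Y" using t by (simp add: Y.Hom_iff)
    have tH: "?t \<in> Hom A ?j (Fobj i_lo T)" using i_adj.transpose_Hom[OF FO(2)[OF x] t] .
    have "is_iso A (Ide A ?j)" using A.is_isoI[OF A.Ide_Hom A.Ide_Hom] FO(2)[OF x] by simp
    then have "?j \<in> ess_image X A j_lo"
      unfolding ess_image_def isomorphic_def using x FO(2)[OF x] A.Ide_Hom by blast
    then have "?j \<in> Gen \<kappa> A (Fobj j_lo G\<^sub>X)" using gen by blast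
    then obtain h where h: "h \<in> Hom A (Fobj j_lo G\<^sub>X) ?j" "?t \<cdot>\<^bsub>A\<^esub> h \<noteq> Zer A (Fobj j_lo G\<^sub>X) (Fobj i_lo T)"
      using A.Gen_iff[OF card ab3A smallA FO(2)[OF GXO] FO(2)[OF x]] tH nz by blast
    obtain h' where h': "h' \<in> Hom X G\<^sub>X x" "Farr j_lo h' = h"
      using j_lo.fully_faithful_full[OF j_lo_fully_faithful GXO x h(1)] .
    obtain s where s: "s \<in> Hom X H x" "s \<cdot>\<^bsub>X\<^esub> \<sigma> = h'" using ext[OF h'(1)] by blast
    note js = j_lo.Farr_Hom[OF s(1)] and j\<sigma> = j_lo.Farr_Hom[OF \<sigma>]
    have "?t \<cdot>\<^bsub>A\<^esub> Farr j_lo s = Farr i_lo (t \<cdot>\<^bsub>Y\<^esub> ?f s) \<cdot>\<^bsub>A\<^esub> \<eta>i (Fobj j_lo H)"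
      using i_adj.transpose_Cmp_right[OF js t] by simp
    also have "\<dots> = Zer A (Fobj j_lo H) (Fobj i_lo T)"
      using z s(1) i_adj.transpose_Zer[OF FO(2)[OF H] T] by simp
    finally have ts: "?t \<cdot>\<^bsub>A\<^esub> Farr j_lo s = Zer A (Fobj j_lo H) (Fobj i_lo T)" .
    have "?t \<cdot>\<^bsub>A\<^esub> h = (?t \<cdot>\<^bsub>A\<^esub> Farr j_lo s) \<cdot>\<^bsub>A\<^esub> Farr j_lo \<sigma>"
      using A.Cmp_assoc[OF j\<sigma> js tH] j_lo.Farr_Cmp[OF \<sigma> s(1)] s(2) h'(2) by simp
    also have "\<dots> = Zer A (Fobj j_lo G\<^sub>X) (Fobj i_lo T)"
      unfolding ts using j\<sigma> T by (simp add: A.Hom_iff)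
    finally show False using h(2) by blast
  qed

  \<comment> \<open>The objects glued from \<open>H\<close> and \<open>G\<^sub>Y\<close>, one for each possible gluing map \<open>\<beta>\<close>.\<close>
  let ?\<eta> = "\<eta>i (Fobj j_lo H)"
  note uH = i_adj.unit_Hom[OF FO(2)[OF H]]
  let ?J = "Hom Y G\<^sub>Y (?F H)"
  have "\<forall>\<beta>. \<exists>p q r. \<beta> \<in> ?J \<longrightarrow> is_pullback A ?\<eta> (Farr i_lo \<beta>) p q \<and> p \<in> Hom A r (Fobj j_lo H) \<and> q \<in> Hom A r (Fobj i_lo G\<^sub>Y)"
  proof
    fix \<beta> show "\<exists>p q r. \<beta> \<in> ?J \<longrightarrow> is_pullback A ?\<eta> (Farr i_lo \<beta>) p q \<and> p \<in> Hom A r (Fobj j_lo H) \<and> q \<in> Hom A r (Fobj i_lo G\<^sub>Y)"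
    proof (cases "\<beta> \<in> ?J")
      case True
      obtain p q where pb: "is_pullback A ?\<eta> (Farr i_lo \<beta>) p q"
        using A.pullback_exists[OF uH i_lo.Farr_Hom[OF True]] by blast
      obtain r where "p \<in> Hom A r (Fobj j_lo H)" "q \<in> Hom A r (Fobj i_lo G\<^sub>Y)"
        using A.pullbackD[OF pb uH i_lo.Farr_Hom[OF True]] by metis
      then show ?thesis using pb by blast
    qed blast
  qed
  then obtain p q E where pb: "\<And>\<beta>. \<beta> \<in> ?J \<Longrightarrow> is_pullback A ?\<eta> (Farr i_lo \<beta>) (p \<beta>) (q \<beta>)"
    and p: "\<And>\<beta>. \<beta> \<in> ?J \<Longrightarrow> p \<beta> \<in> Hom A (E \<beta>) (Fobj j_lo H)"
    and q: "\<And>\<beta>. \<beta> \<in> ?J \<Longrightarrow> q \<beta> \<in> Hom A (E \<beta>) (Fobj i_lo G\<^sub>Y)" by metis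
  have pq: "?\<eta> \<cdot>\<^bsub>A\<^esub> p \<beta> = Farr i_lo \<beta> \<cdot>\<^bsub>A\<^esub> q \<beta>" if "\<beta> \<in> ?J" for \<beta>
    using pb[OF that] unfolding is_pullback_def by blast
  have q_epi: "is_epi A (q \<beta>)" if "\<beta> \<in> ?J" for \<beta>
    using A.pullback_of_epi[OF uH i_lo.Farr_Hom[OF that] \<eta>i_epi[OF FO(2)[OF H]] pb[OF that]] .
  have EO: "E \<beta> \<in> Obj A" if "\<beta> \<in> ?J" for \<beta> using A.Hom_ObjD(1)[OF p[OF that]] .

  \<comment> \<open>Although \<open>p \<beta>\<close> need not be an epimorphism, no nonzero \<open>j_lo t\<close> vanishes on it: the kernel of
    \<open>?\<eta>\<close> factors through \<open>p \<beta>\<close>, so such a \<open>j_lo t\<close> would factor through \<open>i_lo\<close>, and every arrow from the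
    image of \<open>i_lo\<close> to that of \<open>j_lo\<close> is zero.\<close>
  have p_faithful: "t = Zer X H x"
    if b: "\<beta> \<in> ?J" and t: "t \<in> Hom X H x" and z: "Farr j_lo t \<cdot>\<^bsub>A\<^esub> p \<beta> = Zer A (E \<beta>) (Fobj j_lo x)" for \<beta> t x
  proof -
    have x: "x \<in> Obj X" using t by (simp add: X.Hom_iff)
    note jt = j_lo.Farr_Hom[OF t] and ib = i_lo.Farr_Hom[OF b]
    obtain K k where k: "k \<in> Hom A K (Fobj j_lo H)" "is_kernel A k ?\<eta>" using A.obtain_kernel[OF uH] .
    have K: "K \<in> Obj A" and iG: "Fobj i_lo G\<^sub>Y \<in> Obj A" using k(1) GYO by (simp_all add: A.Hom_iff)
    have "?\<eta> \<cdot>\<^bsub>A\<^esub> k = Farr i_lo \<beta> \<cdot>\<^bsub>A\<^esub> Zer A K (Fobj i_lo G\<^sub>Y)"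
      using A.kernelD(1)[OF k(2) uH k(1)] ib K by (simp add: A.Hom_iff)
    then obtain u where u: "u \<in> Hom A K (E \<beta>)" "p \<beta> \<cdot>\<^bsub>A\<^esub> u = k"
      using pb[OF b] k(1) A.Zer_Hom[OF K iG] p[OF b] uH ib unfolding is_pullback_def A.HomD(1)[OF uH] A.HomD(1)[OF ib] A.HomD(1)[OF p[OF b]]
      by blast
    have "Farr j_lo t \<cdot>\<^bsub>A\<^esub> k = (Farr j_lo t \<cdot>\<^bsub>A\<^esub> p \<beta>) \<cdot>\<^bsub>A\<^esub> u" using A.Cmp_assoc[OF u(1) p[OF b] jt] u(2) by simp
    also have "\<dots> = Zer A K (Fobj j_lo x)" unfolding z using u(1) x by (simp add: A.Hom_iff)
    finally obtain w where w: "w \<in> Hom A (Fobj i_lo (?F H)) (Fobj j_lo x)" "w \<cdot>\<^bsub>A\<^esub> ?\<eta> = Farr j_lo t"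
      using A.cokernelD(3)[OF A.epi_is_cokernel_of_kernel[OF \<eta>i_epi[OF FO(2)[OF H]] uH k(2,1)] k(1) uH jt] by blast
    have "w = Zer A (Fobj i_lo (?F H)) (Fobj j_lo x)"
      using j_adj.transpose_zero_object[OF _ j_up_i_lo_zero[OF FO(1)[OF H]] w(1) x] FO(1)[OF H] by simp
    then have "Farr j_lo t = Farr j_lo (Zer X H x)" using w uH H x by (auto simp: A.Hom_iff)
    then show ?thesis using j_lo.fully_faithful_faithful[OF j_lo_fully_faithful t X.Zer_Hom[OF H x]] by blast
  qed

  have glue: "\<exists>h \<in> Hom A (E \<beta>) M. \<eta>j M \<cdot>\<^bsub>A\<^esub> h = Farr j_lo s \<cdot>\<^bsub>A\<^esub> p \<beta> \<and> \<eta>i M \<cdot>\<^bsub>A\<^esub> h = Farr i_lo g \<cdot>\<^bsub>A\<^esub> q \<beta>"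
    if M: "M \<in> Obj A" and s: "s \<in> Hom X H (Fobj j_up M)" and g: "g \<in> Hom Y G\<^sub>Y (Fobj i_up M)"
      and b: "\<beta> \<in> ?J" and sb: "?f s \<cdot>\<^bsub>Y\<^esub> \<beta> = Farr i_up (\<eta>j M) \<cdot>\<^bsub>Y\<^esub> g" for M s g \<beta>
  proof (rule gluing_lift[OF M])
    have x: "Fobj j_up M \<in> Obj X" using M by simp
    note js = j_lo.Farr_Hom[OF s] and ig = i_lo.Farr_Hom[OF g] and ib = i_lo.Farr_Hom[OF b]
    note uJ = i_adj.unit_Hom[OF FO(2)[OF x]] and ifs = i_lo.Farr_Hom[OF FH[OF s]]
    note iu = i_up.Farr_Hom[OF j_adj.unit_Hom[OF M]] and iiu = i_lo.Farr_Hom[OF i_up.Farr_Hom[OF j_adj.unit_Hom[OF M]]]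
    show "Farr j_lo s \<cdot>\<^bsub>A\<^esub> p \<beta> \<in> Hom A (E \<beta>) (Fobj j_lo (Fobj j_up M))" using A.Cmp_Hom[OF p[OF b] js] .
    show "Farr i_lo g \<cdot>\<^bsub>A\<^esub> q \<beta> \<in> Hom A (E \<beta>) (Fobj i_lo (Fobj i_up M))" using A.Cmp_Hom[OF q[OF b] ig] .
    have "\<eta>i (Fobj j_lo (Fobj j_up M)) \<cdot>\<^bsub>A\<^esub> (Farr j_lo s \<cdot>\<^bsub>A\<^esub> p \<beta>) = Farr i_lo (?f s) \<cdot>\<^bsub>A\<^esub> (?\<eta> \<cdot>\<^bsub>A\<^esub> p \<beta>)"
      using A.Cmp_assoc[OF p[OF b] js uJ] i_adj.unit_natural[OF js] A.Cmp_assoc[OF p[OF b] uH ifs] by simp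
    also have "\<dots> = Farr i_lo (?f s \<cdot>\<^bsub>Y\<^esub> \<beta>) \<cdot>\<^bsub>A\<^esub> q \<beta>"
      using pq[OF b] A.Cmp_assoc[OF q[OF b] ib ifs] i_lo.Farr_Cmp[OF b FH[OF s]] by simp
    also have "\<dots> = Farr i_lo (Farr i_up (\<eta>j M)) \<cdot>\<^bsub>A\<^esub> (Farr i_lo g \<cdot>\<^bsub>A\<^esub> q \<beta>)"
      unfolding sb using i_lo.Farr_Cmp[OF g iu] A.Cmp_assoc[OF q[OF b] ig iiu] by simp
    finally show "\<eta>i (Fobj j_lo (Fobj j_up M)) \<cdot>\<^bsub>A\<^esub> (Farr j_lo s \<cdot>\<^bsub>A\<^esub> p \<beta>) =
      Farr i_lo (Farr i_up (\<eta>j M)) \<cdot>\<^bsub>A\<^esub> (Farr i_lo g \<cdot>\<^bsub>A\<^esub> q \<beta>)" .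
  qed

  have separating: "\<exists>\<beta> \<in> ?J. \<exists>h \<in> Hom A (E \<beta>) M. \<phi> \<cdot>\<^bsub>A\<^esub> h \<noteq> Zer A (E \<beta>) N"
    if \<phi>: "\<phi> \<in> Hom A M N" and nz: "\<phi> \<noteq> Zer A M N" for M N \<phi>
  proof -
    have M: "M \<in> Obj A" and N: "N \<in> Obj A" using \<phi> by (auto simp: A.Hom_iff)
    let ?x = "Fobj j_up M" and ?y = "Fobj i_up M" and ?x' = "Fobj j_up N" and ?y' = "Fobj i_up N"
    have jM: "?x \<in> Obj X" and jN: "?x' \<in> Obj X" and iM: "?y \<in> Obj Y" and iN: "?y' \<in> Obj Y"
      using M N by simp_all
    note j\<phi> = j_up.Farr_Hom[OF \<phi>] and i\<phi> = i_up.Farr_Hom[OF \<phi>]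
    note uiM = i_adj.unit_Hom[OF M] and uiN = i_adj.unit_Hom[OF N] and ujM = j_adj.unit_Hom[OF M] and ujN = j_adj.unit_Hom[OF N]
    show ?thesis
    proof (cases "Farr j_up \<phi> = Zer X ?x ?x'")
      case False
      then obtain f where f: "f \<in> Hom X G\<^sub>X ?x" "Farr j_up \<phi> \<cdot>\<^bsub>X\<^esub> f \<noteq> Zer X G\<^sub>X ?x'"
        using GX j\<phi> unfolding is_generator_def by blast
      obtain s where s: "s \<in> Hom X H ?x" "s \<cdot>\<^bsub>X\<^esub> \<sigma> = f" using ext[OF f(1)] by blast
      have s0: "Farr j_up \<phi> \<cdot>\<^bsub>X\<^esub> s \<noteq> Zer X H ?x'"
      proof
        assume "Farr j_up \<phi> \<cdot>\<^bsub>X\<^esub> s = Zer X H ?x'"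
        then have "Farr j_up \<phi> \<cdot>\<^bsub>X\<^esub> f = Zer X H ?x' \<cdot>\<^bsub>X\<^esub> \<sigma>" using X.Cmp_assoc[OF \<sigma> s(1) j\<phi>] s(2) by simp
        then show False using f(2) \<sigma> jN by (simp add: X.Hom_iff)
      qed
      \<comment> \<open>The zero gluing map is compatible with any \<open>s\<close> together with the zero map on \<open>G\<^sub>Y\<close>.\<close>
      let ?b = "Zer Y G\<^sub>Y (?F H)" and ?g = "Zer Y G\<^sub>Y ?y"
      have b: "?b \<in> ?J" using Y.Zer_Hom[OF GYO FO(1)[OF H]] .
      have "?f s \<cdot>\<^bsub>Y\<^esub> ?b = Farr i_up (\<eta>j M) \<cdot>\<^bsub>Y\<^esub> ?g"
        using FH[OF s(1)] i_up.Farr_Hom[OF ujM] GYO by (simp add: Y.Hom_iff)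
      then obtain h where h: "h \<in> Hom A (E ?b) M" "\<eta>j M \<cdot>\<^bsub>A\<^esub> h = Farr j_lo s \<cdot>\<^bsub>A\<^esub> p ?b"
        using glue[OF M s(1) Y.Zer_Hom[OF GYO iM] b] by blast
      have "\<phi> \<cdot>\<^bsub>A\<^esub> h \<noteq> Zer A (E ?b) N"
      proof
        assume z: "\<phi> \<cdot>\<^bsub>A\<^esub> h = Zer A (E ?b) N"
        note js = j_lo.Farr_Hom[OF s(1)] and jj = j_lo.Farr_Hom[OF j\<phi>]
        have "Farr j_lo (Farr j_up \<phi> \<cdot>\<^bsub>X\<^esub> s) \<cdot>\<^bsub>A\<^esub> p ?b = Farr j_lo (Farr j_up \<phi>) \<cdot>\<^bsub>A\<^esub> (\<eta>j M \<cdot>\<^bsub>A\<^esub> h)"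
          using A.Cmp_assoc[OF p[OF b] js jj] j_lo.Farr_Cmp[OF s(1) j\<phi>] h(2) by simp
        also have "\<dots> = \<eta>j N \<cdot>\<^bsub>A\<^esub> (\<phi> \<cdot>\<^bsub>A\<^esub> h)"
          using A.Cmp_assoc[OF h(1) ujM jj] A.Cmp_assoc[OF h(1) \<phi> ujN] j_adj.unit_natural[OF \<phi>] by simp
        also have "\<dots> = Zer A (E ?b) (Fobj j_lo ?x')" unfolding z using ujN EO[OF b] by (simp add: A.Hom_iff)
        finally show False using p_faithful[OF b X.Cmp_Hom[OF s(1) j\<phi>]] s0 by blast
      qed
      then show ?thesis using b h(1) by blast
    next
      case True
      then have i0: "Farr i_up \<phi> \<noteq> Zer Y ?y ?y'" using jointly_faithful[OF \<phi>] nz by blast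
      have small: "is_set \<kappa> (Hom X H ?x)" using smallX H jM unfolding hom_sets_def by blast
      obtain I :: "'u set" and e where I: "is_set \<kappa> I" "bij_betw e I (Hom X H ?x)"
        using small_set_indexed[OF card small] by blast
      have e: "e i \<in> Hom X H ?x" if "i \<in> I" for i using bij_betwE[OF I(2)] that by blast
      have e_surj: "\<exists>i \<in> I. e i = s" if "s \<in> Hom X H ?x" for s
        using bij_betw_imp_surj_on[OF I(2)] that by (metis imageE)
      have "\<exists>i \<in> I. \<exists>g \<in> Hom Y G\<^sub>Y ?y. \<exists>\<beta> \<in> ?J.
          ?f (e i) \<cdot>\<^bsub>Y\<^esub> \<beta> = Farr i_up (\<eta>j M) \<cdot>\<^bsub>Y\<^esub> g \<and> Farr i_up \<phi> \<cdot>\<^bsub>Y\<^esub> g \<noteq> Zer Y G\<^sub>Y ?y'"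
      proof (rule Y.generator_lifts_along_directed_family[OF ab3Y exY I(1) _ FH[OF e] _ _ GY i_up.Farr_Hom[OF ujM] i\<phi> i0])
        show "I \<noteq> {}" using e_surj[OF X.Zer_Hom[OF H jM]] by blast
        show "\<exists>k \<in> I. (\<exists>w \<in> Hom Y (?F H) (?F H). ?f (e k) \<cdot>\<^bsub>Y\<^esub> w = ?f (e i)) \<and> (\<exists>w \<in> Hom Y (?F H) (?F H). ?f (e k) \<cdot>\<^bsub>Y\<^esub> w = ?f (e j))"
          if i: "i \<in> I" and j: "j \<in> I" for i j
        proof -
          obtain z w w' where z: "z \<in> Hom X H ?x" and w: "w \<in> Hom X H H" "z \<cdot>\<^bsub>X\<^esub> w = e i"
            and w': "w' \<in> Hom X H H" "z \<cdot>\<^bsub>X\<^esub> w' = e j" using dir[OF e[OF i] e[OF j]] by blast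
          obtain k where k: "k \<in> I" "e k = z" using e_surj[OF z] by blast
          have "?f z \<cdot>\<^bsub>Y\<^esub> ?f w = ?f (e i)" "?f z \<cdot>\<^bsub>Y\<^esub> ?f w' = ?f (e j)"
            using i_up.Farr_Cmp[OF j_lo.Farr_Hom[OF w(1)] j_lo.Farr_Hom[OF z]] j_lo.Farr_Cmp[OF w(1) z] w(2)
              i_up.Farr_Cmp[OF j_lo.Farr_Hom[OF w'(1)] j_lo.Farr_Hom[OF z]] j_lo.Farr_Cmp[OF w'(1) z] w'(2) by simp_all
          then show ?thesis using k FH[OF w(1)] FH[OF w'(1)] by blast
        qed
        show "t = Zer Y (?F ?x) T"
          if t: "t \<in> Hom Y (?F ?x) T" "\<forall>i \<in> I. t \<cdot>\<^bsub>Y\<^esub> ?f (e i) = Zer Y (?F H) T" for T t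
          using jointly_epi[OF jM t(1)] t(2) e_surj by blast
      qed
      then obtain i g \<beta> where i: "i \<in> I" and g: "g \<in> Hom Y G\<^sub>Y ?y" and b: "\<beta> \<in> ?J"
        and sb: "?f (e i) \<cdot>\<^bsub>Y\<^esub> \<beta> = Farr i_up (\<eta>j M) \<cdot>\<^bsub>Y\<^esub> g" and g0: "Farr i_up \<phi> \<cdot>\<^bsub>Y\<^esub> g \<noteq> Zer Y G\<^sub>Y ?y'"
        by blast
      obtain h where h: "h \<in> Hom A (E \<beta>) M" "\<eta>i M \<cdot>\<^bsub>A\<^esub> h = Farr i_lo g \<cdot>\<^bsub>A\<^esub> q \<beta>"
        using glue[OF M e[OF i] g b sb] by blast
      have "\<phi> \<cdot>\<^bsub>A\<^esub> h \<noteq> Zer A (E \<beta>) N"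
      proof
        assume z: "\<phi> \<cdot>\<^bsub>A\<^esub> h = Zer A (E \<beta>) N"
        note ig = i_lo.Farr_Hom[OF g] and ii = i_lo.Farr_Hom[OF i\<phi>]
        have "Farr i_lo (Farr i_up \<phi> \<cdot>\<^bsub>Y\<^esub> g) \<cdot>\<^bsub>A\<^esub> q \<beta> = Farr i_lo (Farr i_up \<phi>) \<cdot>\<^bsub>A\<^esub> (\<eta>i M \<cdot>\<^bsub>A\<^esub> h)"
          using A.Cmp_assoc[OF q[OF b] ig ii] i_lo.Farr_Cmp[OF g i\<phi>] h(2) by simp
        also have "\<dots> = \<eta>i N \<cdot>\<^bsub>A\<^esub> (\<phi> \<cdot>\<^bsub>A\<^esub> h)"
          using A.Cmp_assoc[OF h(1) uiM ii] A.Cmp_assoc[OF h(1) \<phi> uiN] i_adj.unit_natural[OF \<phi>] by simp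
        also have "\<dots> = Zer A (E \<beta>) (Fobj i_lo ?y')" unfolding z using uiN EO[OF b] by (simp add: A.Hom_iff)
        finally have "Farr i_lo (Farr i_up \<phi> \<cdot>\<^bsub>Y\<^esub> g) = Farr i_lo (Zer Y G\<^sub>Y ?y')"
          using A.epi_zero[OF q_epi[OF b] q[OF b] i_lo.Farr_Hom[OF Y.Cmp_Hom[OF g i\<phi>]]] GYO iN by simp
        then show False
          using i_lo.fully_faithful_faithful[OF i_lo_fully_faithful Y.Cmp_Hom[OF g i\<phi>] Y.Zer_Hom[OF GYO iN]] g0 by blast
      qed
      then show ?thesis using b h(1) by blast
    qed
  qed
  have "is_set \<kappa> ?J" using smallY GYO FO(1)[OF H] unfolding hom_sets_def by blast
  then show ?thesis by (rule A.small_separating_family_imp_generator[OF card ab3A _ EO separating])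
qed

text \<open>Arrows from \<open>G\<close> to the image of \<open>j_lo\<close> factor through the unit at \<open>G\<close>, so the arrows from
  \<open>j_lo (j_up G)\<close> detect at least as much as those from \<open>G\<close>.\<close>

lemma ess_image_j_lo_subset_Gen:
  assumes card: "Card_order \<kappa>" and ab3: "AB3 \<kappa> A" and small: "hom_sets \<kappa> A" and G: "is_generator A G"
  shows "ess_image X A j_lo \<subseteq> Gen \<kappa> A (Fobj j_lo (Fobj j_up G))"
proof
  fix B assume "B \<in> ess_image X A j_lo"
  then obtain x f where x: "x \<in> Obj X" and B: "B \<in> Obj A" and f: "f \<in> Hom A (Fobj j_lo x) B" "is_iso A f"
    unfolding ess_image_def isomorphic_def by blast
  obtain f' where f': "f' \<in> Hom A B (Fobj j_lo x)" "f \<cdot>\<^bsub>A\<^esub> f' = Ide A B" using A.iso_inverse[OF f(2,1)] by blast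
  have GO: "G \<in> Obj A" using G unfolding is_generator_def by blast
  let ?G = "Fobj j_lo (Fobj j_up G)"
  have GO': "?G \<in> Obj A" using GO by simp
  note u = j_adj.unit_Hom[OF GO]
  have "\<exists>h \<in> Hom A ?G B. t \<cdot>\<^bsub>A\<^esub> h \<noteq> Zer A ?G T" if t: "t \<in> Hom A B T" "t \<noteq> Zer A B T" for T t
  proof -
    obtain h where h: "h \<in> Hom A G B" "t \<cdot>\<^bsub>A\<^esub> h \<noteq> Zer A G T" using G t unfolding is_generator_def by blast
    obtain k where k: "k \<in> Hom X (Fobj j_up G) x" "Farr j_lo k \<cdot>\<^bsub>A\<^esub> \<eta>j G = f' \<cdot>\<^bsub>A\<^esub> h"
      using j_adj.transpose_exists[OF A.Cmp_Hom[OF h(1) f'(1)] x] .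
    note jk = j_lo.Farr_Hom[OF k(1)]
    note fk = A.Cmp_Hom[OF jk f(1)]
    have "(f \<cdot>\<^bsub>A\<^esub> Farr j_lo k) \<cdot>\<^bsub>A\<^esub> \<eta>j G = (f \<cdot>\<^bsub>A\<^esub> f') \<cdot>\<^bsub>A\<^esub> h"
      using A.Cmp_assoc[OF u jk f(1)] A.Cmp_assoc[OF h(1) f'(1) f(1)] k(2) by simp
    then have e: "(f \<cdot>\<^bsub>A\<^esub> Farr j_lo k) \<cdot>\<^bsub>A\<^esub> \<eta>j G = h" using f'(2) A.Cmp_Ide_left[OF h(1)] by simp
    have "t \<cdot>\<^bsub>A\<^esub> (f \<cdot>\<^bsub>A\<^esub> Farr j_lo k) \<noteq> Zer A ?G T"
    proof
      assume "t \<cdot>\<^bsub>A\<^esub> (f \<cdot>\<^bsub>A\<^esub> Farr j_lo k) = Zer A ?G T"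
      then have "t \<cdot>\<^bsub>A\<^esub> h = Zer A ?G T \<cdot>\<^bsub>A\<^esub> \<eta>j G" using A.Cmp_assoc[OF u fk t(1)] e by simp
      then show False using h(2) u t(1) by (simp add: A.Hom_iff)
    qed
    then show ?thesis using fk by blast
  qed
  then show "B \<in> Gen \<kappa> A ?G" using A.Gen_iff[OF card ab3 small GO' B] by blast
qed

end

theorem proposition4p9:
  fixes \<kappa> :: "'u rel"
    and A :: "('oa, 'ma) addcat" and Y :: "('oy, 'my) addcat" and X :: "('ox, 'mx) addcat"
  assumes "size_cardinal \<kappa>"
    and "abelian_category A" and "abelian_category Y" and "abelian_category X"
    and "hom_sets \<kappa> A" and "hom_sets \<kappa> Y" and "hom_sets \<kappa> X"
    and "ext1_sets \<kappa> A" and "ext1_sets \<kappa> Y" and "ext1_sets \<kappa> X"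
    and "recollement A Y X i_up i_lo i_up_sh j_lo_sh j_up j_lo"
    and "exact_functor A Y i_up"
    and "AB3 \<kappa> A"
  shows "grothendieck_category \<kappa> A \<longleftrightarrow>
    grothendieck_category \<kappa> X \<and> grothendieck_category \<kappa> Y \<and>
    (\<exists>G. is_generator X G \<and> ess_image X A j_lo \<subseteq> Gen \<kappa> A (Fobj j_lo G))"
proof -
  interpret exact_recollement A Y X i_up i_lo i_up_sh j_lo_sh j_up j_lo
    using assms by (intro exact_recollement.intro exact_recollement_axioms.intro)
  have card: "Card_order \<kappa>" using assms(1) unfolding size_cardinal_def by blast
  show ?thesis
  proof
    assume gA: "grothendieck_category \<kappa> A"
    then obtain G where G: "is_generator A G" and lim: "direct_limits_exact \<kappa> A"
      unfolding grothendieck_category_def AB5_def by blast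
    have GX: "is_generator X (Fobj j_up G)" using j_adj.generator_reflective[OF j_lo_fully_faithful G] .
    have "grothendieck_category \<kappa> X"
      unfolding grothendieck_category_def AB5_def
      using assms(4) GX j_adj.AB3_reflective[OF j_lo_fully_faithful assms(13)]
        jsh_adj.direct_limits_exact_reflected[OF j_lo_sh_exact j_lo_sh_fully_faithful lim] by blast
    moreover have "grothendieck_category \<kappa> Y"
      unfolding grothendieck_category_def AB5_def
      using assms(3) i_adj.generator_reflective[OF i_lo_fully_faithful G]
        i_adj.AB3_reflective[OF i_lo_fully_faithful assms(13)]
        ish_adj.direct_limits_exact_reflected[OF i_lo_exact i_lo_fully_faithful lim] by blast
    ultimately show "grothendieck_category \<kappa> X \<and> grothendieck_category \<kappa> Y \<and>
        (\<exists>G. is_generator X G \<and> ess_image X A j_lo \<subseteq> Gen \<kappa> A (Fobj j_lo G))"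
      using GX ess_image_j_lo_subset_Gen[OF card assms(13,5) G] by blast
  next
    assume R: "grothendieck_category \<kappa> X \<and> grothendieck_category \<kappa> Y \<and>
        (\<exists>G. is_generator X G \<and> ess_image X A j_lo \<subseteq> Gen \<kappa> A (Fobj j_lo G))"
    then obtain GX GY where GX: "is_generator X GX" "ess_image X A j_lo \<subseteq> Gen \<kappa> A (Fobj j_lo GX)"
      and GY: "is_generator Y GY" and X: "AB3 \<kappa> X" "direct_limits_exact \<kappa> X" and Y: "AB3 \<kappa> Y" "direct_limits_exact \<kappa> Y"
      unfolding grothendieck_category_def AB5_def by blast
    show "grothendieck_category \<kappa> A"
      unfolding grothendieck_category_def AB5_def
      using assms(2,13) direct_limits_exact_middle[OF X(2) Y(2)]
        generator_middle[OF assms(1,5,7,6,13) X(1) Y(1,2) GX(1) GY GX(2)] by blast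
  qed
qed

end
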